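(* Let $d\ge 1$ be an integer and let $K\in\mathbb{R}^{d\times d}$ be an invertible covariance matrix (hence symmetric positive definite). Let $G\sim\mathcal{N}_d(0,K)$, and let $F$ be a random vector in $\mathbb{R}^d$ which is conditionally Gaussian with respect to a $\sigma$-field $\mathcal{F}$, with conditional covariance matrix $A\in\mathbb{R}^{d\times d}$. Assume that $\mathbb{E}[\|A\|_{HS}^8]<\infty$, $\mathbb{P}(\det A>0)=1$ and $\mathbb{E}[\|A^{-1}\|_{HS}^2]<\infty$. Then $$D(F\|G)\le C_1\,\|\mathbb{E}[A]-K\|_{HS}^2+C_2\,\mathbb{E}\big[\|A-K\|_{HS}^8\big]^{1/2},$$ where $$C_1=\frac{\sqrt{3}}{12\sqrt{2}}\,S_d\,\|K^{-1}\|_{HS}^2,$$ $$C_2=\frac{1}{\lambda(K)^4}\Big\{8\|K\|_{HS}\,\mathbb{E}[\|A^{-1}\|_{HS}^2]^{1/2}+8\|K^{-1}\|_{HS}\,\mathbb{E}[\|A\|_{HS}^2]^{1/2}+\frac{\sqrt{2}}{\sqrt{3}}\,S_d\,\|K^{-1}\|_{HS}^2\big(\lambda(K)^2+4\|K\|_{HS}^2\big)+\sqrt{70}\,d^2\Big(\frac12 M_K+\frac{(\sqrt2+1)d}{4}\Big)+c_0\,d^2\Big\},$$ with $S_d=2\sqrt6+3\sqrt2+2+\sqrt d$, $c_0=3+\frac{\sqrt3}{8}+5\sqrt{10}+\frac{4\sqrt{30}}{3}+\frac{\sqrt{15}}{3}+\frac{10\sqrt5}{3}$, and $$M_K=\max\Big\{\Big|\log\frac{2^d\det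 K}{(2\|K\|_{op}+\lambda(K))^d}\Big|,\ \log\frac{2^d\det K}{\lambda(K)^d}\Big\}.$$
   Context: All random elements live on a probability space $(\Omega,\mathcal{A},\mathbb{P})$. $\mathcal{N}_d(m,\Sigma)$ is the Gaussian law on $\mathbb{R}^d$ with mean $m$ and covariance $\Sigma$. Conditionally Gaussian: an integrable random vector $X$ in $\mathbb{R}^d$ with $\mathbb{E}[X]=0$ is conditionally Gaussian with respect to a $\sigma$-field $\mathcal{F}\subseteq\mathcal{A}$ if there is an $\mathcal{F}$-measurable, positive semi-definite random matrix $A\in\mathbb{R}^{d\times d}$ (the conditional covariance matrix) such that, almost surely, $\mathbb{E}[e^{i\langle y,X\rangle}\mid\mathcal{F}]=e^{-\frac12\langle y,Ay\rangle}$ for every $y\in\mathbb{R}^d$. Relative entropy: if the law $\nu_Y$ of $Y$ is absolutely continuous with respect to the law $\nu_X$ of $X$, $D(Y\|X):=\int\log\big(\frac{d\nu_Y}{d\nu_X}\big)\,d\nu_Y$, with $0\log 0=0$. $\|M\|_{HS}$ is the Hilbert–Schmidt (Frobenius) norm, $\|M\|_{op}$ the Euclidean operator norm, and $\lambda(M)$ the smallest eigenvalue of $M$. *)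

theory Defs
  imports "HOL-Probability.Probability"
begin

text \<open>The norm of \<^typ>\<open>real ^ 'n ^ 'm\<close> is the Hilbert--Schmidt norm, not the operator norm;
  the latter is \<^const>\<open>onorm\<close>.\<close>

abbreviation hs_norm :: "real ^ 'n ^ 'm \<Rightarrow> real"
  where "hs_norm A \<equiv> norm A"

lemma hs_norm_eq: "hs_norm A = sqrt (\<Sum>i\<in>UNIV. \<Sum>j\<in>UNIV. (A $ i $ j)\<^sup>2)"
  by (simp add: norm_vec_def L2_set_def real_sqrt_pow2 sum_nonneg)

definition op_norm :: "real ^ 'n ^ 'm \<Rightarrow> real"
  where "op_norm A = onorm ((*v) A)"

definition eigenvalue_of :: "real ^ 'n ^ 'n \<Rightarrow> real \<Rightarrow> bool"
  where "eigenvalue_of A \<mu> \<longleftrightarrow> (\<exists>v. v \<noteq> 0 \<and> A *v v = \<mu> *\<^sub>R v)"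

text \<open>Meaningful for symmetric matrices, which have a smallest real eigenvalue.\<close>

definition min_eigenvalue :: "real ^ 'n ^ 'n \<Rightarrow> real"
  where "min_eigenvalue A = (LEAST \<mu>. eigenvalue_of A \<mu>)"

definition psd_matrix :: "real ^ 'n ^ 'n \<Rightarrow> bool"
  where "psd_matrix A \<longleftrightarrow> transpose A = A \<and> (\<forall>x. 0 \<le> x \<bullet> (A *v x))"

text \<open>Lebesgue density of the Gaussian law with mean \<open>m\<close> and covariance matrix \<open>K\<close>,
  for \<open>K\<close> symmetric positive definite.\<close>

definition mv_normal_density :: "real ^ 'n \<Rightarrow> real ^ 'n ^ 'n \<Rightarrow> real ^ 'n \<Rightarrow> real"
  where "mv_normal_density m K x =
    exp (- ((x - m) \<bullet> (matrix_inv K *v (x - m))) / 2) / sqrt ((2 * pi) ^ CARD('n) * det K)"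

definition complex_cond_exp ::
    "'a measure \<Rightarrow> 'a measure \<Rightarrow> ('a \<Rightarrow> complex) \<Rightarrow> 'a \<Rightarrow> complex"
  where "complex_cond_exp M \<F> f \<omega> =
    Complex (real_cond_exp M \<F> (\<lambda>\<omega>. Re (f \<omega>)) \<omega>) (real_cond_exp M \<F> (\<lambda>\<omega>. Im (f \<omega>)) \<omega>)"

text \<open>Conditional expectations are only determined up to null sets, separately for each \<open>y\<close>, so the
  quantifier over \<open>y\<close> stands outside. This is equivalent to asking that the conditional expectations
  have versions for which, almost surely, the identity holds for all \<open>y\<close> simultaneously.\<close>

definition cond_gaussian ::
    "'a measure \<Rightarrow> 'a measure \<Rightarrow> ('a \<Rightarrow> real ^ 'n) \<Rightarrow> ('a \<Rightarrow> real ^ 'n ^ 'n) \<Rightarrow> bool"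
  where "cond_gaussian M \<F> X A \<longleftrightarrow>
    subalgebra M \<F> \<and>
    integrable M X \<and> (\<integral>\<omega>. X \<omega> \<partial>M) = 0 \<and>
    A \<in> borel_measurable \<F> \<and> (AE \<omega> in M. psd_matrix (A \<omega>)) \<and>
    (\<forall>y. AE \<omega> in M. complex_cond_exp M \<F> (\<lambda>\<omega>. exp (\<i> * complex_of_real (y \<bullet> X \<omega>))) \<omega> =
                     complex_of_real (exp (- (y \<bullet> (A \<omega> *v y)) / 2)))"

text \<open>Relative entropy of \<open>\<nu>\<close> with respect to \<open>\<mu>\<close>, for probability measures, with values in
  \<open>[0, \<infinity>]\<close>. \<^const>\<open>KL_divergence\<close> takes the reference measure first and is a Bochner integral, hence
  \<open>0\<close> for non-integrable integrands. For \<open>\<nu>\<close> absolutely continuous, the negative part of the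
  logarithm of the Radon--Nikodym derivative is always \<open>\<nu>\<close>-integrable, so non-integrability
  means that the integral is \<open>\<infinity>\<close>.\<close>

definition relative_entropy :: "'b measure \<Rightarrow> 'b measure \<Rightarrow> ereal"
  where "relative_entropy \<nu> \<mu> =
    (if absolutely_continuous \<mu> \<nu> \<and> integrable \<nu> (entropy_density (exp 1) \<mu> \<nu>)
     then ereal (KL_divergence (exp 1) \<mu> \<nu>) else \<infinity>)"

definition S_const :: "nat \<Rightarrow> real"
  where "S_const d = 2 * sqrt 6 + 3 * sqrt 2 + 2 + sqrt (real d)"

definition c0_const :: real
  where "c0_const = 3 + sqrt 3 / 8 + 5 * sqrt 10 + 4 * sqrt 30 / 3 + sqrt 15 / 3 + 10 * sqrt 5 / 3"

definition M_const :: "real ^ 'n ^ 'n \<Rightarrow> real"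
  where "M_const K =
    max \<bar>ln (2 ^ CARD('n) * det K / (2 * op_norm K + min_eigenvalue K) ^ CARD('n))\<bar>
        (ln (2 ^ CARD('n) * det K / min_eigenvalue K ^ CARD('n)))"

definition C1_const :: "real ^ 'n ^ 'n \<Rightarrow> real"
  where "C1_const K = sqrt 3 / (12 * sqrt 2) * S_const CARD('n) * (hs_norm (matrix_inv K))\<^sup>2"

definition C2_const :: "'a measure \<Rightarrow> ('a \<Rightarrow> real ^ 'n ^ 'n) \<Rightarrow> real ^ 'n ^ 'n \<Rightarrow> real"
  where "C2_const M A K =
    1 / min_eigenvalue K ^ 4 *
    (8 * hs_norm K * sqrt (\<integral>\<omega>. (hs_norm (matrix_inv (A \<omega>)))\<^sup>2 \<partial>M)
     + 8 * hs_norm (matrix_inv K) * sqrt (\<integral>\<omega>. (hs_norm (A \<omega>))\<^sup>2 \<partial>M)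
     + sqrt 2 / sqrt 3 * S_const CARD('n) * (hs_norm (matrix_inv K))\<^sup>2
         * ((min_eigenvalue K)\<^sup>2 + 4 * (hs_norm K)\<^sup>2)
     + sqrt 70 * (real CARD('n))\<^sup>2
         * (1 / 2 * M_const K + (sqrt 2 + 1) * real CARD('n) / 4)
     + c0_const * (real CARD('n))\<^sup>2)"

end

theory Submission
  imports Defs
begin

text \<open>Write \<open>\<phi>\<^sub>S\<close> for the density of the centred Gaussian law with covariance \<open>S\<close>, \<open>\<lambda>\<close> for the smallest
  eigenvalue of \<open>K\<close>, and \<open>W\<close> for the square root of \<open>E |A - K|^8\<close>. By uniqueness of characteristic
  functions, a conditionally Gaussian vector has the mixture density \<open>f = E \<phi>\<^sub>A\<close>
  (\<open>distr_eq_mixture\<close>). Convexity of the relative entropy alone bounds \<open>D(F \<parallel> G)\<close> by the mean of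
  \<open>D(N(0, A) \<parallel> N(0, K))\<close>, which is of second order in \<open>A - K\<close>; the theorem asks for second order only
  in the mean \<open>E A - K\<close> and for fourth order in the fluctuation. The gain comes from the fact that
  mixing averages the densities before their distance to \<open>\<phi>\<^sub>K\<close> is measured.

  Split the probability space into the event \<open>|A - K| \<le> \<lambda> / 2\<close>, of probability \<open>q\<close>, and its
  complement. Convexity separates the two parts (\<open>mixture_log_ratio_le\<close>).

  On the complement, the Gaussian relative entropy is at most half of \<open>tr (A\<inverse> K) + tr (K\<inverse> A)\<close>, and
  the Cauchy--Schwarz inequality together with \<open>sqrt (1 - q) \<le> 16 W / \<lambda>^4\<close> produces the first two
  summands of \<open>C2\<close>.

  On the event near \<open>K\<close>, the bound \<open>ln t \<le> t - 1\<close> replaces the entropy by a chi-square distance, which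
  is a double integral over two independent copies \<open>A\<close>, \<open>A'\<close>. With \<open>D = (A - K) K\<inverse>\<close> and likewise
  \<open>D'\<close>, the Gaussian integral is explicit: \<open>\<integral> \<phi>\<^sub>A \<phi>\<^sub>A' / \<phi>\<^sub>K\<close> is the inverse square root of
  \<open>det (1 - D D')\<close>, and on the near event this is at most \<open>1 + tr (D D') / 2 + 2 |D|^2 |D'|^2\<close>
  (\<open>gaussian_product_integral_le\<close>). After integration the middle term factorizes into
  \<open>tr (E D E D) / 2\<close>, quadratic in the mean, and the last one becomes \<open>2 (E |D|^2)^2\<close>, which is of
  fourth order. Truncation to the near event costs further multiples of \<open>W\<close>, and all of them are
  absorbed by the remaining summands of \<open>C2\<close>.\<close>

section \<open>The spectral theorem for real symmetric matrices\<close>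

text \<open>A maximizer of the Rayleigh quotient on the unit sphere of an invariant subspace is an eigenvector:
  the first-order variation of the quotient vanishes there.\<close>

lemma max_rayleigh_eigenvector:
  fixes f :: "'a::euclidean_space \<Rightarrow> 'a"
  assumes lin: "linear f" and sym: "\<And>x y. f x \<bullet> y = x \<bullet> f y"
    and S: "subspace S" "f ` S \<subseteq> S" "S \<noteq> {0}"
  obtains v \<mu> where "v \<in> S" "norm v = 1" "f v = \<mu> *\<^sub>R v"
proof -
  let ?C = "S \<inter> sphere 0 1"
  have "compact ?C"
    by (rule closed_Int_compact[OF closed_subspace[OF S(1)] compact_sphere])
  obtain u where u: "u \<in> S" "u \<noteq> 0"
    using S(3) subspace_0[OF S(1)] by auto
  then have "u /\<^sub>R norm u \<in> ?C"
    using S(1) by (simp add: subspace_scale)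
  then have "?C \<noteq> {}" by blast
  moreover have "continuous_on ?C (\<lambda>x. x \<bullet> f x)"
    using linear_continuous_on[of f] lin
    by (intro continuous_intros) (simp add: linear_conv_bounded_linear)
  ultimately obtain v where v: "v \<in> ?C" and max: "\<And>x. x \<in> ?C \<Longrightarrow> x \<bullet> f x \<le> v \<bullet> f v"
    using continuous_attains_sup[OF \<open>compact ?C\<close>] by blast
  define \<mu> where "\<mu> = v \<bullet> f v"
  have le: "x \<bullet> f x \<le> \<mu> * (x \<bullet> x)" if "x \<in> S" for x
  proof (cases "x = 0")
    case False
    then have "x /\<^sub>R norm x \<in> ?C"
      using S(1) that by (simp add: subspace_scale)
    from max[OF this] have "(x \<bullet> f x) / (norm x)\<^sup>2 \<le> \<mu>"
      by (simp add: \<mu>_def linear_scale[OF lin] divide_inverse power2_eq_square algebra_simps)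
    then show ?thesis
      using False by (simp add: pos_divide_le_eq power2_norm_eq_inner)
  qed simp
  define w where "w = f v - \<mu> *\<^sub>R v"
  have vS: "v \<in> S" "v \<bullet> v = 1" "norm v = 1"
    using v by (auto simp: power2_norm_eq_inner[symmetric])
  have wS: "w \<in> S"
    unfolding w_def using vS S by (intro subspace_diff subspace_scale) auto
  define a where "a = w \<bullet> w"
  define c where "c = \<mu> * (w \<bullet> w) - w \<bullet> f w"
  \<comment> \<open>Maximality along the line \<open>v + t w\<close>, in the order \<open>t\<close> and \<open>t^2\<close>.\<close>
  have quad: "2 * t * a \<le> t\<^sup>2 * c" for t :: real
  proof -
    have "v + t *\<^sub>R w \<in> S"
      using vS wS S(1) by (intro subspace_add subspace_scale) auto
    from le[OF this] have "(v + t *\<^sub>R w) \<bullet> f (v + t *\<^sub>R w) \<le> \<mu> * ((v + t *\<^sub>R w) \<bullet> (v + t *\<^sub>R w))" .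
    moreover have "f (v + t *\<^sub>R w) = f v + t *\<^sub>R f w"
      by (simp add: linear_add[OF lin] linear_scale[OF lin])
    moreover have "v \<bullet> f w = f v \<bullet> w" using sym[of v w] by simp
    ultimately have "2 * t * (w \<bullet> f v - \<mu> * (w \<bullet> v)) \<le> t\<^sup>2 * c"
      using vS(2)
      by (simp add: \<mu>_def[symmetric] c_def inner_add_left inner_add_right inner_commute[of w v]
          inner_commute[of w "f v"] power2_eq_square algebra_simps)
    moreover have "w \<bullet> f v - \<mu> * (w \<bullet> v) = a"
      by (simp add: a_def w_def inner_diff_left inner_diff_right algebra_simps)
    ultimately show ?thesis by simp
  qed
  have "a \<le> 0"
  proof (rule ccontr)
    assume "\<not> a \<le> 0"
    then have a: "0 < a" by simp
    define t where "t = a / (\<bar>c\<bar> + 1)"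
    have t: "0 < t" using a by (simp add: t_def)
    have "2 * a \<le> t * c"
      using quad[of t] t by (simp add: power2_eq_square algebra_simps)
    also have "\<dots> \<le> t * (\<bar>c\<bar> + 1)"
      using t by (intro mult_left_mono) auto
    also have "\<dots> = a"
      unfolding t_def by simp
    finally show False using a by simp
  qed
  then have "w = 0"
    by (metis a_def inner_gt_zero_iff linorder_not_le)
  then have "f v = \<mu> *\<^sub>R v" by (simp add: w_def)
  then show thesis using that vS by blast
qed

text \<open>Split off one eigenvector and recurse into its orthogonal complement, which is again invariant
  because the map is self-adjoint. The basis is required to span rather than to have the right
  cardinality, so that the dimension is only needed as the induction measure.\<close>

lemma self_adjoint_orthonormal_eigenbasis:
  fixes f :: "'a::euclidean_space \<Rightarrow> 'a"
  assumes lin: "linear f" and sym: "\<And>x y. f x \<bullet> y = x \<bullet> f y"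
    and S: "subspace S" "f ` S \<subseteq> S"
  shows "\<exists>B\<subseteq>S. pairwise orthogonal B \<and> (\<forall>b\<in>B. norm b = 1 \<and> (\<exists>\<mu>. f b = \<mu> *\<^sub>R b)) \<and> S \<subseteq> span B"
  using S
proof (induction "dim S" arbitrary: S rule: less_induct)
  case less
  show ?case
  proof (cases "S = {0}")
    case True
    then show ?thesis by (intro exI[of _ "{}"]) auto
  next
    case False
    obtain v \<mu> where v: "v \<in> S" "norm v = 1" "f v = \<mu> *\<^sub>R v"
      using max_rayleigh_eigenvector[OF lin sym less.prems False] by metis
    have vv: "v \<bullet> v = 1" using v(2) by (simp add: power2_norm_eq_inner[symmetric])
    define T where "T = S \<inter> {x. v \<bullet> x = 0}"
    have T: "subspace T"
      unfolding T_def by (rule subspace_inter[OF less.prems(1) subspace_hyperplane])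
    have "v \<notin> T" using vv by (auto simp: T_def)
    then have "T \<subset> S" using v(1) unfolding T_def by blast
    then have dimT: "dim T < dim S"
      using T less.prems(1) by (metis dim_psubset span_eq_iff)
    have inv: "f ` T \<subseteq> T"
    proof
      fix y assume "y \<in> f ` T"
      then obtain x where x: "x \<in> S" "v \<bullet> x = 0" "y = f x" by (auto simp: T_def)
      have "v \<bullet> f x = f v \<bullet> x" using sym by simp
      then show "y \<in> T" using x v less.prems(2) by (auto simp: T_def)
    qed
    obtain B where B: "B \<subseteq> T" "pairwise orthogonal B"
      "\<forall>b\<in>B. norm b = 1 \<and> (\<exists>\<mu>. f b = \<mu> *\<^sub>R b)" "T \<subseteq> span B"
      using less.hyps[OF dimT T inv] by metis
    have "S \<subseteq> span (insert v B)"
    proof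
      fix x assume x: "x \<in> S"
      have "x - (v \<bullet> x) *\<^sub>R v \<in> T"
        using x v(1) less.prems(1) vv
        by (auto simp: T_def inner_diff_right intro!: subspace_diff subspace_scale)
      then show "x \<in> span (insert v B)"
        using B(4) span_breakdown_eq by blast
    qed
    moreover have "pairwise orthogonal (insert v B)"
      using B(1,2) by (auto simp: pairwise_insert orthogonal_def T_def inner_commute)
    ultimately show ?thesis
      using B v \<open>T \<subset> S\<close> by (intro exI[of _ "insert v B"]) auto
  qed
qed

definition diag_matrix :: "('n \<Rightarrow> real) \<Rightarrow> real ^ 'n ^ 'n"
  where "diag_matrix d = (\<chi> i j. if i = j then d i else 0)"

lemma diag_matrix_mult_vec: "diag_matrix d *v x = (\<chi> i. d i * x $ i)"
  by (simp add: diag_matrix_def matrix_vector_mult_def vec_eq_iff if_distrib[where f = "\<lambda>z. z * _"] cong: if_cong)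

lemma det_diag_matrix: "det (diag_matrix d) = prod d UNIV"
  by (subst det_diagonal) (auto simp: diag_matrix_def)

lemma trace_diag_matrix: "trace (diag_matrix d) = sum d UNIV"
  by (simp add: trace_def diag_matrix_def)

lemma diag_matrix_mult: "diag_matrix c ** diag_matrix d = diag_matrix (\<lambda>i. c i * d i)"
  by (simp add: diag_matrix_def matrix_matrix_mult_def vec_eq_iff if_distrib[where f = "\<lambda>z. z * _"] cong: if_cong)

lemma transpose_diag_matrix [simp]: "transpose (diag_matrix d) = diag_matrix d"
  by (auto simp: diag_matrix_def transpose_def vec_eq_iff)

lemma inner_matrix_vector_transpose:
  fixes A :: "real ^ 'n ^ 'm"
  shows "(A *v x) \<bullet> y = x \<bullet> (transpose A *v y)"
  by (metis dot_lmul_matrix inner_commute vector_transpose_matrix)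

theorem symmetric_matrix_diagonalization:
  fixes A :: "real ^ 'n ^ 'n"
  assumes A: "transpose A = A"
  obtains U d where "orthogonal_matrix U" "A = U ** diag_matrix d ** transpose U"
proof -
  have "f x \<bullet> y = x \<bullet> f y" if "f = (*v) A" for f x y
    using that by (simp add: inner_matrix_vector_transpose A)
  then obtain B where B: "pairwise orthogonal B"
      "\<forall>b\<in>B. norm b = 1 \<and> (\<exists>\<mu>. A *v b = \<mu> *\<^sub>R b)" "UNIV \<subseteq> span B"
    using self_adjoint_orthonormal_eigenbasis[of "(*v) A" UNIV] by auto
  have "0 \<notin> B" using B(2) by force
  then have ind: "independent B"
    using B(1) pairwise_orthogonal_independent by blast
  have "card B = CARD('n)"
    using basis_card_eq_dim[of B UNIV] B(3) ind by simp
  then obtain h where h: "bij_betw h (UNIV :: 'n set) B"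
    using independent_imp_finite[OF ind] by (metis bij_betw_iff_card finite)
  define d where "d j = (SOME \<mu>. A *v h j = \<mu> *\<^sub>R h j)" for j
  have hB: "h j \<in> B" for j
    using h by (auto simp: bij_betw_def)
  have eig: "A *v h j = d j *\<^sub>R h j" for j
    unfolding d_def using B(2) hB[of j] by (metis (mono_tags, lifting) someI_ex)
  define U where "U = (\<chi> i j. h j $ i)"
  have col: "column j U = h j" for j
    by (simp add: U_def column_def vec_eq_iff)
  have "orthogonal_matrix U"
    unfolding orthogonal_matrix_orthonormal_columns col
    using B(1,2) hB h by (auto simp: pairwise_def bij_betw_def inj_eq)
  moreover have "A ** U = U ** diag_matrix d"
  proof -
    have "(A ** U) $ i $ j = (A *v h j) $ i" for i j
      by (simp add: matrix_matrix_mult_def matrix_vector_mult_def U_def)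
    moreover have "(U ** diag_matrix d) $ i $ j = d j * h j $ i" for i j
      by (simp add: matrix_matrix_mult_def diag_matrix_def U_def if_distrib[where f = "\<lambda>z. _ * z"] cong: if_cong)
    ultimately show ?thesis
      by (simp add: vec_eq_iff eig)
  qed
  ultimately have "A = U ** diag_matrix d ** transpose U"
    by (metis matrix_mul_assoc matrix_mul_rid orthogonal_matrix_def)
  with \<open>orthogonal_matrix U\<close> show thesis using that by blast
qed

section \<open>Positive definite matrices\<close>

text \<open>Products with a transpose are kept in the form \<open>transpose A *v x\<close>, on which the adjointness rule
  \<open>inner_matrix_vector_transpose\<close> operates.\<close>

declare transpose_matrix_vector [simp del]

definition pos_def :: "real ^ 'n ^ 'n \<Rightarrow> bool"
  where "pos_def A \<longleftrightarrow> transpose A = A \<and> (\<forall>x. x \<noteq> 0 \<longrightarrow> 0 < x \<bullet> (A *v x))"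

lemma quadratic_form_congruence:
  "x \<bullet> ((U ** B ** transpose U) *v x) = (transpose U *v x) \<bullet> (B *v (transpose U *v (x :: real ^ 'n)))"
  by (simp add: matrix_vector_mul_assoc[symmetric] inner_matrix_vector_transpose)

lemma quadratic_form_diag_matrix: "x \<bullet> (diag_matrix d *v x) = (\<Sum>i\<in>UNIV. d i * (x $ i)\<^sup>2)"
  by (simp add: diag_matrix_mult_vec inner_vec_def power2_eq_square mult_ac)

lemma orthogonal_matrix_inverses:
  assumes "orthogonal_matrix (U :: real ^ 'n ^ 'n)"
  shows "U ** transpose U = mat 1" "transpose U ** U = mat 1"
  using assms by (simp_all add: orthogonal_matrix_def)

lemma det_orthogonal_congruence:
  assumes U: "orthogonal_matrix (U :: real ^ 'n ^ 'n)"
  shows "det (U ** B ** transpose U) = det B"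
proof -
  have "det U * det U = 1"
    using arg_cong[OF orthogonal_matrix_inverses(1)[OF U], of det] by (simp add: det_mul)
  then show ?thesis by (simp add: det_mul)
qed

lemma trace_orthogonal_congruence:
  assumes U: "orthogonal_matrix (U :: real ^ 'n ^ 'n)"
  shows "trace (U ** B ** transpose U) = trace B"
  using orthogonal_matrix_inverses(2)[OF U] by (metis matrix_mul_assoc matrix_mul_lid trace_mul_sym)

lemma eigenvalue_eq_quadratic_form:
  assumes U: "orthogonal_matrix (U :: real ^ 'n ^ 'n)" and A: "A = U ** diag_matrix d ** transpose U"
  shows "(U *v axis i 1) \<bullet> (A *v (U *v axis i 1)) = d i" "U *v axis i 1 \<noteq> 0"
    "A *v (U *v axis i 1) = d i *\<^sub>R (U *v axis i 1)"
proof -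
  have inv: "transpose U *v (U *v x) = x" for x
    by (simp add: matrix_vector_mul_assoc orthogonal_matrix_inverses[OF U])
  have ax: "diag_matrix d *v axis i 1 = d i *\<^sub>R axis i 1"
    by (auto simp: diag_matrix_mult_vec axis_def vec_eq_iff)
  show eig: "A *v (U *v axis i 1) = d i *\<^sub>R (U *v axis i 1)"
    by (simp add: A matrix_vector_mul_assoc[symmetric] inv ax matrix_vector_mult_scaleR)
  show "U *v axis i 1 \<noteq> 0"
    using inv[of "axis i 1"] by (metis axis_eq_0_iff matrix_vector_mult_0_right zero_neq_one)
  show "(U *v axis i 1) \<bullet> (A *v (U *v axis i 1)) = d i"
    unfolding eig by (simp add: inner_matrix_vector_transpose inv inner_axis_axis)
qed

lemma psd_diagonalization:
  assumes "psd_matrix (A :: real ^ 'n ^ 'n)"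
  obtains U d where "orthogonal_matrix U" "A = U ** diag_matrix d ** transpose U" "\<And>i. 0 \<le> d i"
  using assms symmetric_matrix_diagonalization[of A] eigenvalue_eq_quadratic_form(1)
  unfolding psd_matrix_def by metis

lemma pos_def_imp_psd: "pos_def A \<Longrightarrow> psd_matrix A"
  unfolding pos_def_def psd_matrix_def by (metis inner_zero_left less_eq_real_def)

lemma pos_def_diagonalization:
  assumes "pos_def (A :: real ^ 'n ^ 'n)"
  obtains U d where "orthogonal_matrix U" "A = U ** diag_matrix d ** transpose U" "\<And>i. 0 < d i"
  using assms symmetric_matrix_diagonalization[of A] eigenvalue_eq_quadratic_form(1,2)
  unfolding pos_def_def by metis

lemma pos_def_factorization:
  assumes "pos_def (A :: real ^ 'n ^ 'n)"
  obtains U s where "orthogonal_matrix U" "\<And>i. 0 < s i"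
    "A = (U ** diag_matrix s) ** transpose (U ** diag_matrix s)"
proof -
  obtain U d where U: "orthogonal_matrix U" "A = U ** diag_matrix d ** transpose U" "\<And>i. 0 < d i"
    using pos_def_diagonalization[OF assms] by blast
  have "diag_matrix d = diag_matrix (\<lambda>i. sqrt (d i)) ** diag_matrix (\<lambda>i. sqrt (d i))"
    using U(3) by (simp add: diag_matrix_mult less_imp_le)
  then have "A = (U ** diag_matrix (\<lambda>i. sqrt (d i))) ** transpose (U ** diag_matrix (\<lambda>i. sqrt (d i)))"
    by (simp add: U(2) matrix_transpose_mul matrix_mul_assoc)
  then show thesis using that[OF U(1), of "\<lambda>i. sqrt (d i)"] U(3) by simp
qed

lemma pos_def_det_pos: "pos_def (A :: real ^ 'n ^ 'n) \<Longrightarrow> 0 < det A"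
  by (metis pos_def_diagonalization det_orthogonal_congruence det_diag_matrix prod_pos)

lemma pos_def_invertible: "pos_def (A :: real ^ 'n ^ 'n) \<Longrightarrow> invertible A"
  using pos_def_det_pos by (force simp: invertible_det_nz)

text \<open>The eigenvalues are nonnegative and their product is not zero, so all of them are positive.\<close>

lemma psd_det_nonzero_imp_pos_def:
  assumes psd: "psd_matrix (A :: real ^ 'n ^ 'n)" and det: "det A \<noteq> 0"
  shows "pos_def A"
proof -
  obtain U d where U: "orthogonal_matrix U" "A = U ** diag_matrix d ** transpose U" "\<And>i. 0 \<le> d i"
    using psd_diagonalization[OF psd] by blast
  have "prod d UNIV \<noteq> 0"
    using det unfolding U(2) det_orthogonal_congruence[OF U(1)] det_diag_matrix .
  then have d: "0 < d i" for i
    using U(3)[of i] by (simp add: less_le)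
  have "0 < x \<bullet> (A *v x)" if "x \<noteq> 0" for x
  proof -
    let ?y = "transpose U *v x"
    have "?y \<noteq> 0"
    proof
      assume "?y = 0"
      then have "U *v ?y = 0" by simp
      then show False
        using that by (simp add: matrix_vector_mul_assoc orthogonal_matrix_inverses[OF U(1)])
    qed
    then obtain i where "?y $ i \<noteq> 0" by (auto simp: vec_eq_iff)
    then have "0 < (\<Sum>i\<in>UNIV. d i * (?y $ i)\<^sup>2)"
      using d less_imp_le[OF d] by (intro sum_pos2[of UNIV i]) auto
    then show ?thesis
      by (simp only: U(2) quadratic_form_congruence quadratic_form_diag_matrix)
  qed
  then show ?thesis using psd by (simp add: pos_def_def psd_matrix_def)
qed

lemma matrix_inv_inverses:
  assumes "invertible (A :: real ^ 'n ^ 'n)"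
  shows "A ** matrix_inv A = mat 1" "matrix_inv A ** A = mat 1"
  using assms unfolding invertible_def matrix_inv_def by (metis (mono_tags, lifting) someI_ex)+

lemma matrix_inv_eqI:
  assumes "A ** B = mat 1" shows "matrix_inv (A :: real ^ 'n ^ 'n) = B"
proof -
  have "invertible A" using assms invertible_right_inverse by blast
  then have "matrix_inv A = matrix_inv A ** (A ** B)" by (simp add: assms)
  also have "\<dots> = B" by (simp add: matrix_mul_assoc matrix_inv_inverses \<open>invertible A\<close>)
  finally show ?thesis .
qed

lemma transpose_matrix_inv:
  assumes "invertible (A :: real ^ 'n ^ 'n)" "transpose A = A"
  shows "transpose (matrix_inv A) = matrix_inv A"
  using matrix_inv_inverses(2)[OF assms(1)] assms(2)
  by (intro matrix_inv_eqI[symmetric]) (metis matrix_transpose_mul transpose_mat)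

lemma pos_def_matrix_inv:
  assumes A: "pos_def (A :: real ^ 'n ^ 'n)"
  shows "pos_def (matrix_inv A)"
proof -
  note inv = matrix_inv_inverses[OF pos_def_invertible[OF A]]
  have "0 < x \<bullet> (matrix_inv A *v x)" if "x \<noteq> 0" for x
  proof -
    define y where "y = matrix_inv A *v x"
    have "A *v y = x" by (simp add: y_def matrix_vector_mul_assoc inv)
    moreover from this that have "y \<noteq> 0" by auto
    ultimately show ?thesis
      using A unfolding pos_def_def y_def[symmetric] by (metis inner_commute)
  qed
  then show ?thesis
    using A transpose_matrix_inv[OF pos_def_invertible[OF A]] by (simp add: pos_def_def)
qed

text \<open>With \<open>w = A\<inverse> x\<close>, expanding \<open>0 \<le> (w - y) \<bullet> A (w - y)\<close> gives
  \<open>x \<bullet> A\<inverse> x \<ge> 2 (x \<bullet> y) - y \<bullet> A y\<close> for every \<open>y\<close>; the choice \<open>y = K\<inverse> x / c\<close> is optimal for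
  \<open>c K\<close> in place of \<open>A\<close>.\<close>

lemma pos_def_inverse_antimono:
  fixes A K :: "real ^ 'n ^ 'n"
  assumes A: "pos_def A" and K: "pos_def K" and c: "0 < c"
    and le: "\<And>y. y \<bullet> (A *v y) \<le> c * (y \<bullet> (K *v y))"
  shows "1 / c * (x \<bullet> (matrix_inv K *v x)) \<le> x \<bullet> (matrix_inv A *v x)"
proof -
  define w where "w = matrix_inv A *v x"
  define v where "v = matrix_inv K *v x"
  define s where "s = x \<bullet> v"
  have Aw: "A *v w = x" and Kv: "K *v v = x"
    using matrix_inv_inverses(1)[OF pos_def_invertible[OF A]] matrix_inv_inverses(1)[OF pos_def_invertible[OF K]]
    by (simp_all add: w_def v_def matrix_vector_mul_assoc)
  define y where "y = (1 / c) *\<^sub>R v"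
  have symA: "y \<bullet> (A *v w) = w \<bullet> (A *v y)"
    using A inner_matrix_vector_transpose[of A y w] by (simp add: pos_def_def inner_commute)
  have "0 \<le> (w - y) \<bullet> (A *v (w - y))"
    using pos_def_imp_psd[OF A] by (simp add: psd_matrix_def)
  also have "\<dots> = w \<bullet> x - 2 * (x \<bullet> y) + y \<bullet> (A *v y)"
    using symA by (simp add: matrix_vector_mult_diff_distrib inner_diff_left inner_diff_right Aw inner_commute)
  also have "y \<bullet> (A *v y) \<le> c * (y \<bullet> (K *v y))" by (rule le)
  also have "c * (y \<bullet> (K *v y)) = 1 / c * s"
    using c by (simp add: y_def s_def matrix_vector_mult_scaleR Kv inner_commute)
  also have "x \<bullet> y = 1 / c * s" by (simp add: y_def s_def)
  finally show ?thesis by (simp add: s_def v_def w_def inner_commute)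
qed

text \<open>In the coordinates of an orthonormal eigenbasis the eigenvalues are exactly the diagonal entries,
  so the least eigenvalue exists and is the minimum of a finite set of positive numbers.\<close>

lemma pos_def_min_eigenvalue:
  assumes K: "pos_def (K :: real ^ 'n ^ 'n)"
  shows "0 < min_eigenvalue K" "min_eigenvalue K * (norm x)\<^sup>2 \<le> x \<bullet> (K *v x)"
proof -
  obtain U d where U: "orthogonal_matrix U" "K = U ** diag_matrix d ** transpose U" "\<And>i. 0 < d i"
    using pos_def_diagonalization[OF K] by blast
  have inv: "transpose U *v (U *v x) = x" "U *v (transpose U *v x) = x" for x
    by (simp_all add: matrix_vector_mul_assoc orthogonal_matrix_inverses[OF U(1)])
  have rng: "\<mu> \<in> range d" if ev: "eigenvalue_of K \<mu>" for \<mu>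
  proof -
    obtain v where v: "v \<noteq> 0" "K *v v = \<mu> *\<^sub>R v" using ev by (auto simp: eigenvalue_of_def)
    define y where "y = transpose U *v v"
    have "y \<noteq> 0"
      using inv(2)[of v] v(1) by (auto simp: y_def)
    then obtain i where i: "y $ i \<noteq> 0" by (auto simp: vec_eq_iff)
    have "diag_matrix d *v y = transpose U *v (K *v v)"
      by (simp add: U(2) y_def matrix_vector_mul_assoc[symmetric] inv)
    also have "\<dots> = \<mu> *\<^sub>R y"
      by (simp add: v(2) y_def matrix_vector_mult_scaleR)
    finally have "d i * y $ i = \<mu> * y $ i"
      by (simp add: diag_matrix_mult_vec vec_eq_iff)
    then show ?thesis using i by auto
  qed
  have eig: "eigenvalue_of K (d i)" for i
    unfolding eigenvalue_of_def using eigenvalue_eq_quadratic_form(2,3)[OF U(1,2), of i] by blast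
  have "Min (range d) \<in> range d" by (rule Min_in) auto
  then obtain i0 where "Min (range d) = d i0" by (rule imageE)
  then have "eigenvalue_of K (Min (range d))" using eig by simp
  then have min: "min_eigenvalue K = Min (range d)"
    unfolding min_eigenvalue_def using rng by (intro Least_equality Min_le) auto
  then show "0 < min_eigenvalue K" using U(3) by simp
  have "min_eigenvalue K * (norm x)\<^sup>2 = min_eigenvalue K * (norm (transpose U *v x))\<^sup>2"
    by (simp add: power2_norm_eq_inner inner_matrix_vector_transpose inv)
  also have "\<dots> = (\<Sum>i\<in>UNIV. min_eigenvalue K * ((transpose U *v x) $ i)\<^sup>2)"
    by (simp add: norm_vec_def L2_set_def sum_nonneg sum_distrib_left)
  also have "\<dots> \<le> (\<Sum>i\<in>UNIV. d i * ((transpose U *v x) $ i)\<^sup>2)"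
    unfolding min by (intro sum_mono mult_right_mono) auto
  also have "\<dots> = x \<bullet> (K *v x)"
    by (simp only: U(2) quadratic_form_congruence quadratic_form_diag_matrix)
  finally show "min_eigenvalue K * (norm x)\<^sup>2 \<le> x \<bullet> (K *v x)" .
qed

lemma norm_matrix_inv_mult_le:
  assumes K: "pos_def (K :: real ^ 'n ^ 'n)"
  shows "norm (matrix_inv K *v x) \<le> 1 / min_eigenvalue K * norm x"
proof -
  define y where "y = matrix_inv K *v x"
  have Ky: "K *v y = x"
    using matrix_inv_inverses(1)[OF pos_def_invertible[OF K]]
    by (simp add: y_def matrix_vector_mul_assoc)
  have "min_eigenvalue K * (norm y)\<^sup>2 \<le> y \<bullet> x"
    using pos_def_min_eigenvalue(2)[OF K, of y] by (simp add: Ky)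
  also have "\<dots> \<le> norm y * norm x" by (rule norm_cauchy_schwarz)
  finally have "norm y * (min_eigenvalue K * norm y) \<le> norm y * norm x"
    by (simp add: power2_eq_square mult_ac)
  then have "min_eigenvalue K * norm y \<le> norm x"
    using norm_ge_zero[of x] by (cases "y = 0") (auto simp: mult_le_cancel_left)
  then show ?thesis
    using pos_def_min_eigenvalue(1)[OF K] by (simp add: y_def[symmetric] field_simps)
qed

section \<open>Hilbert--Schmidt norm, trace and determinant\<close>

lemma matrix_diff_ldistrib: "A ** (B - C) = A ** B - A ** (C :: real ^ 'n ^ 'm)"
  by (simp add: vec_eq_iff matrix_matrix_mult_def right_diff_distrib sum_subtractf)

lemma matrix_add_rdistrib: "(A + B) ** C = A ** C + B ** (C :: real ^ 'n ^ 'm)"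
  by (simp add: vec_eq_iff matrix_matrix_mult_def distrib_right sum.distrib)

lemma matrix_diff_rdistrib: "(A - B) ** C = A ** C - B ** (C :: real ^ 'n ^ 'm)"
  by (simp add: vec_eq_iff matrix_matrix_mult_def left_diff_distrib sum_subtractf)

lemma inner_matrix_eq_trace: "(A :: real ^ 'n ^ 'm) \<bullet> B = trace (A ** transpose B)"
  by (simp add: inner_vec_def trace_def matrix_matrix_mult_def transpose_def)

lemma trace_mat_1_inner: "(mat 1 :: real ^ 'n ^ 'n) \<bullet> B = trace B"
  by (metis inner_commute inner_matrix_eq_trace matrix_mul_rid transpose_mat)

lemma hs_norm_transpose: "hs_norm (transpose (A :: real ^ 'n ^ 'm)) = hs_norm A"
  unfolding hs_norm_eq transpose_def by (subst sum.swap) simp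

text \<open>The Hilbert--Schmidt norm is the Euclidean norm of the vector of column norms, and left
  multiplication acts on each column separately.\<close>

lemma hs_norm_mult_le_bound:
  fixes A :: "real ^ 'n ^ 'm" and B :: "real ^ 'k ^ 'n"
  assumes A: "\<And>x. norm (A *v x) \<le> c * norm x"
  shows "hs_norm (A ** B) \<le> c * hs_norm B"
proof -
  have c: "0 \<le> c"
    using order.trans[OF norm_ge_zero A, of "axis undefined 1"] by simp
  have col: "hs_norm C = sqrt (\<Sum>j\<in>UNIV. (norm (column j C))\<^sup>2)" for C :: "real ^ 'k ^ 'l"
    unfolding hs_norm_eq
    by (subst sum.swap) (simp add: column_def norm_vec_def L2_set_def sum_nonneg)
  have "column j (A ** B) = A *v column j B" for j
    by (simp add: column_def matrix_matrix_mult_def matrix_vector_mult_def vec_eq_iff)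
  then have "hs_norm (A ** B) \<le> sqrt (\<Sum>j\<in>UNIV. (c * norm (column j B))\<^sup>2)"
    unfolding col using A by (intro real_sqrt_le_mono sum_mono power_mono) auto
  also have "\<dots> = c * hs_norm B"
    using c unfolding col by (simp add: power_mult_distrib sum_distrib_left[symmetric] real_sqrt_mult)
  finally show ?thesis .
qed

lemma norm_matrix_vector_mult_le: "norm ((A :: real ^ 'n ^ 'm) *v x) \<le> hs_norm A * norm x"
proof -
  have "norm (A *v x) = sqrt (\<Sum>i\<in>UNIV. (A $ i \<bullet> x)\<^sup>2)"
    by (simp add: matrix_mult_dot norm_vec_def L2_set_def)
  also have "\<dots> \<le> sqrt (\<Sum>i\<in>UNIV. (norm (A $ i))\<^sup>2 * (norm x)\<^sup>2)"
    using Cauchy_Schwarz_ineq by (intro real_sqrt_le_mono sum_mono) (simp add: power2_norm_eq_inner)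
  also have "\<dots> = hs_norm A * norm x"
    by (simp add: sum_distrib_right[symmetric] real_sqrt_mult norm_vec_def[of A] L2_set_def)
  finally show ?thesis .
qed

lemma hs_norm_mult_le: "hs_norm ((A :: real ^ 'n ^ 'm) ** (B :: real ^ 'k ^ 'n)) \<le> hs_norm A * hs_norm B"
  by (rule hs_norm_mult_le_bound[OF norm_matrix_vector_mult_le])

lemma hs_norm_mult_matrix_inv_le:
  assumes K: "pos_def (K :: real ^ 'n ^ 'n)"
  shows "hs_norm (X ** matrix_inv K) \<le> 1 / min_eigenvalue K * hs_norm X"
proof -
  have "transpose (matrix_inv K) = matrix_inv K"
    using pos_def_matrix_inv[OF K] by (simp add: pos_def_def)
  then have "hs_norm (X ** matrix_inv K) = hs_norm (matrix_inv K ** transpose X)"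
    by (metis hs_norm_transpose matrix_transpose_mul)
  also have "\<dots> \<le> 1 / min_eigenvalue K * hs_norm (transpose X)"
    by (intro hs_norm_mult_le_bound norm_matrix_inv_mult_le K)
  finally show ?thesis by (simp add: hs_norm_transpose)
qed

lemma abs_trace_mult_le: "\<bar>trace ((A :: real ^ 'n ^ 'm) ** B)\<bar> \<le> hs_norm A * hs_norm B"
  using Cauchy_Schwarz_ineq2[of A "transpose B"] by (simp add: inner_matrix_eq_trace hs_norm_transpose)

lemma bounded_linear_matrix_mult_left: "bounded_linear (\<lambda>X. (X :: real ^ 'n ^ 'm) ** (B :: real ^ 'k ^ 'n))"
  unfolding linear_conv_bounded_linear[symmetric]
  by (rule linearI) (simp_all add: vec_eq_iff matrix_matrix_mult_def distrib_right sum.distrib sum_distrib_left mult.assoc)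

lemma bounded_linear_trace_mult: "bounded_linear (\<lambda>X. trace ((X :: real ^ 'n ^ 'm) ** B))"
  using bounded_linear_inner_left[of "transpose B"] by (simp add: inner_matrix_eq_trace)

text \<open>Apply \<open>t \<le> exp (t - 1)\<close> to every eigenvalue. The same inequality serves both parts of the main
  estimate: it bounds the logarithmic determinant in the Gaussian relative entropy, and through
  \<open>Q Q\<^sup>T\<close> it bounds the determinant of an arbitrary matrix \<open>Q\<close>, where no
  diagonalization is at hand.\<close>

lemma det_le_exp_trace:
  assumes "psd_matrix (P :: real ^ 'n ^ 'n)"
  shows "det P \<le> exp (trace P - CARD('n))"
proof -
  obtain U d where U: "orthogonal_matrix U" "P = U ** diag_matrix d ** transpose U" "\<And>i. 0 \<le> d i"
    using psd_diagonalization[OF assms] by blast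
  have "prod d UNIV \<le> (\<Prod>i\<in>UNIV. exp (d i - 1))"
    using U(3) exp_ge_add_one_self[of "d i - 1" for i] by (intro prod_mono) auto
  also have "\<dots> = exp (sum d UNIV - CARD('n))"
    by (simp add: exp_sum[symmetric] sum_subtractf)
  finally show ?thesis
    unfolding U(2) det_orthogonal_congruence[OF U(1)] trace_orthogonal_congruence[OF U(1)]
    by (simp add: det_diag_matrix trace_diag_matrix)
qed

lemma psd_gram: "psd_matrix (Q ** transpose (Q :: real ^ 'n ^ 'n))"
  unfolding psd_matrix_def
  by (simp add: matrix_transpose_mul matrix_vector_mul_assoc[symmetric])
    (metis inner_ge_zero inner_matrix_vector_transpose transpose_transpose)

lemma det_square_le_exp_hs_norm:
  "(det (Q :: real ^ 'n ^ 'n))\<^sup>2 \<le> exp ((hs_norm Q)\<^sup>2 - CARD('n))"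
  using det_le_exp_trace[OF psd_gram, of Q]
  unfolding power2_norm_eq_inner inner_matrix_eq_trace by (simp add: det_mul power2_eq_square)

text \<open>The product \<open>P K\<close> is not symmetric, but with \<open>K = L L\<^sup>T\<close> it has the same determinant and trace as
  the positive semidefinite matrix \<open>L\<^sup>T P L\<close>.\<close>

lemma det_mult_le_exp_trace:
  fixes P K :: "real ^ 'n ^ 'n"
  assumes P: "psd_matrix P" and K: "pos_def K"
  shows "det P * det K \<le> exp (trace (P ** K) - CARD('n))"
proof -
  obtain U s where "orthogonal_matrix U" "\<And>i. 0 < s i" and K: "K = (U ** diag_matrix s) ** transpose (U ** diag_matrix s)"
    using pos_def_factorization[OF K] by blast
  define L where "L = U ** diag_matrix s"
  have "psd_matrix (transpose L ** P ** L)"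
    using P unfolding psd_matrix_def
    by (simp add: matrix_transpose_mul matrix_mul_assoc)
      (simp add: matrix_vector_mul_assoc[symmetric] inner_matrix_vector_transpose[symmetric])
  from det_le_exp_trace[OF this]
  have "det (transpose L ** P ** L) \<le> exp (trace (transpose L ** P ** L) - CARD('n))" .
  moreover have "trace (transpose L ** P ** L) = trace (P ** K)"
    unfolding K L_def[symmetric] by (metis matrix_mul_assoc trace_mul_sym)
  moreover have "det (transpose L ** P ** L) = det P * det K"
    unfolding K L_def[symmetric] by (simp add: det_mul)
  ultimately show ?thesis by simp
qed

lemma trace_mult_pos_def_nonneg:
  fixes P K :: "real ^ 'n ^ 'n"
  assumes P: "psd_matrix P" and K: "pos_def K"
  shows "0 \<le> trace (P ** K)"
proof -
  obtain U s where "orthogonal_matrix U" "\<And>i. 0 < s i" and K: "K = (U ** diag_matrix s) ** transpose (U ** diag_matrix s)"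
    using pos_def_factorization[OF K] by blast
  define L where "L = U ** diag_matrix s"
  have "trace (P ** K) = trace (transpose L ** P ** L)"
    unfolding K L_def[symmetric] by (metis matrix_mul_assoc trace_mul_sym)
  also have "\<dots> = (\<Sum>i\<in>UNIV. axis i 1 \<bullet> ((transpose L ** P ** L) *v axis i 1))"
    by (simp add: trace_def matrix_vector_mult_basis inner_axis' column_def)
  also have "\<dots> = (\<Sum>i\<in>UNIV. (L *v axis i 1) \<bullet> (P *v (L *v axis i 1)))"
    by (simp add: matrix_vector_mul_assoc[symmetric] inner_matrix_vector_transpose)
  also have "0 \<le> \<dots>"
    using P by (intro sum_nonneg) (simp add: psd_matrix_def)
  finally show ?thesis .
qed

text \<open>From \<open>1 - t \<le> exp (- t)\<close> and the expansion of \<open>1 / (1 - t)\<close>.\<close>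

lemma exp_le_quadratic:
  fixes t :: real
  assumes "t \<le> 1 / 5" shows "exp t \<le> 1 + t + 5 / 4 * t\<^sup>2"
proof -
  have "exp t * (1 - t) \<le> exp t * exp (- t)"
    using exp_ge_add_one_self[of "- t"] by (intro mult_left_mono) auto
  then have "exp t * (1 - t) \<le> 1" by (simp add: exp_minus)
  then have "exp t \<le> 1 / (1 - t)"
    using assms by (simp add: pos_le_divide_eq)
  also have "\<dots> \<le> 1 + t + 5 / 4 * t\<^sup>2"
  proof -
    have "0 \<le> t\<^sup>2 * (1 / 4 - 5 / 4 * t)"
      using assms by (intro mult_nonneg_nonneg) auto
    then have "1 \<le> (1 + t + 5 / 4 * t\<^sup>2) * (1 - t)"
      by (simp add: algebra_simps power2_eq_square)
    then show ?thesis
      using assms by (simp add: pos_divide_le_eq)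
  qed
  finally show ?thesis .
qed

text \<open>A second-order expansion of the inverse square root of \<open>det (1 - N)\<close> with explicit constants. In
  the application \<open>N\<close> is a product of two matrices and not symmetric, so the determinant of the
  inverse \<open>Q\<close> is estimated through \<open>|Q|^2\<close>, which the Neumann identity
  \<open>Q = 1 + N + N (Q - 1)\<close> controls; \<open>m\<close> is then the product of the norms of the two factors.\<close>

lemma sqrt_det_inverse_le:
  fixes N Q :: "real ^ 'n ^ 'n"
  assumes Q: "(mat 1 - N) ** Q = mat 1"
    and N: "hs_norm N \<le> m" "\<bar>trace N\<bar> \<le> m" "m \<le> 1 / 4"
  shows "sqrt \<bar>det Q\<bar> \<le> 1 + trace N / 2 + 2 * m\<^sup>2"
proof -
  define E where "E = Q - mat 1"
  have QE: "Q = mat 1 + E" by (simp add: E_def)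
  have m0: "0 \<le> m" using N(1) norm_ge_zero order_trans by blast
  have E: "E = N + N ** E"
    using Q by (simp add: QE matrix_diff_rdistrib matrix_add_ldistrib algebra_simps)
  have "norm E \<le> norm N + norm (N ** E)"
    by (subst E) (rule norm_triangle_ineq)
  also have "\<dots> \<le> m + m * norm E"
    using N(1) hs_norm_mult_le[of N E] by (intro add_mono order.trans[OF hs_norm_mult_le] mult_right_mono) auto
  also have "\<dots> \<le> m + 1 / 4 * norm E"
    using N(3) by (intro add_left_mono mult_right_mono) auto
  finally have nE: "norm E \<le> 4 / 3 * m" by simp
  have "trace E = trace N + trace (N ** E)"
    by (subst E) (rule trace_add)
  also have "trace (N ** E) \<le> norm N * norm E"
    using abs_trace_mult_le[of N E] by simp
  also have "\<dots> \<le> m * (4 / 3 * m)"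
    using N(1) nE m0 by (intro mult_mono) auto
  finally have trE: "trace E \<le> trace N + 4 / 3 * m\<^sup>2"
    by (simp add: power2_eq_square)
  \<comment> \<open>The coefficient is \<open>(2 * 4/3 + (4/3)^2) / 4\<close>, from the bounds on \<open>trace E\<close> and \<open>norm E\<close>.\<close>
  define t where "t = trace N / 2 + 10 / 9 * m\<^sup>2"
  have "(norm Q)\<^sup>2 = CARD('n) + 2 * trace E + (norm E)\<^sup>2"
    unfolding QE power2_norm_eq_inner
    by (simp add: inner_add_left inner_add_right trace_mat_1_inner inner_commute[of E "mat 1"] trace_I)
  moreover have "(norm E)\<^sup>2 \<le> (4 / 3 * m)\<^sup>2"
    using nE by (intro power_mono) auto
  ultimately have "(norm Q)\<^sup>2 - CARD('n) \<le> 4 * t"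
    using trE by (simp add: t_def power2_eq_square)
  then have "(det Q)\<^sup>2 \<le> exp (4 * t)"
    using det_square_le_exp_hs_norm[of Q] by (meson exp_le_cancel_iff order_trans)
  also have "exp (4 * t) = (exp t) ^ 4"
    by (simp add: exp_of_nat_mult[symmetric])
  also have "(det Q)\<^sup>2 = (sqrt \<bar>det Q\<bar>) ^ 4"
    using power_mult[of "sqrt \<bar>det Q\<bar>" 2 2] by simp
  finally have "sqrt \<bar>det Q\<bar> \<le> exp t"
    by (subst (asm) power_mono_iff) auto
  also have "\<dots> \<le> 1 + t + 5 / 4 * t\<^sup>2"
  proof (rule exp_le_quadratic)
    show "t \<le> 1 / 5"
    proof -
      have "m * m \<le> 1 / 4 * m" using N(3) m0 by (intro mult_right_mono) auto
      then show ?thesis using N(2,3) by (simp add: t_def power2_eq_square)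
    qed
  qed
  also have "\<dots> \<le> 1 + trace N / 2 + 2 * m\<^sup>2"
  proof -
    have "m * m \<le> 1 / 4 * m" using N(3) m0 by (intro mult_right_mono) auto
    moreover have "0 \<le> m * m" by simp
    ultimately have "t \<le> 7 / 9 * m" "- (7 / 9 * m) \<le> t"
      using N(2) m0 unfolding t_def power2_eq_square by linarith+
    then have "\<bar>t\<bar> \<le> 7 / 9 * m" by linarith
    then have "\<bar>t\<bar>\<^sup>2 \<le> (7 / 9 * m)\<^sup>2" by (intro power_mono) auto
    then have "t\<^sup>2 \<le> 49 / 81 * m\<^sup>2" by (simp add: power2_eq_square)
    then show ?thesis using t_def zero_le_power2[of m] by linarith
  qed
  finally show ?thesis .
qed

section \<open>Measurability of matrix operations\<close>

lemma borel_measurable_vecI: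
  fixes f :: "'a \<Rightarrow> 'b::euclidean_space ^ 'n"
  assumes "\<And>i. (\<lambda>x. f x $ i) \<in> borel_measurable M"
  shows "f \<in> borel_measurable M"
proof (subst borel_measurable_euclidean_space, intro ballI)
  fix b :: "'b ^ 'n" assume "b \<in> Basis"
  then obtain i u where "b = axis i u" by (auto simp: Basis_vec_def)
  moreover note [measurable] = assms
  ultimately show "(\<lambda>x. f x \<bullet> b) \<in> borel_measurable M"
    by (simp add: inner_axis)
qed

lemma vec_nth_measurable [measurable (raw)]:
  fixes f :: "'a \<Rightarrow> 'b::euclidean_space ^ 'n"
  assumes "f \<in> borel_measurable M"
  shows "(\<lambda>x. f x $ i) \<in> borel_measurable M"
  using assms by (rule measurable_compose) (intro borel_measurable_continuous_onI continuous_intros)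

lemma det_measurable [measurable (raw)]:
  fixes f :: "'a \<Rightarrow> real ^ 'n ^ 'n"
  assumes [measurable]: "f \<in> borel_measurable M"
  shows "(\<lambda>x. det (f x)) \<in> borel_measurable M"
  unfolding det_def by measurable

lemma matrix_vector_mult_measurable2 [measurable (raw)]:
  fixes f :: "'a \<Rightarrow> real ^ 'n ^ 'm"
  assumes [measurable]: "f \<in> borel_measurable M" "g \<in> borel_measurable M"
  shows "(\<lambda>x. f x *v g x) \<in> borel_measurable M"
  by (rule borel_measurable_vecI) (simp add: matrix_vector_mult_def)

lemma matrix_matrix_mult_measurable [measurable (raw)]:
  fixes f :: "'a \<Rightarrow> real ^ 'n ^ 'm" and g :: "'a \<Rightarrow> real ^ 'k ^ 'n"
  assumes [measurable]: "f \<in> borel_measurable M" "g \<in> borel_measurable M"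
  shows "(\<lambda>x. f x ** g x) \<in> borel_measurable M"
  by (intro borel_measurable_vecI) (simp add: matrix_matrix_mult_def)

lemma trace_measurable [measurable (raw)]:
  fixes f :: "'a \<Rightarrow> real ^ 'n ^ 'n"
  assumes [measurable]: "f \<in> borel_measurable M"
  shows "(\<lambda>x. trace (f x)) \<in> borel_measurable M"
  unfolding trace_def by measurable

text \<open>Cramer's rule makes the inverse a rational function of the entries. For a singular matrix,
  \<^const>\<open>matrix_inv\<close> chooses from an empty set of inverses; this default does not depend on the
  matrix, so measurability holds on the whole space.\<close>

lemma matrix_inv_cases:
  "matrix_inv (A :: real ^ 'n ^ 'n) =
    (if det A = 0 then SOME B. False
     else (\<chi> k l. det (\<chi> i j. if j = k then axis l 1 $ i else A $ i $ j) / det A))"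
proof (cases "det A = 0")
  case True
  then have "\<not> invertible A" by (simp add: invertible_det_nz)
  then have "(\<lambda>B. A ** B = mat 1 \<and> B ** A = mat 1) = (\<lambda>B. False)"
    by (auto simp: invertible_def fun_eq_iff)
  then show ?thesis using True by (simp add: matrix_inv_def)
next
  case False
  then have inv: "A ** matrix_inv A = mat 1"
    by (simp add: matrix_inv_inverses invertible_det_nz)
  have "matrix_inv A *v axis l 1 = (\<chi> k. det (\<chi> i j. if j = k then axis l 1 $ i else A $ i $ j) / det A)" for l
    using cramer[OF False, of "matrix_inv A *v axis l 1" "axis l 1"]
    by (simp add: matrix_vector_mul_assoc inv)
  moreover have "(matrix_inv A *v axis l 1) $ k = matrix_inv A $ k $ l" for k l
    by (simp add: matrix_vector_mult_basis column_def)
  ultimately show ?thesis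
    using False by (simp add: vec_eq_iff)
qed

lemma matrix_inv_measurable [measurable (raw)]:
  fixes f :: "'a \<Rightarrow> real ^ 'n ^ 'n"
  assumes [measurable]: "f \<in> borel_measurable M"
  shows "(\<lambda>x. matrix_inv (f x)) \<in> borel_measurable M"
proof -
  have "(\<lambda>x. (\<chi> k l. det (\<chi> i j. if j = k then axis l 1 $ i else f x $ i $ j) / det (f x)) :: real ^ 'n ^ 'n)
      \<in> borel_measurable M"
  proof (intro borel_measurable_vecI)
    fix k l
    have "(\<lambda>x. (\<chi> i j. if j = k then axis l 1 $ i else f x $ i $ j) :: real ^ 'n ^ 'n) \<in> borel_measurable M"
      by (intro borel_measurable_vecI) simp
    then show "(\<lambda>x. (\<chi> k l. det (\<chi> i j. if j = k then axis l 1 $ i else f x $ i $ j) / det (f x)) $ k $ l) \<in> borel_measurable M"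
      by simp
  qed
  then show ?thesis
    unfolding matrix_inv_cases by measurable
qed

lemma mv_normal_density_measurable2 [measurable (raw)]:
  fixes f :: "'a \<Rightarrow> real ^ 'n ^ 'n"
  assumes [measurable]: "f \<in> borel_measurable M" "g \<in> borel_measurable M"
  shows "(\<lambda>x. mv_normal_density 0 (f x) (g x)) \<in> borel_measurable M"
  unfolding mv_normal_density_def by measurable

section \<open>Linear images of Lebesgue measure\<close>

text \<open>The uniqueness argument for Haar measure. Let \<open>B\<close> be the unit ball, which \<open>f\<close> preserves. By
  translation invariance in \<open>x\<close>, the integral of \<open>1\<^sub>A (f x + y) 1\<^sub>B (y)\<close> over \<open>x\<close> and \<open>y\<close> is the
  measure of \<open>f -` A\<close> times that of \<open>B\<close>; by translation invariance in \<open>y\<close>, it is the measure of \<open>A\<close>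
  times that of \<open>B\<close>.\<close>

lemma lborel_orthogonal_invariant:
  fixes f :: "'a::euclidean_space \<Rightarrow> 'a"
  assumes f: "orthogonal_transformation f"
  shows "distr lborel borel f = lborel"
proof (rule measure_eqI)
  fix A :: "'a set" assume "A \<in> sets (distr lborel borel f)"
  then have [measurable]: "A \<in> sets borel" by simp
  have lin: "linear f" using f by (rule orthogonal_transformation_linear)
  have [measurable]: "f \<in> borel_measurable borel"
    using lin by (intro borel_measurable_continuous_onI linear_continuous_on)
      (simp add: linear_conv_bounded_linear)
  have surj: "f (inv f y) = y" for y
    using orthogonal_transformation_surj[OF f] by (simp add: surj_f_inv_f)
  define B where "B = ball (0::'a) 1"
  have [measurable]: "B \<in> sets borel" by (simp add: B_def)
  have shift: "(\<integral>\<^sup>+ x. h (c + x) \<partial>lborel) = (\<integral>\<^sup>+ x. h x \<partial>lborel)" if [measurable]: "h \<in> borel_measurable borel"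
    for h and c :: 'a
    by (subst (2) lborel_distr_plus[symmetric, of c]) (simp add: nn_integral_distr)
  define J where "J = (\<integral>\<^sup>+ y. \<integral>\<^sup>+ x. indicator A (f x + y) * indicator B y \<partial>lborel \<partial>lborel)"
  have "(\<integral>\<^sup>+ x. indicator A (f x + y) * indicator B y \<partial>lborel) = emeasure lborel (f -` A) * indicator B y" for y
  proof -
    have "(\<integral>\<^sup>+ x. indicator A (f x + y) * indicator B y \<partial>lborel)
        = (\<integral>\<^sup>+ x. indicator A (f (inv f y + x)) \<partial>lborel) * indicator B y"
      by (simp add: nn_integral_multc linear_add[OF lin] surj add.commute)
    also have "(\<integral>\<^sup>+ x. indicator A (f (inv f y + x)) \<partial>lborel) = (\<integral>\<^sup>+ x. indicator (f -` A) x \<partial>lborel)"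
      by (subst shift[of "\<lambda>x. indicator A (f x)"], measurable)
        (intro nn_integral_cong, simp split: split_indicator)
    also have "\<dots> = emeasure lborel (f -` A)"
      using measurable_sets_borel[of f borel A] by (intro nn_integral_indicator) simp
    finally show ?thesis by simp
  qed
  then have J1: "J = emeasure lborel (f -` A) * emeasure lborel B"
    by (simp add: J_def nn_integral_cmult)
  have "J = (\<integral>\<^sup>+ x. \<integral>\<^sup>+ y. indicator A (f x + y) * indicator B y \<partial>lborel \<partial>lborel)"
    unfolding J_def by (rule lborel_pair.Fubini') simp
  also have "\<dots> = (\<integral>\<^sup>+ x. \<integral>\<^sup>+ y. indicator A y * indicator B (y - f x) \<partial>lborel \<partial>lborel)"
    using shift[of "\<lambda>y. indicator A y * indicator B (y - f x)" "f x" for x] by simp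
  also have "\<dots> = (\<integral>\<^sup>+ y. \<integral>\<^sup>+ x. indicator A y * indicator B (y - f x) \<partial>lborel \<partial>lborel)"
    by (rule lborel_pair.Fubini') simp
  also have "\<dots> = (\<integral>\<^sup>+ y. indicator A y * emeasure lborel B \<partial>lborel)"
  proof (intro nn_integral_cong)
    fix y
    have "indicator B (y - f x) = (indicator (ball (inv f y) 1) x :: ennreal)" for x
    proof -
      have "norm (y - f x) = norm (inv f y - x)"
        using orthogonal_transformation_norm[OF f, of "inv f y - x"]
        by (simp add: linear_diff[OF lin] surj)
      then show ?thesis by (simp add: B_def indicator_def dist_norm norm_minus_commute[of "f x"])
    qed
    then have "(\<integral>\<^sup>+ x. indicator A y * indicator B (y - f x) \<partial>lborel)
        = (\<integral>\<^sup>+ x. indicator A y * indicator (ball (inv f y) 1) x \<partial>lborel)"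
      by simp
    also have "\<dots> = indicator A y * emeasure lborel (ball (inv f y) 1)"
      by (rule nn_integral_cmult_indicator) simp
    finally show "(\<integral>\<^sup>+ x. indicator A y * indicator B (y - f x) \<partial>lborel) = indicator A y * emeasure lborel B"
      by (simp add: B_def emeasure_ball)
  qed
  also have "\<dots> = emeasure lborel A * emeasure lborel B"
    by (simp add: nn_integral_multc)
  finally have "emeasure lborel (f -` A) * emeasure lborel B = emeasure lborel A * emeasure lborel B"
    using J1 by simp
  moreover have "emeasure lborel B \<noteq> 0" "emeasure lborel B \<noteq> \<infinity>"
    by (auto simp: B_def emeasure_ball unit_ball_vol_pos less_imp_neq[symmetric])
  ultimately have "emeasure lborel (f -` A) = emeasure lborel A"
    by (metis infinity_ennreal_def mult_divide_eq_ennreal)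
  then show "emeasure (distr lborel borel f) A = emeasure lborel A"
    by (simp add: emeasure_distr)
qed simp

lemma Basis_vec_range: "(Basis :: (real ^ 'n) set) = range (\<lambda>i. axis i 1)"
  by (auto simp: Basis_vec_def)

lemma inj_axis: "inj (\<lambda>i. axis i (1::real) :: real ^ 'n)"
  by (auto simp: inj_def axis_eq_axis)

lemma prod_Basis_vec: "prod h (Basis :: (real ^ 'n) set) = (\<Prod>i\<in>UNIV. h (axis i 1))"
  unfolding Basis_vec_range by (subst prod.reindex[OF inj_axis]) simp

lemma sum_Basis_vec: "sum h (Basis :: (real ^ 'n) set) = (\<Sum>i\<in>UNIV. h (axis i 1))"
  unfolding Basis_vec_range by (subst sum.reindex[OF inj_axis]) simp

text \<open>A rotation after a coordinatewise scaling: by the spectral theorem these linear maps suffice to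
  transport the standard Gaussian measure to every nondegenerate covariance.\<close>

lemma lborel_diag_orthogonal:
  fixes U :: "real ^ 'n ^ 'n"
  assumes U: "orthogonal_matrix U" and s: "\<And>i. 0 < s i"
  shows "lborel = density (distr lborel borel ((*v) (U ** diag_matrix s))) (\<lambda>_. ennreal (prod s UNIV))"
proof -
  define c where "c b = s (SOME i. b = axis i 1)" for b :: "real ^ 'n"
  have c: "c (axis i 1) = s i" for i by (simp add: c_def axis_eq_axis)
  let ?T = "\<lambda>x. 0 + (\<Sum>j\<in>Basis. (c j * (x \<bullet> j)) *\<^sub>R j)"
  have T: "?T = (*v) (diag_matrix s)"
    by (simp add: fun_eq_iff sum_Basis_vec diag_matrix_mult_vec vec_eq_iff c inner_axis)
      (simp add: axis_def if_distrib[where f = "\<lambda>z. _ * z"] cong: if_cong)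
  have pc: "(\<Prod>j\<in>Basis. \<bar>c j\<bar>) = prod s UNIV"
    using s by (simp add: prod_Basis_vec c abs_of_pos)
  have "c j \<noteq> 0" if "j \<in> Basis" for j
    using that c s by (metis (no_types) Basis_vec_range imageE less_irrefl)
  then have D: "lborel = density (distr lborel borel ((*v) (diag_matrix s))) (\<lambda>_. ennreal (prod s UNIV))"
    using lborel_affine_euclidean[of c 0] unfolding T pc by blast
  have "orthogonal_transformation ((*v) U)"
    using U by (simp add: orthogonal_transformation_matrix)
  from lborel_orthogonal_invariant[OF this]
  have "lborel = distr lborel borel ((*v) U)" by simp
  also have "\<dots> = distr (density (distr lborel borel ((*v) (diag_matrix s))) (\<lambda>_. ennreal (prod s UNIV))) borel ((*v) U)"
    by (subst D) simp
  also have "\<dots> = density (distr (distr lborel borel ((*v) (diag_matrix s))) borel ((*v) U)) (\<lambda>_. ennreal (prod s UNIV))"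
    by (simp add: density_distr)
  also have "distr (distr lborel borel ((*v) (diag_matrix s))) borel ((*v) U) = distr lborel borel ((*v) (U ** diag_matrix s))"
    by (subst distr_distr) (auto simp: comp_def matrix_vector_mul_assoc)
  finally show ?thesis .
qed

lemma integral_lborel_prod:
  fixes h :: "'a::euclidean_space \<Rightarrow> real \<Rightarrow> 'b::{real_normed_field, banach, second_countable_topology}"
  assumes h: "\<And>b. b \<in> Basis \<Longrightarrow> integrable lborel (h b)"
  shows "(\<integral>z. (\<Prod>b\<in>Basis. h b (z \<bullet> b)) \<partial>lborel) = (\<Prod>b\<in>Basis. \<integral>t. h b t \<partial>lborel)"
proof -
  interpret product_sigma_finite "\<lambda>_::'a. lborel :: real measure" by standard
  have [measurable]: "h b \<in> borel_measurable borel" if "b \<in> Basis" for b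
    using borel_measurable_integrable[OF h[OF that]] by simp
  have "(\<integral>z. (\<Prod>b\<in>Basis. h b (z \<bullet> b)) \<partial>lborel)
      = (\<integral>f. (\<Prod>b\<in>Basis. h b ((\<Sum>b\<in>Basis. f b *\<^sub>R b) \<bullet> b)) \<partial>(\<Pi>\<^sub>M b\<in>Basis. lborel))"
    by (subst lborel_eq) (simp add: integral_distr)
  also have "\<dots> = (\<integral>f. (\<Prod>b\<in>Basis. h b (f b)) \<partial>(\<Pi>\<^sub>M b\<in>Basis. lborel))"
    by (intro Bochner_Integration.integral_cong prod.cong refl) (simp add: inner_sum_left_Basis)
  also have "\<dots> = (\<Prod>b\<in>Basis. \<integral>t. h b t \<partial>lborel)"
    by (rule product_integral_prod[OF finite_Basis h])
  finally show ?thesis .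
qed

section \<open>Multivariate Gaussian measures\<close>

definition gaussian_measure :: "real ^ 'n ^ 'n \<Rightarrow> (real ^ 'n) measure"
  where "gaussian_measure A = density lborel (\<lambda>x. ennreal (mv_normal_density 0 A x))"

lemma sets_gaussian_measure [measurable_cong, simp]: "sets (gaussian_measure A) = sets borel"
  by (simp add: gaussian_measure_def)

lemma space_gaussian_measure [simp]: "space (gaussian_measure A) = UNIV"
  by (simp add: gaussian_measure_def)

lemma mv_normal_density_pos: "pos_def A \<Longrightarrow> 0 < mv_normal_density m A x"
  using pos_def_det_pos[of A] by (simp add: mv_normal_density_def)

lemma standard_density_eq_prod:
  "mv_normal_density 0 (mat 1) z = (\<Prod>i\<in>UNIV. std_normal_density (z $ i))" for z :: "real ^ 'n"
proof -
  have "matrix_inv (mat 1 :: real ^ 'n ^ 'n) = mat 1" by (rule matrix_inv_eqI) simp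
  moreover have "(\<Prod>i\<in>UNIV. std_normal_density (z $ i))
      = exp (\<Sum>i\<in>UNIV. - (z $ i)\<^sup>2 / 2) * (1 / sqrt (2 * pi)) ^ CARD('n)"
    by (simp add: std_normal_density_def prod_dividef exp_sum power_divide del: real_sqrt_mult)
  moreover have "(\<Sum>i\<in>UNIV. - (z $ i)\<^sup>2 / 2) = - (z \<bullet> z) / 2"
    by (simp add: inner_vec_def power2_eq_square sum_negf sum_divide_distrib)
  moreover have "sqrt (2 ^ CARD('n) * pi ^ CARD('n)) = sqrt (2 * pi) ^ CARD('n)"
    by (metis power_mult_distrib real_sqrt_power)
  ultimately show ?thesis
    by (simp add: mv_normal_density_def power_one_over del: real_sqrt_mult)
qed

lemma gaussian_measure_eq_distr:
  fixes U :: "real ^ 'n ^ 'n"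
  assumes U: "orthogonal_matrix U" and s: "\<And>i. 0 < s i"
    and A: "A = (U ** diag_matrix s) ** transpose (U ** diag_matrix s)"
  shows "gaussian_measure A = distr (gaussian_measure (mat 1)) borel ((*v) (U ** diag_matrix s))"
proof -
  define L where "L = U ** diag_matrix s"
  have detL: "(det L)\<^sup>2 = (prod s UNIV)\<^sup>2"
  proof -
    have "(det U)\<^sup>2 = 1"
      using arg_cong[OF orthogonal_matrix_inverses(1)[OF U], of det] by (simp add: det_mul power2_eq_square)
    then show ?thesis by (simp add: L_def det_mul det_diag_matrix power_mult_distrib)
  qed
  have ps: "0 < prod s UNIV" using s by (intro prod_pos) auto
  then have "det L \<noteq> 0" using detL by (metis less_irrefl zero_eq_power2)
  then have "invertible L" by (simp add: invertible_det_nz)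
  note Li = matrix_inv_inverses[OF this]
  have Ai: "matrix_inv A = transpose (matrix_inv L) ** matrix_inv L"
  proof (rule matrix_inv_eqI)
    have "A ** (transpose (matrix_inv L) ** matrix_inv L)
        = L ** (transpose L ** transpose (matrix_inv L)) ** matrix_inv L"
      by (simp add: A L_def[symmetric] matrix_mul_assoc)
    also have "transpose L ** transpose (matrix_inv L) = mat 1"
      by (simp add: matrix_transpose_mul[symmetric] Li transpose_mat)
    finally show "A ** (transpose (matrix_inv L) ** matrix_inv L) = mat 1"
      by (simp add: Li)
  qed
  have quad: "(L *v z) \<bullet> (matrix_inv A *v (L *v z)) = z \<bullet> z" for z
    by (simp add: Ai matrix_vector_mul_assoc[symmetric] inner_matrix_vector_transpose[symmetric])
      (simp add: matrix_vector_mul_assoc Li)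
  have dA: "det A = (prod s UNIV)\<^sup>2"
    using detL by (simp add: A L_def[symmetric] det_mul power2_eq_square)
  have dens: "ennreal (prod s UNIV) * ennreal (mv_normal_density 0 A (L *v z)) = ennreal (mv_normal_density 0 (mat 1) z)" for z
  proof -
    have "matrix_inv (mat 1 :: real ^ 'n ^ 'n) = mat 1" by (rule matrix_inv_eqI) simp
    then show ?thesis
      using ps less_imp_neq[OF s, symmetric] by (simp add: mv_normal_density_def quad dA ennreal_mult''[symmetric] real_sqrt_mult)
  qed
  have "gaussian_measure A = density (density (distr lborel borel ((*v) L)) (\<lambda>_. ennreal (prod s UNIV)))
      (\<lambda>x. ennreal (mv_normal_density 0 A x))"
    unfolding gaussian_measure_def L_def by (subst lborel_diag_orthogonal[OF U s]) rule
  also have "\<dots> = density (distr lborel borel ((*v) L)) (\<lambda>x. ennreal (prod s UNIV) * ennreal (mv_normal_density 0 A x))"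
    by (subst density_density_eq) auto
  also have "\<dots> = distr (density lborel (\<lambda>z. ennreal (mv_normal_density 0 (mat 1) z))) borel ((*v) L)"
    by (subst density_distr) (auto simp: dens)
  finally show ?thesis by (simp add: gaussian_measure_def L_def)
qed

lemma nn_integral_gaussian_prod:
  fixes h :: "'n::finite \<Rightarrow> real \<Rightarrow> real"
  assumes [measurable]: "\<And>i. h i \<in> borel_measurable borel" and nn: "\<And>i t. 0 \<le> h i t"
  shows "(\<integral>\<^sup>+ z. ennreal (\<Prod>i\<in>UNIV. h i (z $ i)) \<partial>gaussian_measure (mat 1))
    = (\<Prod>i\<in>UNIV. \<integral>\<^sup>+ t. ennreal (h i t) \<partial>std_normal_distribution)"
proof -
  define idx where "idx b = (SOME i. b = axis i 1)" for b :: "real ^ 'n"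
  have idx: "idx (axis i 1) = i" for i by (simp add: idx_def axis_eq_axis)
  have "(\<integral>\<^sup>+ z. ennreal (\<Prod>i\<in>UNIV. h i (z $ i)) \<partial>gaussian_measure (mat 1))
      = (\<integral>\<^sup>+ z. (\<Prod>b\<in>Basis. ennreal (std_normal_density (z \<bullet> b) * h (idx b) (z \<bullet> b))) \<partial>lborel)"
    unfolding gaussian_measure_def
    by (subst nn_integral_density)
      (auto intro!: nn_integral_cong simp: prod_Basis_vec idx inner_axis standard_density_eq_prod nn
        ennreal_mult''[symmetric] prod_nonneg prod_ennreal prod.distrib)
  also have "\<dots> = (\<Prod>b\<in>Basis. \<integral>\<^sup>+ t. ennreal (std_normal_density t * h (idx b) t) \<partial>lborel)"
    by (rule nn_integral_lborel_prod) auto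
  also have "\<dots> = (\<Prod>i\<in>UNIV. \<integral>\<^sup>+ t. ennreal (h i t) \<partial>std_normal_distribution)"
    by (simp add: prod_Basis_vec idx nn_integral_density nn ennreal_mult'')
  finally show ?thesis .
qed

lemma prob_space_gaussian_standard: "prob_space (gaussian_measure (mat 1 :: real ^ 'n ^ 'n))"
proof
  have "emeasure (gaussian_measure (mat 1 :: real ^ 'n ^ 'n)) UNIV
      = (\<integral>\<^sup>+ z. ennreal (\<Prod>i\<in>UNIV. (\<lambda>_ _. 1) i (z $ i)) \<partial>gaussian_measure (mat 1 :: real ^ 'n ^ 'n))"
    by simp
  also have "\<dots> = 1"
    using prob_space.emeasure_space_1[OF prob_space_normal_density[of 1 0]]
    by (subst nn_integral_gaussian_prod) auto
  finally show "emeasure (gaussian_measure (mat 1 :: real ^ 'n ^ 'n)) (space (gaussian_measure (mat 1))) = 1"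
    by simp
qed

lemma prob_space_gaussian:
  assumes "pos_def A" shows "prob_space (gaussian_measure A)"
proof -
  obtain U s where "orthogonal_matrix U" "\<And>i. 0 < s i"
    "A = (U ** diag_matrix s) ** transpose (U ** diag_matrix s)"
    using pos_def_factorization[OF assms] by blast
  from gaussian_measure_eq_distr[OF this] show ?thesis
    by (simp add: prob_space.prob_space_distr[OF prob_space_gaussian_standard])
qed

lemma nn_integral_mv_normal_density:
  "pos_def A \<Longrightarrow> (\<integral>\<^sup>+ x. ennreal (mv_normal_density 0 A x) \<partial>lborel) = 1"
  using prob_space.emeasure_space_1[OF prob_space_gaussian, of A]
  by (simp add: gaussian_measure_def emeasure_density)

text \<open>This is the normalization of the Gaussian density with covariance \<open>P\<inverse>\<close>.\<close>

lemma gaussian_integral: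
  fixes P :: "real ^ 'n ^ 'n"
  assumes P: "pos_def P"
  shows "(\<integral>\<^sup>+ x. ennreal (exp (- (x \<bullet> (P *v x)) / 2)) \<partial>lborel) = ennreal (sqrt ((2 * pi) ^ CARD('n) / det P))"
proof -
  let ?c = "sqrt ((2 * pi) ^ CARD('n) / det P)"
  note inv = matrix_inv_inverses[OF pos_def_invertible[OF P]]
  have inv2: "matrix_inv (matrix_inv P) = P" by (rule matrix_inv_eqI) (rule inv)
  have "det (matrix_inv P) * det P = 1"
    using arg_cong[OF inv(2), of det] by (simp add: det_mul)
  then have d: "det (matrix_inv P) = 1 / det P"
    using pos_def_det_pos[OF P] by (simp add: field_simps)
  have c: "0 < ?c" using pos_def_det_pos[OF P] by simp
  have "ennreal (exp (- (x \<bullet> (P *v x)) / 2)) = ennreal ?c * ennreal (mv_normal_density 0 (matrix_inv P) x)" for x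
    using c pos_def_det_pos[OF P] by (simp add: mv_normal_density_def inv2 d ennreal_mult'[symmetric])
  then have "(\<integral>\<^sup>+ x. ennreal (exp (- (x \<bullet> (P *v x)) / 2)) \<partial>lborel)
      = ennreal ?c * (\<integral>\<^sup>+ x. ennreal (mv_normal_density 0 (matrix_inv P) x) \<partial>lborel)"
    by (simp add: nn_integral_cmult)
  also have "(\<integral>\<^sup>+ x. ennreal (mv_normal_density 0 (matrix_inv P) x) \<partial>lborel) = 1"
    using prob_space.emeasure_space_1[OF prob_space_gaussian[OF pos_def_matrix_inv[OF P]]]
    by (simp add: gaussian_measure_def emeasure_density)
  finally show ?thesis by simp
qed

lemma char_gaussian_standard:
  "(CLINT z|gaussian_measure (mat 1). iexp (w \<bullet> z)) = complex_of_real (exp (- (w \<bullet> w) / 2))"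
  for w :: "real ^ 'n"
proof -
  define idx where "idx b = (SOME i. b = axis i 1)" for b :: "real ^ 'n"
  have idx: "idx (axis i 1) = i" for i by (simp add: idx_def axis_eq_axis)
  define h where "h b t = std_normal_density t *\<^sub>R iexp (w $ idx b * t)" for b t
  have inth: "integrable lborel (h b)" for b
    unfolding h_def
    by (rule Bochner_Integration.integrable_bound[where f = std_normal_density])
      (use integrable_std_normal_moment[of 0] in auto)
  have "(CLINT z|gaussian_measure (mat 1). iexp (w \<bullet> z))
      = (\<integral>z. (\<Prod>b\<in>Basis. h b (z \<bullet> b)) \<partial>lborel)"
  proof -
    have "mv_normal_density 0 (mat 1) z *\<^sub>R iexp (w \<bullet> z) = (\<Prod>b\<in>Basis. h b (z \<bullet> b))" for z :: "real ^ 'n"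
    proof -
      have "(\<Prod>b\<in>Basis. h b (z \<bullet> b)) = (\<Prod>i\<in>UNIV. std_normal_density (z $ i) *\<^sub>R iexp (w $ i * z $ i))"
        by (simp add: h_def prod_Basis_vec idx inner_axis)
      also have "\<dots> = (\<Prod>i\<in>UNIV. complex_of_real (std_normal_density (z $ i))) * iexp (w \<bullet> z)"
        by (simp add: scaleR_conv_of_real prod.distrib inner_vec_def exp_sum[symmetric] sum_distrib_left)
      finally show ?thesis
        by (simp add: standard_density_eq_prod scaleR_conv_of_real)
    qed
    then show ?thesis
      unfolding gaussian_measure_def
      by (subst integral_density) (auto simp: mv_normal_density_pos less_imp_le standard_density_eq_prod prod_nonneg)
  qed
  also have "\<dots> = (\<Prod>b\<in>Basis. \<integral>t. h b t \<partial>lborel)"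
    using inth by (rule integral_lborel_prod)
  also have "\<dots> = (\<Prod>b\<in>Basis. complex_of_real (exp (- (w $ idx b)\<^sup>2 / 2)))"
  proof (intro prod.cong refl)
    fix b :: "real ^ 'n"
    have "(\<integral>t. h b t \<partial>lborel) = char std_normal_distribution (w $ idx b)"
      unfolding char_def h_def by (subst integral_density) auto
    then show "(\<integral>t. h b t \<partial>lborel) = complex_of_real (exp (- (w $ idx b)\<^sup>2 / 2))"
      by (simp add: char_std_normal_distribution)
  qed
  also have "\<dots> = complex_of_real (exp (\<Sum>i\<in>UNIV. - (w $ i)\<^sup>2 / 2))"
    by (simp add: prod_Basis_vec idx exp_sum)
  also have "(\<Sum>i\<in>UNIV. - (w $ i)\<^sup>2 / 2) = - (w \<bullet> w) / 2"
    by (simp add: inner_vec_def power2_eq_square sum_negf sum_divide_distrib)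
  finally show ?thesis .
qed

lemma char_gaussian:
  fixes A :: "real ^ 'n ^ 'n"
  assumes "pos_def A"
  shows "(CLINT x|gaussian_measure A. iexp (y \<bullet> x)) = complex_of_real (exp (- (y \<bullet> (A *v y)) / 2))"
proof -
  obtain U s where U: "orthogonal_matrix U" "\<And>i. 0 < s i"
    and A: "A = (U ** diag_matrix s) ** transpose (U ** diag_matrix s)"
    using pos_def_factorization[OF assms] by blast
  let ?L = "U ** diag_matrix s"
  have "(CLINT x|gaussian_measure A. iexp (y \<bullet> x)) = (CLINT z|gaussian_measure (mat 1). iexp (y \<bullet> (?L *v z)))"
    unfolding gaussian_measure_eq_distr[OF U A] by (subst integral_distr) auto
  also have "\<dots> = (CLINT z|gaussian_measure (mat 1). iexp ((transpose ?L *v y) \<bullet> z))"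
    by (simp only: inner_matrix_vector_transpose transpose_transpose)
  also have "\<dots> = complex_of_real (exp (- ((transpose ?L *v y) \<bullet> (transpose ?L *v y)) / 2))"
    by (rule char_gaussian_standard)
  also have "(transpose ?L *v y) \<bullet> (transpose ?L *v y) = y \<bullet> (A *v y)"
    unfolding A by (simp only: inner_matrix_vector_transpose transpose_transpose matrix_vector_mul_assoc[symmetric])
  finally show ?thesis .
qed

lemma standard_gaussian_second_moment:
  "(\<integral>\<^sup>+ z. ennreal ((z $ i)\<^sup>2) \<partial>gaussian_measure (mat 1)) = 1" for i :: "'n::finite"
proof -
  have "(\<integral>\<^sup>+ z. ennreal ((z $ i)\<^sup>2) \<partial>gaussian_measure (mat 1))
      = (\<integral>\<^sup>+ z. ennreal (\<Prod>j\<in>UNIV. (if j = i then (z $ j)\<^sup>2 else 1)) \<partial>gaussian_measure (mat 1 :: real ^ 'n ^ 'n))"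
    by simp
  also have "\<dots> = (\<Prod>j\<in>UNIV. \<integral>\<^sup>+ t. ennreal (if j = i then t\<^sup>2 else 1) \<partial>std_normal_distribution)"
    by (rule nn_integral_gaussian_prod) auto
  also have "\<dots> = (\<Prod>j\<in>(UNIV :: 'n set). 1)"
  proof (intro prod.cong refl)
    fix j :: 'n
    have "(\<integral>\<^sup>+ t. ennreal (t\<^sup>2) \<partial>std_normal_distribution) = ennreal (\<integral>t. t ^ (2 * 1) \<partial>std_normal_distribution)"
      using std_normal_distribution_even_moments(2)[of 1] by (subst nn_integral_eq_integral) auto
    also have "\<dots> = 1"
      by (subst std_normal_distribution_even_moments(1)) (simp add: fact_numeral)
    finally show "(\<integral>\<^sup>+ t. ennreal (if j = i then t\<^sup>2 else 1) \<partial>std_normal_distribution) = 1"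
      using prob_space.emeasure_space_1[OF prob_space_normal_density[of 1 0]] by (cases "j = i") simp_all
  qed
  finally show ?thesis by simp
qed

lemma standard_gaussian_orthogonal_invariant:
  assumes V: "orthogonal_matrix (V :: real ^ 'n ^ 'n)"
  shows "distr (gaussian_measure (mat 1)) borel ((*v) V) = gaussian_measure (mat 1)"
proof -
  have 1: "diag_matrix (\<lambda>_. 1) = (mat 1 :: real ^ 'n ^ 'n)"
    by (simp add: diag_matrix_def mat_def)
  show ?thesis
    using gaussian_measure_eq_distr[OF V, of "\<lambda>_. 1" "mat 1"]
    by (simp add: 1 orthogonal_matrix_inverses[OF V])
qed

text \<open>Transport to the standard Gaussian measure, diagonalize the resulting form \<open>R\<close>, and rotate; what
  remains is a nonnegative combination of squared coordinates. All steps are identities between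
  nonnegative integrals.\<close>

lemma gaussian_quadratic_form_integral:
  fixes A P :: "real ^ 'n ^ 'n"
  assumes A: "pos_def A" and P: "psd_matrix P"
  shows "(\<integral>\<^sup>+ x. ennreal (x \<bullet> (P *v x)) \<partial>gaussian_measure A) = ennreal (trace (P ** A))"
proof -
  obtain U s where U: "orthogonal_matrix U" "\<And>i. 0 < s i"
    and A: "A = (U ** diag_matrix s) ** transpose (U ** diag_matrix s)"
    using pos_def_factorization[OF A] by blast
  define L where "L = U ** diag_matrix s"
  define R where "R = transpose L ** P ** L"
  have quad: "(L *v z) \<bullet> (P *v (L *v z)) = z \<bullet> (R *v z)" for z
    by (simp add: R_def matrix_vector_mul_assoc[symmetric] inner_matrix_vector_transpose)
  have "psd_matrix R"
    using P unfolding psd_matrix_def quad[symmetric]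
    by (simp add: R_def matrix_transpose_mul matrix_mul_assoc)
  then obtain V p where V: "orthogonal_matrix V" "R = V ** diag_matrix p ** transpose V" "\<And>i. 0 \<le> p i"
    using psd_diagonalization by blast
  have "(\<integral>\<^sup>+ x. ennreal (x \<bullet> (P *v x)) \<partial>gaussian_measure A)
      = (\<integral>\<^sup>+ z. ennreal (z \<bullet> (R *v z)) \<partial>gaussian_measure (mat 1))"
    unfolding gaussian_measure_eq_distr[OF U A] L_def[symmetric] by (subst nn_integral_distr) (auto simp: quad)
  also have "\<dots> = (\<integral>\<^sup>+ z. ennreal ((transpose V *v z) \<bullet> (diag_matrix p *v (transpose V *v z))) \<partial>gaussian_measure (mat 1))"
    by (simp only: V(2) quadratic_form_congruence)
  also have "\<dots> = (\<integral>\<^sup>+ z. ennreal (z \<bullet> (diag_matrix p *v z)) \<partial>gaussian_measure (mat 1))"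
    by (subst (2) standard_gaussian_orthogonal_invariant[symmetric, of "transpose V"])
      (auto simp: V(1) nn_integral_distr)
  also have "\<dots> = (\<integral>\<^sup>+ z. (\<Sum>i\<in>UNIV. ennreal (p i) * ennreal ((z $ i)\<^sup>2)) \<partial>gaussian_measure (mat 1))"
    using V(3) by (simp add: quadratic_form_diag_matrix sum_ennreal[symmetric] ennreal_mult del: sum_ennreal)
  also have "\<dots> = (\<Sum>i\<in>UNIV. ennreal (p i) * (\<integral>\<^sup>+ z. ennreal ((z $ i)\<^sup>2) \<partial>gaussian_measure (mat 1 :: real ^ 'n ^ 'n)))"
    by (simp add: nn_integral_sum nn_integral_cmult)
  also have "\<dots> = ennreal (sum p UNIV)"
    using V(3) by (simp add: standard_gaussian_second_moment)
  also have "sum p UNIV = trace (P ** A)"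
  proof -
    have "sum p UNIV = trace R"
      by (simp add: V(2) trace_orthogonal_congruence[OF V(1)] trace_diag_matrix)
    also have "\<dots> = trace (P ** A)"
      unfolding R_def A L_def[symmetric] by (metis matrix_mul_assoc trace_mul_sym)
    finally show ?thesis .
  qed
  finally show ?thesis .
qed

text \<open>The quadratic form of \<open>A\<inverse>\<close> and the dimension enter the exact logarithm with a favourable sign and
  are dropped. The bound is nonnegative and its integral against \<open>\<phi>\<^sub>A\<close> is half of
  \<open>tr (A\<inverse> K) + tr (K\<inverse> A)\<close>.\<close>

lemma ln_gaussian_density_ratio_le:
  fixes A K :: "real ^ 'n ^ 'n"
  assumes A: "pos_def A" and K: "pos_def K"
  shows "ln (mv_normal_density 0 A x / mv_normal_density 0 K x)
    \<le> (trace (matrix_inv A ** K) + x \<bullet> (matrix_inv K *v x)) / 2"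
proof -
  let ?p = "(2 * pi) ^ CARD('n)"
  note dets = pos_def_det_pos[OF A] pos_def_det_pos[OF K]
  have ln: "ln (mv_normal_density 0 B x) = - (x \<bullet> (matrix_inv B *v x)) / 2 - ln ?p / 2 - ln (det B) / 2"
    if "pos_def B" for B
    using pos_def_det_pos[OF that]
    by (simp add: mv_normal_density_def ln_div ln_mult ln_sqrt add_divide_distrib)
  have "det (matrix_inv A) * det A = 1"
    using arg_cong[OF matrix_inv_inverses(2)[OF pos_def_invertible[OF A]], of det] by (simp add: det_mul)
  then have "det (matrix_inv A) = 1 / det A" using dets by (simp add: field_simps)
  then have "det K / det A \<le> exp (trace (matrix_inv A ** K) - CARD('n))"
    using det_mult_le_exp_trace[OF pos_def_imp_psd[OF pos_def_matrix_inv[OF A]] K] by simp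
  then have "ln (det K / det A) \<le> trace (matrix_inv A ** K) - CARD('n)"
    using dets by (metis divide_pos_pos exp_le_cancel_iff exp_ln)
  then have "ln (det K) - ln (det A) \<le> trace (matrix_inv A ** K)"
    using dets by (simp add: ln_div)
  moreover have "0 \<le> x \<bullet> (matrix_inv A *v x)"
    using pos_def_imp_psd[OF pos_def_matrix_inv[OF A]] by (simp add: psd_matrix_def)
  moreover have "ln (mv_normal_density 0 A x / mv_normal_density 0 K x)
      = ln (mv_normal_density 0 A x) - ln (mv_normal_density 0 K x)"
    using mv_normal_density_pos[OF A, of 0 x] mv_normal_density_pos[OF K, of 0 x] by (simp add: ln_div)
  ultimately show ?thesis by (simp add: ln[OF A] ln[OF K])
qed

section \<open>The product integral of two Gaussian densities\<close>

text \<open>The integrand is a multiple of \<open>exp (- (x \<bullet> P x) / 2)\<close> with \<open>P = A\<inverse> + A'\<inverse> - K\<inverse>\<close>. All normalizing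
  constants combine into \<open>det (A P A' K\<inverse>)\<close>, and \<open>A P A' K\<inverse> = 1 - D D'\<close>.\<close>

lemma gaussian_product_integral:
  fixes A A' K :: "real ^ 'n ^ 'n"
  defines "D \<equiv> (A - K) ** matrix_inv K" and "D' \<equiv> (A' - K) ** matrix_inv K"
  assumes pd: "pos_def A" "pos_def A'" "pos_def K"
    and P: "pos_def (matrix_inv A + matrix_inv A' - matrix_inv K)"
  shows "(\<integral>\<^sup>+ x. ennreal (mv_normal_density 0 A x * mv_normal_density 0 A' x / mv_normal_density 0 K x) \<partial>lborel)
      = ennreal (sqrt (1 / det (mat 1 - D ** D')))" "0 < det (mat 1 - D ** D')"
proof -
  let ?P = "matrix_inv A + matrix_inv A' - matrix_inv K"
  let ?p = "(2 * pi) ^ CARD('n)"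
  note inv = pd[THEN pos_def_invertible, THEN matrix_inv_inverses(1)]
    pd[THEN pos_def_invertible, THEN matrix_inv_inverses(2)]
  note dets = pd[THEN pos_def_det_pos] pos_def_det_pos[OF P]
  have "mat 1 - D ** D' = A ** ?P ** A' ** matrix_inv K"
  proof -
    have "A ** ?P ** A' ** matrix_inv K = (A ** matrix_inv A) ** (A' ** matrix_inv K)
        + A ** (matrix_inv A' ** A') ** matrix_inv K - A ** matrix_inv K ** (A' ** matrix_inv K)"
      by (simp add: matrix_add_ldistrib matrix_diff_ldistrib matrix_add_rdistrib matrix_diff_rdistrib matrix_mul_assoc)
    moreover have "D = A ** matrix_inv K - mat 1" "D' = A' ** matrix_inv K - mat 1"
      by (simp_all add: D_def D'_def matrix_diff_rdistrib inv)
    ultimately show ?thesis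
      by (simp add: inv matrix_diff_ldistrib matrix_diff_rdistrib matrix_mul_assoc)
  qed
  moreover have "det (matrix_inv K) = 1 / det K"
    using arg_cong[OF inv(3), of det] dets by (simp add: det_mul field_simps)
  ultimately have dN: "det (mat 1 - D ** D') = det A * det ?P * det A' / det K"
    by (simp add: det_mul)
  show "0 < det (mat 1 - D ** D')"
    unfolding dN using dets by simp
  let ?c = "sqrt (?p * det K) / (sqrt (?p * det A) * sqrt (?p * det A'))"
  have "mv_normal_density 0 A x * mv_normal_density 0 A' x / mv_normal_density 0 K x
      = ?c * exp (- (x \<bullet> (?P *v x)) / 2)" for x
  proof -
    have "exp (- (x \<bullet> (?P *v x)) / 2) = exp (- (x \<bullet> (matrix_inv A *v x)) / 2) * exp (- (x \<bullet> (matrix_inv A' *v x)) / 2)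
        / exp (- (x \<bullet> (matrix_inv K *v x)) / 2)"
      by (simp add: exp_add[symmetric] exp_diff[symmetric] matrix_vector_mult_add_rdistrib
          matrix_vector_mult_diff_rdistrib inner_add_right inner_diff_right field_simps)
    then show ?thesis
      by (simp only: mv_normal_density_def diff_zero) (simp add: field_simps)
  qed
  then have "(\<integral>\<^sup>+ x. ennreal (mv_normal_density 0 A x * mv_normal_density 0 A' x / mv_normal_density 0 K x) \<partial>lborel)
      = (\<integral>\<^sup>+ x. ennreal ?c * ennreal (exp (- (x \<bullet> (?P *v x)) / 2)) \<partial>lborel)"
    using dets by (intro nn_integral_cong) (simp add: ennreal_mult'[symmetric])
  also have "\<dots> = ennreal ?c * ennreal (sqrt (?p / det ?P))"
    by (subst nn_integral_cmult, simp, simp only: gaussian_integral[OF P])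
  also have "\<dots> = ennreal (?c * sqrt (?p / det ?P))"
    using dets by (simp add: ennreal_mult'[symmetric])
  also have "?c * sqrt (?p / det ?P) = sqrt (1 / det (mat 1 - D ** D'))"
  proof -
    have p: "0 < ?p" by simp
    have "?c * sqrt (?p / det ?P) = sqrt ((?p * det K) / ((?p * det A) * (?p * det A')) * (?p / det ?P))"
      by (simp only: real_sqrt_mult real_sqrt_divide)
    also have "(?p * det K) / ((?p * det A) * (?p * det A')) * (?p / det ?P) = 1 / det (mat 1 - D ** D')"
    proof -
      have "(p * k) / ((p * a) * (p * b)) * (p / c) = 1 / (a * c * b / k)"
        if "0 < p" "0 < k" "0 < a" "0 < b" "0 < c" for p k a b c :: real
        using that by (simp add: field_simps)
      then show ?thesis unfolding dN using p dets by blast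
    qed
    finally show ?thesis .
  qed
  finally show "(\<integral>\<^sup>+ x. ennreal (mv_normal_density 0 A x * mv_normal_density 0 A' x / mv_normal_density 0 K x) \<partial>lborel)
      = ennreal (sqrt (1 / det (mat 1 - D ** D')))" .
qed

text \<open>The closeness assumption gives \<open>A \<le> 3/2 K\<close>, hence \<open>A\<inverse> \<ge> 2/3 K\<inverse>\<close>, so that the exponent
  \<open>A\<inverse> + A'\<inverse> - K\<inverse> \<ge> 1/3 K\<inverse>\<close> is positive definite and the integral converges; it also gives
  \<open>|D| \<le> 1/2\<close>, which is the smallness required by the determinant expansion.\<close>

lemma gaussian_product_integral_le:
  fixes A A' K :: "real ^ 'n ^ 'n"
  defines "D \<equiv> (A - K) ** matrix_inv K" and "D' \<equiv> (A' - K) ** matrix_inv K"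
  assumes pd: "pos_def A" "pos_def A'" "pos_def K"
    and near: "hs_norm (A - K) \<le> min_eigenvalue K / 2" "hs_norm (A' - K) \<le> min_eigenvalue K / 2"
  shows "(\<integral>\<^sup>+ x. ennreal (mv_normal_density 0 A x * mv_normal_density 0 A' x / mv_normal_density 0 K x) \<partial>lborel)
      \<le> ennreal (1 + trace (D ** D') / 2 + 2 * (hs_norm D * hs_norm D')\<^sup>2)"
    and "hs_norm D \<le> 1 / 2"
proof -
  note lam = pos_def_min_eigenvalue[OF pd(3)]
  have D: "hs_norm ((B - K) ** matrix_inv K) \<le> 1 / 2" if "hs_norm (B - K) \<le> min_eigenvalue K / 2" for B
  proof -
    have "1 / min_eigenvalue K * hs_norm (B - K) \<le> 1 / 2"
      using lam(1) that by (simp add: pos_divide_le_eq)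
    then show ?thesis
      using hs_norm_mult_matrix_inv_le[OF pd(3), of "B - K"] by linarith
  qed
  show "hs_norm D \<le> 1 / 2" using D near by (simp add: D_def)
  have le: "y \<bullet> (B *v y) \<le> 3 / 2 * (y \<bullet> (K *v y))" if "hs_norm (B - K) \<le> min_eigenvalue K / 2" for B and y :: "real ^ 'n"
  proof -
    have "y \<bullet> ((B - K) *v y) \<le> norm y * norm ((B - K) *v y)" by (rule norm_cauchy_schwarz)
    also have "\<dots> \<le> norm y * (hs_norm (B - K) * norm y)"
      by (intro mult_left_mono norm_matrix_vector_mult_le) auto
    also have "\<dots> \<le> norm y * (min_eigenvalue K / 2 * norm y)"
      using that by (intro mult_left_mono mult_right_mono) auto
    also have "\<dots> \<le> 1 / 2 * (y \<bullet> (K *v y))"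
      using lam(2)[of y] by (simp add: power2_eq_square mult_ac)
    finally show ?thesis by (simp add: matrix_vector_mult_diff_rdistrib inner_diff_right)
  qed
  have P: "pos_def (matrix_inv A + matrix_inv A' - matrix_inv K)"
  proof -
    have "transpose (matrix_inv A + matrix_inv A' - matrix_inv K) = matrix_inv A + matrix_inv A' - matrix_inv K"
      using pd[THEN pos_def_matrix_inv] by (simp add: pos_def_def transpose_def vec_eq_iff)
    moreover have "0 < x \<bullet> ((matrix_inv A + matrix_inv A' - matrix_inv K) *v x)" if "x \<noteq> 0" for x
    proof -
      have "0 < x \<bullet> (matrix_inv K *v x)"
        using pos_def_matrix_inv[OF pd(3)] that by (simp add: pos_def_def)
      moreover have "2 / 3 * (x \<bullet> (matrix_inv K *v x)) \<le> x \<bullet> (matrix_inv A *v x)"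
        "2 / 3 * (x \<bullet> (matrix_inv K *v x)) \<le> x \<bullet> (matrix_inv A' *v x)"
        using pos_def_inverse_antimono[OF pd(1,3), of "3 / 2" x] pos_def_inverse_antimono[OF pd(2,3), of "3 / 2" x]
          le near by auto
      ultimately show ?thesis
        by (simp add: matrix_vector_mult_add_rdistrib matrix_vector_mult_diff_rdistrib inner_add_right inner_diff_right)
    qed
    ultimately show ?thesis by (simp add: pos_def_def)
  qed
  note int = gaussian_product_integral[OF pd P, folded D_def D'_def]
  define Q where "Q = matrix_inv (mat 1 - D ** D')"
  have "invertible (mat 1 - D ** D')" using int(2) by (simp add: invertible_det_nz)
  then have Q: "(mat 1 - D ** D') ** Q = mat 1" by (simp add: Q_def matrix_inv_inverses)
  have "det Q = 1 / det (mat 1 - D ** D')"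
    using arg_cong[OF Q, of det] int(2) by (simp add: det_mul field_simps)
  moreover have "sqrt \<bar>det Q\<bar> \<le> 1 + trace (D ** D') / 2 + 2 * (hs_norm D * hs_norm D')\<^sup>2"
  proof (rule sqrt_det_inverse_le[OF Q hs_norm_mult_le abs_trace_mult_le])
    have "hs_norm D * hs_norm D' \<le> 1 / 2 * (1 / 2)"
      unfolding D_def D'_def using D near by (intro mult_mono) auto
    then show "hs_norm D * hs_norm D' \<le> 1 / 4" by simp
  qed
  ultimately show "(\<integral>\<^sup>+ x. ennreal (mv_normal_density 0 A x * mv_normal_density 0 A' x / mv_normal_density 0 K x) \<partial>lborel)
      \<le> ennreal (1 + trace (D ** D') / 2 + 2 * (hs_norm D * hs_norm D')\<^sup>2)"
    unfolding int(1) using int(2) by (intro ennreal_leI) simp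
qed

section \<open>Uniqueness of characteristic functions\<close>

text \<open>Equal characteristic functions have equal values at \<open>0\<close>, so both measures have the same total mass
  and can be normalized to probability measures.\<close>

lemma finite_measure_eqI_char:
  fixes \<mu> \<nu> :: "real measure"
  assumes \<mu>: "finite_measure \<mu>" "sets \<mu> = sets borel" and \<nu>: "finite_measure \<nu>" "sets \<nu> = sets borel"
    and char: "\<And>t. char \<mu> t = char \<nu> t"
  shows "\<mu> = \<nu>"
proof -
  have sp: "space \<mu> = UNIV" "space \<nu> = UNIV"
    using \<mu>(2) \<nu>(2) by (metis sets_eq_imp_space_eq space_borel)+
  define m where "m = measure \<mu> UNIV"
  have m: "emeasure \<mu> UNIV = ennreal m" "emeasure \<nu> UNIV = ennreal m" "0 \<le> m"
  proof -
    have "complex_of_real (measure \<mu> UNIV) = complex_of_real (measure \<nu> UNIV)"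
      using char[of 0] by (simp add: char_def sp)
    then show "emeasure \<mu> UNIV = ennreal m" "emeasure \<nu> UNIV = ennreal m"
      using finite_measure.emeasure_eq_measure[OF \<mu>(1)] finite_measure.emeasure_eq_measure[OF \<nu>(1)]
      by (auto simp: m_def)
  qed (simp add: m_def)
  show ?thesis
  proof (cases "m = 0")
    case True
    show ?thesis
    proof (rule measure_eqI)
      fix X
      have "emeasure \<mu> X \<le> emeasure \<mu> UNIV" "emeasure \<nu> X \<le> emeasure \<nu> UNIV"
        using emeasure_space[of \<mu>] emeasure_space[of \<nu>] by (auto simp: sp)
      then show "emeasure \<mu> X = emeasure \<nu> X" using m True by simp
    qed (simp add: \<mu> \<nu>)
  next
    case False
    with m(3) have pos: "0 < m" by simp
    define c where "c = ennreal (1 / m)"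
    have dist: "real_distribution (density \<rho> (\<lambda>_. c))"
      if "sets \<rho> = sets borel" "emeasure \<rho> UNIV = ennreal m" for \<rho> :: "real measure"
    proof (intro real_distribution.intro real_distribution_axioms.intro prob_spaceI)
      have "space \<rho> = UNIV" using that by (metis sets_eq_imp_space_eq space_borel)
      then show "emeasure (density \<rho> (\<lambda>_. c)) (space (density \<rho> (\<lambda>_. c))) = 1"
        using that pos by (simp add: c_def emeasure_density ennreal_mult''[symmetric])
      show "sets (density \<rho> (\<lambda>_. c)) = sets borel" using that by simp
    qed
    have "char (density \<rho> (\<lambda>_. c)) t = (1 / m) *\<^sub>R char \<rho> t" if "sets \<rho> = sets borel" for \<rho> t
    proof -
      have [measurable_cong]: "sets \<rho> = sets borel" by fact
      show ?thesis
        unfolding char_def c_def using pos by (subst integral_density) auto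
    qed
    then have "char (density \<mu> (\<lambda>_. c)) = char (density \<nu> (\<lambda>_. c))"
      using char \<mu> \<nu> by (simp add: fun_eq_iff)
    then have eq: "density \<mu> (\<lambda>_. c) = density \<nu> (\<lambda>_. c)"
      using dist \<mu> \<nu> m by (intro Levy_uniqueness) auto
    have "density (density \<rho> (\<lambda>_. c)) (\<lambda>_. ennreal m) = \<rho>" for \<rho> :: "real measure"
      using pos by (simp add: density_density_eq c_def ennreal_mult'[symmetric] density_1)
    then show ?thesis using eq by metis
  qed
qed

text \<open>Reduction to the line, one coordinate at a time. The induction over a set \<open>S\<close> of coordinates shows
  that integrals of \<open>\<Prod>i\<in>S. 1\<^sub>B\<^sub>i (x\<^sub>i)\<close> times \<open>cos (y \<bullet> x + \<theta>)\<close> agree, where \<open>y\<close> vanishes on \<open>S\<close>. To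
  move a further coordinate \<open>j\<close> into \<open>S\<close>, one regards the first factor times \<open>1 + cos (y \<bullet> x + \<theta>)\<close> as
  a density (the summand \<open>1\<close> makes it nonnegative) and pushes the weighted measure forward along
  \<open>x\<^sub>j\<close>: products of cosines are sums of cosines, so the induction hypothesis determines the
  characteristic function of this measure on the line.\<close>

lemma finite_measure_vec_eqI_char:
  fixes \<mu> \<nu> :: "(real ^ 'n) measure"
  assumes \<mu>: "finite_measure \<mu>" "sets \<mu> = sets borel" and \<nu>: "finite_measure \<nu>" "sets \<nu> = sets borel"
    and char: "\<And>y. (CLINT x|\<mu>. iexp (y \<bullet> x)) = (CLINT x|\<nu>. iexp (y \<bullet> x))"
  shows "\<mu> = \<nu>"
proof -
  interpret \<mu>: finite_measure \<mu> by fact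
  interpret \<nu>: finite_measure \<nu> by fact
  note [measurable_cong] = \<mu>(2) \<nu>(2)
  have sp [simp]: "space \<mu> = UNIV" "space \<nu> = UNIV"
    using \<mu>(2) \<nu>(2) by (metis sets_eq_imp_space_eq space_borel)+
  define V where "V S B x = (\<Prod>i\<in>S. indicator (B i) (x $ i) :: real)" for S and B :: "'n \<Rightarrow> real set" and x :: "real ^ 'n"
  have V01: "0 \<le> V S B x" "V S B x \<le> 1" for S B x
    unfolding V_def by (auto intro!: prod_nonneg prod_le_1)
  have Vm [measurable]: "V S B \<in> borel_measurable borel" if "\<And>i. B i \<in> sets borel" for S B
    unfolding V_def[abs_def] using that by measurable
  have trig: "(\<integral>x. cos (y \<bullet> x + \<theta>) \<partial>\<mu>) = (\<integral>x. cos (y \<bullet> x + \<theta>) \<partial>\<nu>)" for y \<theta>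
  proof -
    have "(\<integral>x. cos (y \<bullet> x + \<theta>) \<partial>\<rho>) = Re (iexp \<theta> * (CLINT x|\<rho>. iexp (y \<bullet> x)))"
      if "finite_measure \<rho>" "sets \<rho> = sets borel" for \<rho> :: "(real ^ 'n) measure"
    proof -
      interpret finite_measure \<rho> by fact
      note [measurable_cong] = that(2)
      have "integrable \<rho> (\<lambda>x. iexp \<theta> * iexp (y \<bullet> x))"
        by (rule integrable_const_bound[of _ 1]) (auto simp: norm_mult)
      from integral_Re[OF this] have "(\<integral>x. Re (iexp \<theta> * iexp (y \<bullet> x)) \<partial>\<rho>) = Re (CLINT x|\<rho>. iexp \<theta> * iexp (y \<bullet> x))" .
      moreover have "Re (iexp \<theta> * iexp (y \<bullet> x)) = cos (y \<bullet> x + \<theta>)" for x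
        by (simp add: Re_exp Im_exp cos_add)
      ultimately show ?thesis by simp
    qed
    then show ?thesis using \<mu> \<nu> char by metis
  qed
  have "(\<integral>x. V S B x * cos (y \<bullet> x + \<theta>) \<partial>\<mu>) = (\<integral>x. V S B x * cos (y \<bullet> x + \<theta>) \<partial>\<nu>)"
    if "finite S" "\<And>i. B i \<in> sets borel" "\<And>i. i \<in> S \<Longrightarrow> y $ i = 0" for S B y \<theta>
    using that
  proof (induction S arbitrary: y \<theta> rule: finite_induct)
    case empty
    then show ?case by (simp add: V_def trig)
  next
    case (insert j S)
    note [measurable] = insert.prems(1) Vm[OF insert.prems(1)]
    define W where "W y \<theta> x = V S B x * (1 + cos (y \<bullet> x + \<theta>))" for y x :: "real ^ 'n" and \<theta>
    have Wm [measurable]: "W y \<theta> \<in> borel_measurable borel" for y \<theta>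
      unfolding W_def[abs_def] by measurable
    have W0: "0 \<le> W y \<theta> x" for y \<theta> x
      unfolding W_def
      by (rule mult_nonneg_nonneg[OF V01(1)]) (use cos_ge_minus_one[of "y \<bullet> x + \<theta>"] in linarith)
    have W2: "W y \<theta> x \<le> 2" for y \<theta> x
      using mult_mono[OF V01(2)[of S B x], of "1 + cos (y \<bullet> x + \<theta>)" 2]
        cos_ge_minus_one[of "y \<bullet> x + \<theta>"] cos_le_one[of "y \<bullet> x + \<theta>"]
      by (simp add: W_def)
    have bdd: "integrable \<rho> h" if "finite_measure \<rho>" "sets \<rho> = sets borel" "h \<in> borel_measurable borel"
        "\<And>x. \<bar>h x\<bar> \<le> 2" for \<rho> :: "(real ^ 'n) measure" and h :: "real ^ 'n \<Rightarrow> real"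
    proof -
      note [measurable_cong] = that(2)
      note [measurable] = that(3)
      show ?thesis using that by (intro finite_measure.integrable_const_bound[of _ _ 2]) auto
    qed
    \<comment> \<open>The new coordinate can be restricted to \<open>B j\<close> under the weight \<open>W\<close>.\<close>
    have key: "(\<integral>x. W y \<theta> x * indicator (B j) (x $ j) \<partial>\<mu>) = (\<integral>x. W y \<theta> x * indicator (B j) (x $ j) \<partial>\<nu>)"
      if y: "\<And>i. i \<in> insert j S \<Longrightarrow> y $ i = 0" for y \<theta>
    proof -
      define push where "push \<rho> = distr (density \<rho> (\<lambda>x. ennreal (W y \<theta> x))) borel (\<lambda>x. x $ j)" for \<rho>
      have fin: "finite_measure (push \<rho>)" if "finite_measure \<rho>" "sets \<rho> = sets borel" for \<rho>
      proof -
        note [measurable_cong] = that(2)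
        interpret finite_measure \<rho> by fact
        have "emeasure (push \<rho>) UNIV = (\<integral>\<^sup>+ x. ennreal (W y \<theta> x) \<partial>\<rho>)"
          using sets_eq_imp_space_eq[OF that(2)] by (simp add: push_def emeasure_distr emeasure_density)
        also have "\<dots> < \<infinity>"
          using bdd[OF that, of "W y \<theta>"] W0 W2 by (subst nn_integral_eq_integral) auto
        finally show ?thesis by (intro finite_measureI) (auto simp: push_def)
      qed
      have ch: "char (push \<rho>) t = Complex (\<integral>x. W y \<theta> x * cos (t * x $ j) \<partial>\<rho>) (\<integral>x. W y \<theta> x * sin (t * x $ j) \<partial>\<rho>)"
        if "finite_measure \<rho>" "sets \<rho> = sets borel" for \<rho> t
      proof -
        note [measurable_cong] = that(2)
        interpret finite_measure \<rho> by fact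
        have "char (push \<rho>) t = (\<integral>x. W y \<theta> x *\<^sub>R iexp (t * x $ j) \<partial>\<rho>)"
          unfolding char_def push_def
          by (subst integral_distr, simp, simp, subst integral_density) (auto simp: W0)
        moreover have "integrable \<rho> (\<lambda>x. W y \<theta> x *\<^sub>R iexp (t * x $ j))"
          using W0 W2 by (intro integrable_const_bound[of _ 2]) auto
        ultimately show ?thesis
          by (simp add: complex_eq_iff integral_Re[symmetric] integral_Im[symmetric] Re_exp Im_exp)
      qed
      have cosW: "(\<integral>x. W y \<theta> x * cos (t * x $ j + \<phi>) \<partial>\<mu>) = (\<integral>x. W y \<theta> x * cos (t * x $ j + \<phi>) \<partial>\<nu>)" for t \<phi>
      proof -
        have eq: "W y \<theta> x * cos (t * x $ j + \<phi>) = V S B x * cos (axis j t \<bullet> x + \<phi>)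
            + (V S B x * cos ((y + axis j t) \<bullet> x + (\<theta> + \<phi>)) + V S B x * cos ((y - axis j t) \<bullet> x + (\<theta> - \<phi>))) / 2" for x
        proof -
          have ax: "axis j t \<bullet> x = t * x $ j" by (simp add: inner_axis')
          define a where "a = y \<bullet> x"
          define b where "b = t * x $ j"
          have arg: "a + b + (\<theta> + \<phi>) = (a + \<theta>) + (b + \<phi>)" "a - b + (\<theta> - \<phi>) = (a + \<theta>) - (b + \<phi>)"
            by auto
          have "W y \<theta> x * cos (b + \<phi>) = V S B x * cos (b + \<phi>) + V S B x * (cos (a + \<theta>) * cos (b + \<phi>))"
            by (simp add: W_def a_def algebra_simps)
          also have "cos (a + \<theta>) * cos (b + \<phi>) = (cos (a + b + (\<theta> + \<phi>)) + cos (a - b + (\<theta> - \<phi>))) / 2"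
            unfolding arg by (simp only: cos_times_cos add.commute)
          also have "V S B x * \<dots> = (V S B x * cos (a + b + (\<theta> + \<phi>)) + V S B x * cos (a - b + (\<theta> - \<phi>))) / 2"
            by (simp only: distrib_left times_divide_eq_right)
          finally show ?thesis
            by (simp only: inner_add_left inner_diff_left ax a_def b_def)
        qed
        have V2: "\<bar>V S B x * cos r\<bar> \<le> 2" for x r
          using mult_mono[of "\<bar>V S B x\<bar>" 1 "\<bar>cos r\<bar>" 1] V01[of S B x] by (simp add: abs_mult)
        have split: "(\<integral>x. W y \<theta> x * cos (t * x $ j + \<phi>) \<partial>\<rho>) = (\<integral>x. V S B x * cos (axis j t \<bullet> x + \<phi>) \<partial>\<rho>)
            + ((\<integral>x. V S B x * cos ((y + axis j t) \<bullet> x + (\<theta> + \<phi>)) \<partial>\<rho>)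
               + (\<integral>x. V S B x * cos ((y - axis j t) \<bullet> x + (\<theta> - \<phi>)) \<partial>\<rho>)) / 2"
          if "finite_measure \<rho>" "sets \<rho> = sets borel" for \<rho>
        proof -
          have i: "integrable \<rho> (\<lambda>x. V S B x * cos (z \<bullet> x + r))" for z r
            by (rule bdd[OF that]) (auto simp: V2)
          show ?thesis unfolding eq using i by simp
        qed
        have z: "axis j t $ i = 0" "y $ i = 0" if "i \<in> S" for i
          using that insert.hyps(2) y by (auto simp: axis_def)
        show ?thesis
          unfolding split[OF \<mu>] split[OF \<nu>]
          by (simp only: insert.IH[OF insert.prems(1)] z vector_add_component vector_minus_component add_0 diff_0_right)
      qed
      \<comment> \<open>A phase shift by a quarter period.\<close>
      have sinW: "(\<integral>x. W y \<theta> x * sin (t * x $ j) \<partial>\<mu>) = (\<integral>x. W y \<theta> x * sin (t * x $ j) \<partial>\<nu>)" for t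
      proof -
        have "cos (r + - pi / 2) = sin r" for r by (simp add: cos_diff)
        then show ?thesis using cosW[of t "- pi / 2"] by (simp only:)
      qed
      have "push \<mu> = push \<nu>"
      proof (rule finite_measure_eqI_char)
        show "char (push \<mu>) t = char (push \<nu>) t" for t
          using cosW[of t 0] sinW[of t] by (simp add: ch[OF \<mu>] ch[OF \<nu>])
      qed (use fin \<mu> \<nu> in \<open>auto simp: push_def\<close>)
      moreover have "emeasure (push \<rho>) (B j) = ennreal (\<integral>x. W y \<theta> x * indicator (B j) (x $ j) \<partial>\<rho>)"
        if "finite_measure \<rho>" "sets \<rho> = sets borel" for \<rho>
      proof -
        note [measurable_cong] = that(2)
        have "(\<lambda>x. x $ j) -` B j \<in> sets \<rho>"
          using measurable_sets_borel[of "\<lambda>x :: real ^ 'n. x $ j" borel "B j"] insert.prems(1) that(2) by simp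
        then have "emeasure (push \<rho>) (B j) = (\<integral>\<^sup>+ x. ennreal (W y \<theta> x * indicator (B j) (x $ j)) \<partial>\<rho>)"
          using sets_eq_imp_space_eq[OF that(2)] unfolding push_def
          by (subst emeasure_distr, simp, simp, subst emeasure_density)
            (auto intro!: nn_integral_cong split: split_indicator)
        also have "\<dots> = ennreal (\<integral>x. W y \<theta> x * indicator (B j) (x $ j) \<partial>\<rho>)"
          using W0 W2 by (intro nn_integral_eq_integral bdd[OF that]) (auto split: split_indicator)
        finally show ?thesis .
      qed
      ultimately have "ennreal (\<integral>x. W y \<theta> x * indicator (B j) (x $ j) \<partial>\<mu>)
          = ennreal (\<integral>x. W y \<theta> x * indicator (B j) (x $ j) \<partial>\<nu>)"
        using \<mu> \<nu> by metis
      then show ?thesis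
        using W0 by (subst (asm) ennreal_inj) (auto intro!: integral_nonneg)
    qed
    \<comment> \<open>For \<open>y = 0\<close> and \<open>\<theta> = pi / 2\<close> the cosine vanishes and the weight is \<open>V\<close> itself, so subtraction removes the auxiliary summand \<open>1\<close>.\<close>
    have "(\<integral>x. V (insert j S) B x * cos (y \<bullet> x + \<theta>) \<partial>\<rho>)
        = (\<integral>x. W y \<theta> x * indicator (B j) (x $ j) \<partial>\<rho>) - (\<integral>x. W 0 (pi / 2) x * indicator (B j) (x $ j) \<partial>\<rho>)"
      if "finite_measure \<rho>" "sets \<rho> = sets borel" for \<rho>
    proof -
      have "integrable \<rho> (\<lambda>x. W z r x * indicator (B j) (x $ j))" for z r
        using W0 W2 by (intro bdd[OF that]) (auto split: split_indicator)
      moreover have "V (insert j S) B x * cos (y \<bullet> x + \<theta>)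
          = W y \<theta> x * indicator (B j) (x $ j) - W 0 (pi / 2) x * indicator (B j) (x $ j)" for x
        using insert.hyps by (simp add: V_def W_def algebra_simps)
      ultimately show ?thesis by simp
    qed
    then show ?case using \<mu> \<nu> key[of y \<theta>] key[of 0 "pi / 2"] insert.prems(2) by simp
  qed
  from this[of UNIV _ 0 0] have V: "(\<integral>x. V UNIV B x \<partial>\<mu>) = (\<integral>x. V UNIV B x \<partial>\<nu>)"
    if "\<And>i. B i \<in> sets borel" for B using that by simp
  have box: "emeasure \<mu> (box a b) = emeasure \<nu> (box a b)" for a b :: "real ^ 'n"
  proof -
    have "V UNIV (\<lambda>i. {a $ i <..< b $ i}) x = indicator (box a b) x" for x
      unfolding V_def by (auto simp: mem_box_cart indicator_def prod_zero_iff)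
    with V[of "\<lambda>i. {a $ i <..< b $ i}"] show ?thesis
      by (simp add: \<mu>.emeasure_eq_measure \<nu>.emeasure_eq_measure)
  qed
  show ?thesis
  proof (rule measure_eqI_generator_eq)
    let ?E = "range (\<lambda>(a, b). box a b :: (real ^ 'n) set)"
    show "Int_stable ?E" by (auto simp: Int_stable_def box_Int_box)
    show "?E \<subseteq> Pow UNIV" "sets \<mu> = sigma_sets UNIV ?E" "sets \<nu> = sigma_sets UNIV ?E"
      by (simp_all add: borel_eq_box \<mu> \<nu>)
    let ?A = "\<lambda>n::nat. box (- (real n *\<^sub>R One)) (real n *\<^sub>R One) :: (real ^ 'n) set"
    show "range ?A \<subseteq> ?E" "(\<Union>i. ?A i) = UNIV"
      unfolding UN_box_eq_UNIV by auto
    show "emeasure \<mu> (?A i) \<noteq> \<infinity>" for i by (simp add: \<mu>.emeasure_eq_measure)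
    show "emeasure \<mu> X = emeasure \<nu> X" if "X \<in> ?E" for X using that box by auto
  qed
qed

section \<open>Gaussian mixtures\<close>

text \<open>The part of the mixture density that is contributed by the event \<open>S\<close>.\<close>

definition mixture_density :: "'a measure \<Rightarrow> ('a \<Rightarrow> real ^ 'n ^ 'n) \<Rightarrow> 'a set \<Rightarrow> real ^ 'n \<Rightarrow> ennreal"
  where "mixture_density M A S x = (\<integral>\<^sup>+ \<omega>. ennreal (mv_normal_density 0 (A \<omega>) x) * indicator S \<omega> \<partial>M)"

text \<open>Positive definiteness is required at every point and not just almost surely; a random matrix can
  be changed on a null set to achieve this.\<close>

locale gaussian_mixture = prob_space M for M :: "'a measure" +
  fixes A :: "'a \<Rightarrow> real ^ 'n ^ 'n"
  assumes A_measurable [measurable]: "A \<in> borel_measurable M"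
    and A_pos_def: "pos_def (A \<omega>)"
begin

lemma mixture_density_measurable [measurable]:
  assumes [measurable]: "S \<in> sets M"
  shows "mixture_density M A S \<in> borel_measurable borel"
  unfolding mixture_density_def by measurable

lemma nn_integral_mixture_density:
  assumes [measurable]: "S \<in> sets M"
  shows "(\<integral>\<^sup>+ x. mixture_density M A S x \<partial>lborel) = emeasure M S"
proof -
  interpret P: pair_sigma_finite M "lborel :: (real ^ 'n) measure" by standard
  have "(\<integral>\<^sup>+ x. mixture_density M A S x \<partial>lborel)
      = (\<integral>\<^sup>+ \<omega>. (\<integral>\<^sup>+ x. ennreal (mv_normal_density 0 (A \<omega>) x) * indicator S \<omega> \<partial>lborel) \<partial>M)"
    unfolding mixture_density_def by (rule P.Fubini') measurable
  also have "\<dots> = (\<integral>\<^sup>+ \<omega>. indicator S \<omega> \<partial>M)"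
    by (simp add: nn_integral_multc nn_integral_mv_normal_density A_pos_def)
  finally show ?thesis by simp
qed

text \<open>The mixture is the second marginal of the joint law of \<open>\<omega>\<close> and \<open>x\<close> with density
  \<open>mv_normal_density 0 (A \<omega>) x\<close>, so Fubini's theorem reduces its characteristic function to the
  Gaussian one.\<close>

lemma char_mixture:
  "(CLINT x|density lborel (mixture_density M A (space M)). iexp (y \<bullet> x))
    = (\<integral>\<omega>. complex_of_real (exp (- (y \<bullet> (A \<omega> *v y)) / 2)) \<partial>M)"
proof -
  interpret P: pair_sigma_finite M "lborel :: (real ^ 'n) measure" by standard
  let ?\<phi> = "\<lambda>z. mv_normal_density 0 (A (fst z)) (snd z)"
  let ?\<nu> = "density (M \<Otimes>\<^sub>M lborel) (\<lambda>z. ennreal (?\<phi> z))"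
  have pos: "0 \<le> ?\<phi> z" for z
    using A_pos_def by (simp add: mv_normal_density_pos less_imp_le)
  have "density lborel (mixture_density M A (space M)) = distr ?\<nu> borel snd"
  proof (rule measure_eqI)
    fix X :: "(real ^ 'n) set" assume "X \<in> sets (density lborel (mixture_density M A (space M)))"
    then have [measurable]: "X \<in> sets borel" by simp
    have "emeasure (density lborel (mixture_density M A (space M))) X
        = (\<integral>\<^sup>+ x. (\<integral>\<^sup>+ \<omega>. ennreal (mv_normal_density 0 (A \<omega>) x) * indicator X x \<partial>M) \<partial>lborel)"
      by (subst emeasure_density)
        (auto intro!: nn_integral_cong simp: mixture_density_def nn_integral_multc[symmetric])
    also have "\<dots> = (\<integral>\<^sup>+ z. ennreal (?\<phi> z) * indicator X (snd z) \<partial>(M \<Otimes>\<^sub>M lborel))"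
      by (subst P.nn_integral_snd[symmetric]) (auto simp: split_def)
    also have "\<dots> = emeasure (distr ?\<nu> borel snd) X"
      by (subst emeasure_distr, simp, simp, subst emeasure_density)
        (auto intro!: nn_integral_cong simp: indicator_def space_pair_measure)
    finally show "emeasure (density lborel (mixture_density M A (space M))) X = emeasure (distr ?\<nu> borel snd) X" .
  qed simp
  then have "(CLINT x|density lborel (mixture_density M A (space M)). iexp (y \<bullet> x))
      = (\<integral>z. ?\<phi> z *\<^sub>R iexp (y \<bullet> snd z) \<partial>(M \<Otimes>\<^sub>M lborel))"
    by (simp add: integral_distr integral_density pos)
  also have "\<dots> = (\<integral>\<omega>. (\<integral>x. mv_normal_density 0 (A \<omega>) x *\<^sub>R iexp (y \<bullet> x) \<partial>lborel) \<partial>M)"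
  proof -
    have "integrable (M \<Otimes>\<^sub>M lborel) (\<lambda>(\<omega>, x). mv_normal_density 0 (A \<omega>) x *\<^sub>R iexp (y \<bullet> x))"
    proof (rule integrableI_bounded)
      have "(\<integral>\<^sup>+ z. norm (case z of (\<omega>, x) \<Rightarrow> mv_normal_density 0 (A \<omega>) x *\<^sub>R iexp (y \<bullet> x)) \<partial>(M \<Otimes>\<^sub>M lborel))
          = (\<integral>\<^sup>+ z. ennreal (?\<phi> z) \<partial>(M \<Otimes>\<^sub>M lborel))"
        using pos by (intro nn_integral_cong) (auto simp: norm_mult)
      also have "\<dots> = (\<integral>\<^sup>+ \<omega>. (\<integral>\<^sup>+ x. ennreal (mv_normal_density 0 (A \<omega>) x) \<partial>lborel) \<partial>M)"
        by (subst lborel.nn_integral_fst[symmetric]) auto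
      also have "\<dots> = 1"
        by (simp add: nn_integral_mv_normal_density A_pos_def emeasure_space_1)
      finally show "(\<integral>\<^sup>+ z. norm (case z of (\<omega>, x) \<Rightarrow> mv_normal_density 0 (A \<omega>) x *\<^sub>R iexp (y \<bullet> x)) \<partial>(M \<Otimes>\<^sub>M lborel)) < \<infinity>"
        by simp
    qed measurable
    from P.integral_fst'[OF this] show ?thesis by (simp add: split_def)
  qed
  also have "\<dots> = (\<integral>\<omega>. complex_of_real (exp (- (y \<bullet> (A \<omega> *v y)) / 2)) \<partial>M)"
  proof (intro Bochner_Integration.integral_cong refl)
    fix \<omega>
    have "(\<integral>x. mv_normal_density 0 (A \<omega>) x *\<^sub>R iexp (y \<bullet> x) \<partial>lborel) = (CLINT x|gaussian_measure (A \<omega>). iexp (y \<bullet> x))"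
      unfolding gaussian_measure_def
      by (subst integral_density) (auto simp: mv_normal_density_pos less_imp_le A_pos_def)
    then show "(\<integral>x. mv_normal_density 0 (A \<omega>) x *\<^sub>R iexp (y \<bullet> x) \<partial>lborel) = complex_of_real (exp (- (y \<bullet> (A \<omega> *v y)) / 2))"
      by (simp add: char_gaussian A_pos_def)
  qed
  finally show ?thesis .
qed

theorem distr_eq_mixture:
  assumes [measurable]: "F \<in> borel_measurable M"
    and char: "\<And>y. (CLINT \<omega>|M. iexp (y \<bullet> F \<omega>)) = (\<integral>\<omega>. complex_of_real (exp (- (y \<bullet> (A \<omega> *v y)) / 2)) \<partial>M)"
  shows "distr M borel F = density lborel (mixture_density M A (space M))"
proof (rule finite_measure_vec_eqI_char)
  show "finite_measure (distr M borel F)"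
    by (rule finite_measure_distr) simp
  show "finite_measure (density lborel (mixture_density M A (space M)))"
    by (rule finite_measureI) (simp add: emeasure_density nn_integral_mixture_density)
  show "(CLINT x|distr M borel F. iexp (y \<bullet> x)) = (CLINT x|density lborel (mixture_density M A (space M)). iexp (y \<bullet> x))" for y
    unfolding char_mixture char[symmetric] by (subst integral_distr) auto
qed simp_all

end

section \<open>Relative entropy of a mixture\<close>

text \<open>The integrand \<open>g ln (g / f)\<close> is bounded below by the integrable function \<open>g - f\<close>, so an integrable
  upper bound makes it integrable, and the relative entropy is then not the value \<open>\<infinity>\<close> reserved for
  divergent integrals.\<close>

lemma relative_entropy_density_le:
  fixes f g U :: "'b \<Rightarrow> real"
  assumes sf: "sigma_finite_measure N"
    and f [measurable]: "f \<in> borel_measurable N" "integrable N f" "\<And>x. 0 < f x"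
    and g [measurable]: "g \<in> borel_measurable N" "integrable N g" "\<And>x. 0 \<le> g x"
    and U: "integrable N U" "AE x in N. g x * ln (g x / f x) \<le> U x"
  shows "relative_entropy (density N (\<lambda>x. ennreal (g x))) (density N (\<lambda>x. ennreal (f x))) \<le> ereal (\<integral>x. U x \<partial>N)"
proof -
  interpret sigma_finite_measure N by fact
  let ?F = "density N (\<lambda>x. ennreal (f x))" and ?G = "density N (\<lambda>x. ennreal (g x))"
  have lower: "g x - f x \<le> g x * ln (g x / f x)" for x
  proof (cases "g x = 0")
    case False
    then have "0 < g x" using g(3)[of x] by simp
    have "ln (f x / g x) \<le> f x / g x - 1"
      using f(3)[of x] \<open>0 < g x\<close> by (intro ln_le_minus_one) simp
    then have "g x * ln (f x / g x) \<le> g x * (f x / g x - 1)"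
      using g(3) by (intro mult_left_mono)
    also have "\<dots> = f x - g x" using False by (simp add: right_diff_distrib)
    finally show ?thesis
      using f(3)[of x] \<open>0 < g x\<close> by (simp add: ln_div algebra_simps)
  qed (use f(3)[of x] in simp)
  have int: "integrable N (\<lambda>x. g x * ln (g x / f x))"
  proof (rule Bochner_Integration.integrable_bound[where f = "\<lambda>x. \<bar>U x\<bar> + \<bar>g x - f x\<bar>"])
    show "AE x in N. norm (g x * ln (g x / f x)) \<le> norm (\<bar>U x\<bar> + \<bar>g x - f x\<bar>)"
      using U(2)
    proof eventually_elim
      case (elim x)
      then show ?case using lower[of x] by simp
    qed
  qed (use U f g in auto)
  have ac: "absolutely_continuous ?F ?G"
    unfolding absolutely_continuous_def
  proof
    fix X assume "X \<in> null_sets ?F"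
    then have X: "X \<in> sets N" "AE x in N. x \<in> X \<longrightarrow> ennreal (f x) = 0"
      by (auto simp: null_sets_density_iff)
    then have "AE x in N. x \<notin> X" using f(3) by (auto elim!: eventually_mono simp: ennreal_eq_0_iff not_le[symmetric])
    with X(1) show "X \<in> null_sets ?G"
      by (auto simp: null_sets_density_iff)
  qed
  interpret F: sigma_finite_measure ?F
    by (subst sigma_finite_iff_density_finite) auto
  have G: "?G = density ?F (\<lambda>x. ennreal (g x / f x))"
    using f g less_imp_neq[OF f(3)] by (subst density_density_divide) (auto simp: less_imp_le)
  have "AE x in ?F. RN_deriv ?F ?G x = ennreal (g x / f x)"
    unfolding G by (rule AE_symmetric[OF F.RN_deriv_unique]) auto
  then have RN: "AE x in N. entropy_density (exp 1) ?F ?G x = ln (g x / f x)"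
    using f(3) g(3) by (auto simp: AE_density entropy_density_def log_def less_imp_le elim!: eventually_mono)
  have m: "entropy_density (exp 1) ?F ?G \<in> borel_measurable N"
    using measurable_entropy_density[of "exp 1" ?F ?G] by simp
  have ed: "integrable ?G (entropy_density (exp 1) ?F ?G)"
  proof -
    have "integrable N (\<lambda>x. g x * entropy_density (exp 1) ?F ?G x)"
      by (rule integrable_cong_AE_imp[OF int]) (use m RN in \<open>auto elim!: eventually_mono\<close>)
    then show ?thesis
      using m g(3) by (subst integrable_real_density) auto
  qed
  have "KL_divergence (exp 1) ?F ?G = (\<integral>x. g x * log (exp 1) (g x / f x) \<partial>N)"
    using f g less_imp_neq[OF f(3)] by (intro KL_density_density) (auto simp: less_imp_le)
  also have "\<dots> = (\<integral>x. g x * ln (g x / f x) \<partial>N)"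
    by (simp add: log_def)
  also have "\<dots> \<le> (\<integral>x. U x \<partial>N)"
    using int U by (rule integral_mono_AE)
  finally show ?thesis
    using ac ed by (simp add: relative_entropy_def)
qed

lemma enn2real_integrable_le:
  fixes h :: "'a \<Rightarrow> ennreal"
  assumes [measurable]: "h \<in> borel_measurable M" and le: "(\<integral>\<^sup>+ x. h x \<partial>M) \<le> ennreal c" and c: "0 \<le> c"
  shows "integrable M (\<lambda>x. enn2real (h x))" "(\<integral>x. enn2real (h x) \<partial>M) \<le> c" "AE x in M. h x < \<infinity>"
    "(\<integral>x. enn2real (h x) \<partial>M) = enn2real (\<integral>\<^sup>+ x. h x \<partial>M)"
proof -
  have fin: "(\<integral>\<^sup>+ x. h x \<partial>M) < \<infinity>" using le by (simp add: order.strict_trans1)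
  then show ae: "AE x in M. h x < \<infinity>"
    using nn_integral_PInf_AE[of h M] by (auto simp: less_top[symmetric])
  then have eq: "(\<integral>\<^sup>+ x. ennreal (enn2real (h x)) \<partial>M) = (\<integral>\<^sup>+ x. h x \<partial>M)"
    by (intro nn_integral_cong_AE) (auto elim!: eventually_mono simp: less_top)
  then show int: "integrable M (\<lambda>x. enn2real (h x))"
    using fin by (intro integrableI_nonneg) auto
  show "(\<integral>x. enn2real (h x) \<partial>M) = enn2real (\<integral>\<^sup>+ x. h x \<partial>M)"
    by (subst integral_eq_nn_integral) (auto simp: eq)
  also have "\<dots> \<le> enn2real (ennreal c)" using le by (intro enn2real_mono) auto
  finally show "(\<integral>x. enn2real (h x) \<partial>M) \<le> c" using c by simp
qed

text \<open>A pointwise form of convexity of the relative entropy, with \<open>a \<omega>\<close> and \<open>k\<close> the values of two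
  densities at a fixed point. The inequality \<open>t ln r \<le> t ln (t / k) + f - t\<close> for \<open>r = f / k\<close> says that
  the tangent of \<open>t ln (t / k)\<close> at \<open>f\<close> lies below its graph. It is used for \<open>t = a \<omega>\<close> outside \<open>S\<close>,
  where \<open>b\<close> controls the logarithm, and once for the mean \<open>t = g / P(S)\<close> inside \<open>S\<close>: there the
  average is taken before the logarithm, and \<open>ln s \<le> s - 1\<close> turns it into a chi-square term.\<close>

lemma (in prob_space) mixture_log_ratio_le:
  fixes a b :: "'a \<Rightarrow> real"
  assumes a: "integrable M a" "\<And>\<omega>. 0 < a \<omega>" and k: "0 < k" and S [measurable]: "S \<in> events"
    and b: "\<And>\<omega>. ln (a \<omega> / k) \<le> b \<omega>"
    and ab: "integrable M (\<lambda>\<omega>. a \<omega> * b \<omega> * indicator (space M - S) \<omega>)"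
  defines "f \<equiv> expectation a" and "g \<equiv> expectation (\<lambda>\<omega>. a \<omega> * indicator S \<omega>)"
  shows "f * ln (f / k) \<le> g\<^sup>2 / k / prob S - g + expectation (\<lambda>\<omega>. a \<omega> * b \<omega> * indicator (space M - S) \<omega>)"
proof -
  note [measurable] = borel_measurable_integrable[OF a(1)]
  have f: "0 < f"
    unfolding f_def using expectation_greater[of a 0] a by simp
  define r where "r = f / k"
  have r: "0 < r" using f k by (simp add: r_def)
  have young: "t * ln r \<le> t * ln (t / k) + f - t" if "0 < t" for t
  proof -
    have "ln (f / t) \<le> f / t - 1" using f that by (intro ln_le_minus_one) simp
    then have "t * ln (f / t) \<le> t * (f / t - 1)" using that by (intro mult_left_mono) auto
    then show ?thesis using that f k by (simp add: r_def ln_div algebra_simps)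
  qed
  have intS: "integrable M (\<lambda>\<omega>. a \<omega> * indicator S \<omega>)" "integrable M (\<lambda>\<omega>. a \<omega> * indicator (space M - S) \<omega>)"
    by (intro integrable_real_mult_indicator a(1); simp)+
  have intf: "integrable M (\<lambda>\<omega>. f * indicator (space M - S) \<omega>)"
    by (intro integrable_mult_right integrable_real_indicator) (simp_all add: emeasure_eq_measure)
  have fg: "expectation (\<lambda>\<omega>. a \<omega> * indicator (space M - S) \<omega>) = f - g"
  proof -
    have "f = expectation (\<lambda>\<omega>. a \<omega> * indicator S \<omega> + a \<omega> * indicator (space M - S) \<omega>)"
      unfolding f_def by (intro Bochner_Integration.integral_cong) (auto simp: indicator_def)
    also have "\<dots> = g + expectation (\<lambda>\<omega>. a \<omega> * indicator (space M - S) \<omega>)"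
      unfolding g_def using intS by simp
    finally show ?thesis by simp
  qed
  have "expectation (\<lambda>\<omega>. a \<omega> * indicator (space M - S) \<omega> * ln r)
      \<le> expectation (\<lambda>\<omega>. a \<omega> * b \<omega> * indicator (space M - S) \<omega> + f * indicator (space M - S) \<omega>
          - a \<omega> * indicator (space M - S) \<omega>)"
  proof (intro integral_mono)
    fix \<omega>
    have "a \<omega> * ln r \<le> a \<omega> * ln (a \<omega> / k) + f - a \<omega>" by (rule young[OF a(2)])
    also have "a \<omega> * ln (a \<omega> / k) \<le> a \<omega> * b \<omega>"
      using a(2)[of \<omega>] b by (intro mult_left_mono) auto
    finally show "a \<omega> * indicator (space M - S) \<omega> * ln r \<le> a \<omega> * b \<omega> * indicator (space M - S) \<omega>
        + f * indicator (space M - S) \<omega> - a \<omega> * indicator (space M - S) \<omega>"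
      by (simp split: split_indicator)
  qed (use intS intf ab in auto)
  then have bad: "(f - g) * ln r \<le> expectation (\<lambda>\<omega>. a \<omega> * b \<omega> * indicator (space M - S) \<omega>)
      + f * (1 - prob S) - (f - g)"
    using intS intf ab by (simp add: fg prob_compl)
  have good: "g * ln r \<le> g\<^sup>2 / k / prob S - g + prob S * f - g"
  proof (cases "g = 0")
    case True
    then show ?thesis using f by simp
  next
    case False
    have "0 \<le> g" unfolding g_def using a(2) by (intro Bochner_Integration.integral_nonneg) (simp add: less_imp_le)
    with False have g: "0 < g" by simp
    have "prob S \<noteq> 0"
    proof
      assume "prob S = 0"
      then have "AE \<omega> in M. \<omega> \<notin> S"
        by (intro AE_not_in) (simp add: null_sets_def emeasure_eq_measure)
      then have "g = expectation (\<lambda>_. 0)"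
        unfolding g_def by (intro integral_cong_AE) (auto elim!: eventually_mono)
      then show False using g by simp
    qed
    then have q: "0 < prob S" using measure_nonneg[of M S] by linarith
    define t where "t = g / prob S"
    have t: "0 < t" using g q by (simp add: t_def)
    have "t * ln r \<le> t * ln (t / k) + f - t" by (rule young[OF t])
    also have "t * ln (t / k) \<le> t * (t / k - 1)"
      using t k by (intro mult_left_mono ln_le_minus_one) auto
    finally have "prob S * (t * ln r) \<le> prob S * (t * (t / k - 1) + f - t)"
      using q by (intro mult_left_mono) auto
    moreover have e: "prob S * t = g" using q by (simp add: t_def)
    then have "prob S * (t * ln r) = g * ln r" by (simp add: mult.assoc[symmetric])
    moreover have "prob S * (t * (t / k - 1) + f - t) = (prob S * t) * (t / k - 1) + prob S * f - prob S * t"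
      by (simp add: algebra_simps)
    moreover have "g * (t / k - 1) = g\<^sup>2 / k / prob S - g"
      by (simp add: t_def power2_eq_square right_diff_distrib)
    ultimately show ?thesis unfolding e by simp
  qed
  have "f * ln r = g * ln r + (f - g) * ln r" by (simp add: algebra_simps)
  also have "\<dots> \<le> g\<^sup>2 / k / prob S - g + expectation (\<lambda>\<omega>. a \<omega> * b \<omega> * indicator (space M - S) \<omega>)"
    using good bad by (simp add: algebra_simps)
  finally show ?thesis by (simp add: r_def)
qed

context gaussian_mixture
begin

text \<open>Integration of \<open>mixture_log_ratio_le\<close> over \<open>x\<close>. The event \<open>S\<close> contributes a chi-square integral and
  its complement the averaged Gaussian relative entropies.\<close>

theorem relative_entropy_mixture_le:
  fixes K :: "real ^ 'n ^ 'n"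
  assumes K: "pos_def K" and S [measurable]: "S \<in> events" and c: "0 \<le> c1" "0 \<le> c2"
    and c1: "(\<integral>\<^sup>+ x. (mixture_density M A S x)\<^sup>2 / ennreal (mv_normal_density 0 K x) \<partial>lborel) \<le> ennreal c1"
    and c2: "(\<integral>\<^sup>+ \<omega>. ennreal ((trace (matrix_inv (A \<omega>) ** K) + trace (matrix_inv K ** A \<omega>)) / 2)
        * indicator (space M - S) \<omega> \<partial>M) \<le> ennreal c2"
  shows "relative_entropy (density lborel (mixture_density M A (space M))) (gaussian_measure K)
    \<le> ereal (c1 / prob S - prob S + c2)"
proof -
  interpret P: pair_sigma_finite M "lborel :: (real ^ 'n) measure" by standard
  let ?\<phi> = "\<lambda>\<omega> x. mv_normal_density 0 (A \<omega>) x"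
  let ?k = "mv_normal_density 0 K"
  have pos: "0 < ?\<phi> \<omega> x" for \<omega> x by (simp add: mv_normal_density_pos A_pos_def)
  have kpos: "0 < ?k x" for x by (simp add: mv_normal_density_pos K)
  define b where "b \<omega> x = (trace (matrix_inv (A \<omega>) ** K) + x \<bullet> (matrix_inv K *v x)) / 2" for \<omega> and x :: "real ^ 'n"
  note psd_inv = A_pos_def[THEN pos_def_matrix_inv, THEN pos_def_imp_psd] K[THEN pos_def_matrix_inv, THEN pos_def_imp_psd]
  have tr0: "0 \<le> trace (matrix_inv (A \<omega>) ** K)" for \<omega>
    by (rule trace_mult_pos_def_nonneg[OF psd_inv(1) K])
  have x0: "0 \<le> x \<bullet> (matrix_inv K *v x)" for x
    using psd_inv(2) by (simp add: psd_matrix_def)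
  have b0: "0 \<le> b \<omega> x" for \<omega> x using tr0 x0 by (simp add: b_def)
  have [measurable]: "(\<lambda>z. b (fst z) (snd z)) \<in> borel_measurable (M \<Otimes>\<^sub>M borel)"
    "(\<lambda>z. b (snd z) (fst z)) \<in> borel_measurable (borel \<Otimes>\<^sub>M M)"
    unfolding b_def by measurable
  have [measurable]: "space M - S \<in> events" by simp
  have [measurable]: "(\<lambda>\<omega>. b \<omega> x) \<in> borel_measurable M" for x
    unfolding b_def by measurable
  have half: "ennreal (t / 2) = ennreal (1 / 2) * ennreal t" for t
  proof -
    have "0 \<le> (1 / 2 :: real)" by simp
    from ennreal_mult'[OF this, of t] show ?thesis by (simp only: times_divide_eq_left mult_1)
  qed
  define h where "h x = (\<integral>\<^sup>+ \<omega>. ennreal (?\<phi> \<omega> x * b \<omega> x) * indicator (space M - S) \<omega> \<partial>M)" for x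
  have hm [measurable]: "h \<in> borel_measurable borel"
    unfolding h_def by measurable
  have "(\<integral>\<^sup>+ x. h x \<partial>lborel)
      = (\<integral>\<^sup>+ \<omega>. (\<integral>\<^sup>+ x. ennreal (?\<phi> \<omega> x * b \<omega> x) * indicator (space M - S) \<omega> \<partial>lborel) \<partial>M)"
    unfolding h_def by (rule P.Fubini') measurable
  also have "\<dots> = (\<integral>\<^sup>+ \<omega>. ennreal ((trace (matrix_inv (A \<omega>) ** K) + trace (matrix_inv K ** A \<omega>)) / 2)
        * indicator (space M - S) \<omega> \<partial>M)"
  proof (intro nn_integral_cong)
    fix \<omega>
    have "(\<integral>\<^sup>+ x. ennreal (?\<phi> \<omega> x * b \<omega> x) \<partial>lborel)
        = (\<integral>\<^sup>+ x. ennreal (b \<omega> x) \<partial>gaussian_measure (A \<omega>))"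
      unfolding gaussian_measure_def b_def
      by (subst nn_integral_density) (auto simp: ennreal_mult'[symmetric] pos less_imp_le)
    also have "\<dots> = (\<integral>\<^sup>+ x. ennreal (trace (matrix_inv (A \<omega>) ** K) / 2)
        + ennreal (1 / 2) * ennreal (x \<bullet> (matrix_inv K *v x)) \<partial>gaussian_measure (A \<omega>))"
      using tr0 x0
      by (intro nn_integral_cong) (simp only: b_def half[symmetric] add_divide_distrib, simp)
    also have "\<dots> = ennreal (trace (matrix_inv (A \<omega>) ** K) / 2) + ennreal (1 / 2) * ennreal (trace (matrix_inv K ** A \<omega>))"
      using prob_space.emeasure_space_1[OF prob_space_gaussian[OF A_pos_def[of \<omega>]]]
      by (simp add: nn_integral_add nn_integral_cmult gaussian_quadratic_form_integral[OF A_pos_def psd_inv(2)])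
    also have "\<dots> = ennreal ((trace (matrix_inv (A \<omega>) ** K) + trace (matrix_inv K ** A \<omega>)) / 2)"
      using tr0 trace_mult_pos_def_nonneg[OF psd_inv(2) A_pos_def]
      by (simp only: half[symmetric] add_divide_distrib) simp
    finally show "(\<integral>\<^sup>+ x. ennreal (?\<phi> \<omega> x * b \<omega> x) * indicator (space M - S) \<omega> \<partial>lborel)
        = ennreal ((trace (matrix_inv (A \<omega>) ** K) + trace (matrix_inv K ** A \<omega>)) / 2) * indicator (space M - S) \<omega>"
      by (simp add: nn_integral_multc b_def)
  qed
  finally have h: "(\<integral>\<^sup>+ x. h x \<partial>lborel) \<le> ennreal c2" using c2 by simp
  note h = enn2real_integrable_le[OF _ h c(2), simplified]
  define f where "f x = enn2real (mixture_density M A (space M) x)" for x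
  define g where "g x = enn2real (mixture_density M A S x)" for x
  have sum1: "(\<integral>\<^sup>+ x. mixture_density M A (space M) x \<partial>lborel) \<le> ennreal 1"
    "(\<integral>\<^sup>+ x. mixture_density M A S x \<partial>lborel) \<le> ennreal 1"
    by (simp_all add: nn_integral_mixture_density emeasure_eq_measure)
  note f = enn2real_integrable_le[OF _ sum1(1), simplified, folded f_def]
  note g = enn2real_integrable_le[OF _ sum1(2), simplified, folded g_def]
  have [measurable]: "f \<in> borel_measurable borel" "g \<in> borel_measurable borel"
    unfolding f_def[abs_def] g_def[abs_def] by measurable
  have g_total: "(\<integral>x. g x \<partial>lborel) = prob S"
    using g(4) by (simp add: nn_integral_mixture_density emeasure_eq_measure)
  have "AE x in lborel. ennreal ((g x)\<^sup>2 / ?k x) = (mixture_density M A S x)\<^sup>2 / ennreal (?k x)"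
    using g(3)
  proof eventually_elim
    case (elim x)
    then have "mixture_density M A S x = ennreal (g x)" by (simp add: g_def)
    then show ?case
      using kpos[of x] by (simp add: g_def divide_ennreal[symmetric] ennreal_power[symmetric])
  qed
  then have chi: "(\<integral>\<^sup>+ x. ennreal ((g x)\<^sup>2 / ?k x) \<partial>lborel) \<le> ennreal c1"
    using c1 by (subst nn_integral_cong_AE)
  have "integrable lborel (\<lambda>x. enn2real (ennreal ((g x)\<^sup>2 / ?k x)))"
    "(\<integral>x. enn2real (ennreal ((g x)\<^sup>2 / ?k x)) \<partial>lborel) \<le> c1"
    using enn2real_integrable_le[OF _ chi c(1)] by auto
  then have chi: "integrable lborel (\<lambda>x. (g x)\<^sup>2 / ?k x)" "(\<integral>x. (g x)\<^sup>2 / ?k x \<partial>lborel) \<le> c1"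
    using kpos by (simp_all add: less_imp_le)
  define U where "U x = (g x)\<^sup>2 / ?k x / prob S - g x + enn2real (h x)" for x
  have U: "integrable lborel U"
    unfolding U_def using chi(1) g(1) h(1) by (simp del: divide_divide_eq_left)
  have pointwise: "AE x in lborel. f x * ln (f x / ?k x) \<le> U x"
    using f(3) h(3)
  proof eventually_elim
    case (elim x)
    have ia: "integrable M (\<lambda>\<omega>. ?\<phi> \<omega> x)"
    proof (rule integrableI_nonneg)
      have "(\<integral>\<^sup>+ \<omega>. ennreal (?\<phi> \<omega> x) \<partial>M) = mixture_density M A (space M) x"
        unfolding mixture_density_def by (intro nn_integral_cong) simp
      then show "(\<integral>\<^sup>+ \<omega>. ennreal (?\<phi> \<omega> x) \<partial>M) < \<infinity>" using elim(1) by simp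
    qed (auto simp: pos less_imp_le)
    have iab: "integrable M (\<lambda>\<omega>. ?\<phi> \<omega> x * b \<omega> x * indicator (space M - S) \<omega>)"
    proof (rule integrableI_nonneg)
      have "(\<integral>\<^sup>+ \<omega>. ennreal (?\<phi> \<omega> x * b \<omega> x * indicator (space M - S) \<omega>) \<partial>M) = h x"
        unfolding h_def by (intro nn_integral_cong) (simp split: split_indicator)
      then show "(\<integral>\<^sup>+ \<omega>. ennreal (?\<phi> \<omega> x * b \<omega> x * indicator (space M - S) \<omega>) \<partial>M) < \<infinity>" using elim(2) by simp
    qed (auto simp: pos less_imp_le b0)
    have "expectation (\<lambda>\<omega>. ?\<phi> \<omega> x) = f x"
      unfolding f_def mixture_density_def
      by (subst integral_eq_nn_integral) (auto simp: pos less_imp_le intro!: arg_cong[where f = enn2real] nn_integral_cong)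
    moreover have "expectation (\<lambda>\<omega>. ?\<phi> \<omega> x * indicator S \<omega>) = g x"
      unfolding g_def mixture_density_def
      by (subst integral_eq_nn_integral)
        (auto simp: pos less_imp_le intro!: arg_cong[where f = enn2real] nn_integral_cong split: split_indicator)
    moreover have "expectation (\<lambda>\<omega>. ?\<phi> \<omega> x * b \<omega> x * indicator (space M - S) \<omega>) = enn2real (h x)"
      unfolding h_def
      by (subst integral_eq_nn_integral)
        (auto simp: pos less_imp_le b0 intro!: arg_cong[where f = enn2real] nn_integral_cong split: split_indicator)
    ultimately show ?case
      using mixture_log_ratio_le[OF ia pos kpos S ln_gaussian_density_ratio_le[OF A_pos_def K, folded b_def] iab]
      by (simp add: U_def)
  qed
  have "AE x in lborel. ennreal (f x) = mixture_density M A (space M) x"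
    using f(3) by eventually_elim (simp add: f_def)
  then have "density lborel (mixture_density M A (space M)) = density lborel (\<lambda>x. ennreal (f x))"
    by (intro density_cong) (auto elim!: eventually_mono)
  moreover have "integrable lborel ?k"
    by (rule integrableI_nonneg) (auto simp: kpos less_imp_le nn_integral_mv_normal_density[OF K])
  then have "relative_entropy (density lborel (\<lambda>x. ennreal (f x))) (gaussian_measure K) \<le> ereal (\<integral>x. U x \<partial>lborel)"
    unfolding gaussian_measure_def
    using f(1) U pointwise kpos
    by (intro relative_entropy_density_le sigma_finite_lborel) (auto simp: f_def)
  moreover have "(\<integral>x. U x \<partial>lborel) \<le> c1 / prob S - prob S + c2"
  proof -
    have "(\<integral>x. U x \<partial>lborel) = (\<integral>x. (g x)\<^sup>2 / ?k x \<partial>lborel) / prob S - prob S + (\<integral>x. enn2real (h x) \<partial>lborel)"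
      unfolding U_def using chi(1) g(1) h(1) by (simp add: g_total del: divide_divide_eq_left)
    also have "\<dots> \<le> c1 / prob S - prob S + c2"
      using chi(2) h(2) by (intro add_mono diff_mono divide_right_mono) auto
    finally show ?thesis .
  qed
  ultimately show ?thesis by (metis ereal_less_eq(3) order_trans)
qed

section \<open>Covariances near the target\<close>

context
  fixes K :: "real ^ 'n ^ 'n"
  assumes K: "pos_def K"
begin

definition rel_dev :: "'a \<Rightarrow> real ^ 'n ^ 'n"
  where "rel_dev \<omega> = (A \<omega> - K) ** matrix_inv K"

text \<open>The threshold is half of the smallest eigenvalue, so that on this event \<open>A\<close> is comparable with \<open>K\<close>.\<close>

definition near :: "'a set"
  where "near = {\<omega> \<in> space M. hs_norm (A \<omega> - K) \<le> min_eigenvalue K / 2}"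

definition near_dev :: "'a \<Rightarrow> real ^ 'n ^ 'n"
  where "near_dev \<omega> = indicator near \<omega> *\<^sub>R rel_dev \<omega>"

lemma near_sets [measurable]: "near \<in> events"
  unfolding near_def by measurable

lemma integrable_indicator_near: "integrable M (indicator near :: _ \<Rightarrow> real)"
  by (intro integrable_real_indicator) (simp_all add: emeasure_eq_measure)

lemma near_dev_measurable [measurable]: "near_dev \<in> borel_measurable M"
  unfolding near_dev_def rel_dev_def by measurable

lemma norm_near_dev_le: "norm (near_dev \<omega>) \<le> 1 / 2 * indicator near \<omega>"
  using gaussian_product_integral_le(2)[OF A_pos_def A_pos_def K, of \<omega> \<omega>]
  by (auto simp: near_dev_def rel_dev_def near_def split: split_indicator)

lemma integrable_near_dev: "integrable M near_dev" "integrable M (\<lambda>\<omega>. (norm (near_dev \<omega>))\<^sup>2)"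
proof -
  have le: "norm (near_dev \<omega>) \<le> 1" for \<omega>
    using norm_near_dev_le[of \<omega>] by (auto split: split_indicator_asm)
  then show "integrable M near_dev" by (intro integrable_const_bound[of _ 1]) auto
  show "integrable M (\<lambda>\<omega>. (norm (near_dev \<omega>))\<^sup>2)"
    using power_le_one[OF norm_ge_zero le] by (intro integrable_const_bound[of _ 1]) auto
qed

lemma norm_expectation_near_dev_le: "norm (expectation near_dev) \<le> prob near / 2"
proof -
  have "norm (expectation near_dev) \<le> expectation (\<lambda>\<omega>. norm (near_dev \<omega>))"
    by (rule integral_norm_bound)
  also have "\<dots> \<le> expectation (\<lambda>\<omega>. 1 / 2 * indicator near \<omega>)"
    using integrable_near_dev integrable_indicator_near norm_near_dev_le by (intro integral_mono) auto
  finally show ?thesis by simp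
qed

lemma expectation_near_dev_square_le: "expectation (\<lambda>\<omega>. (norm (near_dev \<omega>))\<^sup>2) \<le> prob near / 4"
proof -
  have "(norm (near_dev \<omega>))\<^sup>2 \<le> 1 / 4 * indicator near \<omega>" for \<omega>
    using power_mono[OF norm_near_dev_le norm_ge_zero, of \<omega> 2] by (simp add: power2_eq_square split: split_indicator_asm)
  then have "expectation (\<lambda>\<omega>. (norm (near_dev \<omega>))\<^sup>2) \<le> expectation (\<lambda>\<omega>. 1 / 4 * indicator near \<omega>)"
    using integrable_near_dev integrable_indicator_near by (intro integral_mono) auto
  then show ?thesis by simp
qed

text \<open>The square of the mixture density is a double integral over two independent copies of the
  covariance. Truncated deviations vanish off the near event, so the bound on the product integral
  can be written with them throughout, and \<open>tr (D D')\<close> is bilinear: its expectation over the two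
  copies is the trace of the square of the mean. This factorization is where the mean, instead of
  the fluctuation, appears at second order.\<close>

lemma mixture_chi_square_le:
  defines "m \<equiv> expectation near_dev" and "s \<equiv> expectation (\<lambda>\<omega>. (norm (near_dev \<omega>))\<^sup>2)"
  shows "(\<integral>\<^sup>+ x. (mixture_density M A near x)\<^sup>2 / ennreal (mv_normal_density 0 K x) \<partial>lborel)
    \<le> ennreal ((prob near)\<^sup>2 + trace (m ** m) / 2 + 2 * s\<^sup>2)"
proof -
  interpret P: pair_sigma_finite M "lborel :: (real ^ 'n) measure" by standard
  let ?\<phi> = "\<lambda>\<omega> x. mv_normal_density 0 (A \<omega>) x"
  let ?k = "mv_normal_density 0 K"
  have pos: "0 < ?\<phi> \<omega> x" "0 < ?k x" for \<omega> x by (simp_all add: mv_normal_density_pos A_pos_def K)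
  define H where "H \<omega> \<omega>' x = ennreal (?\<phi> \<omega> x * ?\<phi> \<omega>' x / ?k x) * indicator near \<omega> * indicator near \<omega>'" for \<omega> \<omega>' x
  have "(mixture_density M A near x)\<^sup>2 / ennreal (?k x) = (\<integral>\<^sup>+ \<omega>. \<integral>\<^sup>+ \<omega>'. H \<omega> \<omega>' x \<partial>M \<partial>M)" for x
  proof -
    have "H \<omega> \<omega>' x = (ennreal (?\<phi> \<omega> x) * indicator near \<omega>) * (ennreal (?\<phi> \<omega>' x) * indicator near \<omega>') / ennreal (?k x)" for \<omega> \<omega>'
      using pos by (simp add: H_def divide_ennreal[symmetric] ennreal_mult less_imp_le split: split_indicator)
    then show ?thesis
      by (simp add: power2_eq_square mixture_density_def nn_integral_divide nn_integral_cmult nn_integral_multc)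
  qed
  then have "(\<integral>\<^sup>+ x. (mixture_density M A near x)\<^sup>2 / ennreal (?k x) \<partial>lborel)
      = (\<integral>\<^sup>+ x. \<integral>\<^sup>+ \<omega>. \<integral>\<^sup>+ \<omega>'. H \<omega> \<omega>' x \<partial>M \<partial>M \<partial>lborel)"
    by simp
  also have "\<dots> = (\<integral>\<^sup>+ \<omega>. \<integral>\<^sup>+ x. \<integral>\<^sup>+ \<omega>'. H \<omega> \<omega>' x \<partial>M \<partial>lborel \<partial>M)"
    unfolding H_def by (rule P.Fubini') measurable
  also have "\<dots> = (\<integral>\<^sup>+ \<omega>. \<integral>\<^sup>+ \<omega>'. \<integral>\<^sup>+ x. H \<omega> \<omega>' x \<partial>lborel \<partial>M \<partial>M)"
    unfolding H_def by (intro nn_integral_cong P.Fubini') measurable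
  also have "\<dots> \<le> (\<integral>\<^sup>+ \<omega>. ennreal (indicator near \<omega> * prob near + trace (near_dev \<omega> ** m) / 2
      + 2 * (norm (near_dev \<omega>))\<^sup>2 * s) \<partial>M)"
  proof (intro nn_integral_mono)
    fix \<omega>
    define B where "B \<omega>' = indicator near \<omega> * indicator near \<omega>' + trace (near_dev \<omega> ** near_dev \<omega>') / 2
        + 2 * (norm (near_dev \<omega>))\<^sup>2 * (norm (near_dev \<omega>'))\<^sup>2" for \<omega>'
    have B: "(\<integral>\<^sup>+ x. H \<omega> \<omega>' x \<partial>lborel) \<le> ennreal (B \<omega>')" for \<omega>'
    proof (cases "\<omega> \<in> near \<and> \<omega>' \<in> near")
      case True
      then have "(\<integral>\<^sup>+ x. H \<omega> \<omega>' x \<partial>lborel) = (\<integral>\<^sup>+ x. ennreal (?\<phi> \<omega> x * ?\<phi> \<omega>' x / ?k x) \<partial>lborel)"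
        by (simp add: H_def)
      also have "\<dots> \<le> ennreal (1 + trace (rel_dev \<omega> ** rel_dev \<omega>') / 2 + 2 * (norm (rel_dev \<omega>) * norm (rel_dev \<omega>'))\<^sup>2)"
        unfolding rel_dev_def using True
        by (intro gaussian_product_integral_le(1) A_pos_def K) (auto simp: near_def)
      finally show ?thesis
        using True by (simp add: B_def near_dev_def power_mult_distrib mult.assoc)
    qed (auto simp: H_def)
    have B0: "0 \<le> B \<omega>'" for \<omega>'
    proof (cases "\<omega> \<in> near \<and> \<omega>' \<in> near")
      case True
      have "\<bar>trace (near_dev \<omega> ** near_dev \<omega>')\<bar> \<le> norm (near_dev \<omega>) * norm (near_dev \<omega>')"
        by (rule abs_trace_mult_le)
      also have "\<dots> \<le> 1 / 2 * (1 / 2)"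
        using norm_near_dev_le[of \<omega>] norm_near_dev_le[of \<omega>'] True by (intro mult_mono) auto
      finally have "\<bar>trace (near_dev \<omega> ** near_dev \<omega>')\<bar> \<le> 1 / 4" by simp
      moreover have "0 \<le> 2 * (norm (near_dev \<omega>))\<^sup>2 * (norm (near_dev \<omega>'))\<^sup>2" by simp
      ultimately show ?thesis using True unfolding B_def by simp
    next
      case False
      then have "near_dev \<omega> = 0 \<or> near_dev \<omega>' = 0" by (auto simp: near_dev_def)
      then show ?thesis using False by (auto simp: B_def trace_def)
    qed
    have tr: "trace (near_dev \<omega> ** near_dev \<omega>') = trace (near_dev \<omega>' ** near_dev \<omega>)" for \<omega>'
      by (rule trace_mul_sym)
    have int_tr: "integrable M (\<lambda>\<omega>'. trace (near_dev \<omega>' ** near_dev \<omega>))"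
      by (rule integrable_bounded_linear[OF bounded_linear_trace_mult integrable_near_dev(1)])
    note int1 = integrable_indicator_near
    have "(\<integral>\<^sup>+ \<omega>'. \<integral>\<^sup>+ x. H \<omega> \<omega>' x \<partial>lborel \<partial>M) \<le> (\<integral>\<^sup>+ \<omega>'. ennreal (B \<omega>') \<partial>M)"
      by (intro nn_integral_mono B)
    also have "\<dots> = ennreal (expectation B)"
      unfolding B_def[abs_def] tr
      using B0 int_tr int1 integrable_near_dev(2)
      by (intro nn_integral_eq_integral) (auto simp: B_def tr)
    also have "expectation B = indicator near \<omega> * prob near + trace (m ** near_dev \<omega>) / 2 + 2 * (norm (near_dev \<omega>))\<^sup>2 * s"
      unfolding B_def[abs_def] tr m_def s_def
      using int_tr int1 integrable_near_dev(2)
      by (simp add: integral_bounded_linear[OF bounded_linear_trace_mult integrable_near_dev(1)])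
    finally show "(\<integral>\<^sup>+ \<omega>'. \<integral>\<^sup>+ x. H \<omega> \<omega>' x \<partial>lborel \<partial>M)
        \<le> ennreal (indicator near \<omega> * prob near + trace (near_dev \<omega> ** m) / 2 + 2 * (norm (near_dev \<omega>))\<^sup>2 * s)"
      by (simp only: trace_mul_sym[of m])
  qed
  also have "\<dots> = ennreal (expectation (\<lambda>\<omega>. indicator near \<omega> * prob near + trace (near_dev \<omega> ** m) / 2
      + 2 * (norm (near_dev \<omega>))\<^sup>2 * s))"
  proof (rule nn_integral_eq_integral)
    have s0: "0 \<le> s" unfolding s_def by (rule Bochner_Integration.integral_nonneg) simp
    have "integrable M (\<lambda>\<omega>. trace (near_dev \<omega> ** m))"
      by (rule integrable_bounded_linear[OF bounded_linear_trace_mult integrable_near_dev(1)])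
    moreover note integrable_indicator_near
    ultimately show "integrable M (\<lambda>\<omega>. indicator near \<omega> * prob near + trace (near_dev \<omega> ** m) / 2
      + 2 * (norm (near_dev \<omega>))\<^sup>2 * s)"
      using integrable_near_dev(2) by (intro Bochner_Integration.integrable_add) auto
    show "AE \<omega> in M. 0 \<le> indicator near \<omega> * prob near + trace (near_dev \<omega> ** m) / 2 + 2 * (norm (near_dev \<omega>))\<^sup>2 * s"
    proof (rule AE_I2)
      fix \<omega>
      have "\<bar>trace (near_dev \<omega> ** m)\<bar> \<le> norm (near_dev \<omega>) * norm m" by (rule abs_trace_mult_le)
      also have "\<dots> \<le> (1 / 2 * indicator near \<omega>) * (prob near / 2)"
        using norm_near_dev_le norm_expectation_near_dev_le by (intro mult_mono) (auto simp: m_def)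
      finally have "- trace (near_dev \<omega> ** m) \<le> 1 / 4 * (indicator near \<omega> * prob near)" by simp
      moreover have "0 \<le> indicator near \<omega> * prob near" by simp
      moreover have "0 \<le> 2 * (norm (near_dev \<omega>))\<^sup>2 * s" using s0 by simp
      ultimately show "0 \<le> indicator near \<omega> * prob near + trace (near_dev \<omega> ** m) / 2 + 2 * (norm (near_dev \<omega>))\<^sup>2 * s"
        by linarith
    qed
  qed
  also have "expectation (\<lambda>\<omega>. indicator near \<omega> * prob near + trace (near_dev \<omega> ** m) / 2 + 2 * (norm (near_dev \<omega>))\<^sup>2 * s)
      = (prob near)\<^sup>2 + trace (m ** m) / 2 + 2 * s\<^sup>2"
  proof -
    have "integrable M (\<lambda>\<omega>. trace (near_dev \<omega> ** m))"
      by (rule integrable_bounded_linear[OF bounded_linear_trace_mult integrable_near_dev(1)])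
    moreover note integrable_indicator_near
    moreover have "expectation (\<lambda>\<omega>. trace (near_dev \<omega> ** m)) = trace (m ** m)"
      unfolding m_def by (rule integral_bounded_linear[OF bounded_linear_trace_mult integrable_near_dev(1)])
    ultimately show ?thesis
      using integrable_near_dev(2) by (simp add: s_def[symmetric]) (simp add: power2_eq_square)
  qed
  finally show ?thesis .
qed

text \<open>Conditioning on the near event divides the chi-square excess \<open>X\<close> by its probability \<open>q\<close>. Since \<open>X\<close>
  is itself of order \<open>q^2\<close>, this costs no more than \<open>(1 - q) / 4\<close>.\<close>

theorem relative_entropy_near_le:
  assumes c: "0 \<le> c"
    "(\<integral>\<^sup>+ \<omega>. ennreal ((trace (matrix_inv (A \<omega>) ** K) + trace (matrix_inv K ** A \<omega>)) / 2)
        * indicator (space M - near) \<omega> \<partial>M) \<le> ennreal c"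
  shows "relative_entropy (density lborel (mixture_density M A (space M))) (gaussian_measure K)
    \<le> ereal ((norm (expectation near_dev))\<^sup>2 / 2 + 2 * (expectation (\<lambda>\<omega>. (norm (near_dev \<omega>))\<^sup>2))\<^sup>2
        + (1 - prob near) / 4 + c)"
proof -
  define m where "m = expectation near_dev"
  define s where "s = expectation (\<lambda>\<omega>. (norm (near_dev \<omega>))\<^sup>2)"
  define q where "q = prob near"
  define X where "X = (norm m)\<^sup>2 / 2 + 2 * s\<^sup>2"
  have q: "0 \<le> q" "q \<le> 1" by (simp_all add: q_def)
  have "trace (m ** m) \<le> (norm m)\<^sup>2"
    using abs_trace_mult_le[of m m] by (simp add: power2_eq_square)
  then have "ennreal (q\<^sup>2 + trace (m ** m) / 2 + 2 * s\<^sup>2) \<le> ennreal (q\<^sup>2 + X)"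
    by (intro ennreal_leI) (simp add: X_def)
  with mixture_chi_square_le have chi: "(\<integral>\<^sup>+ x. (mixture_density M A near x)\<^sup>2 / ennreal (mv_normal_density 0 K x) \<partial>lborel)
      \<le> ennreal (q\<^sup>2 + X)"
    unfolding m_def s_def q_def by (rule order_trans)
  have "0 \<le> q\<^sup>2 + X" by (simp add: X_def)
  from relative_entropy_mixture_le[OF K near_sets this c(1) chi c(2)]
  have "relative_entropy (density lborel (mixture_density M A (space M))) (gaussian_measure K)
      \<le> ereal ((q\<^sup>2 + X) / q - q + c)"
    by (simp add: q_def)
  also have "(q\<^sup>2 + X) / q - q + c \<le> X + (1 - q) / 4 + c"
  \<comment> \<open>For \<open>q = 0\<close> the quotient is \<open>0\<close>, and the near event contributes nothing.\<close>
  proof (cases "q = 0")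
    case True
    then show ?thesis by (simp add: X_def)
  next
    case False
    with q have q0: "0 < q" by simp
    have "(norm m)\<^sup>2 \<le> (q / 2)\<^sup>2"
      using norm_expectation_near_dev_le by (intro power_mono) (auto simp: m_def q_def)
    moreover have "s\<^sup>2 \<le> (q / 4)\<^sup>2"
      using expectation_near_dev_square_le by (intro power_mono) (auto simp: s_def q_def)
    ultimately have "X \<le> q\<^sup>2 / 4" by (simp add: X_def power2_eq_square)
    then have "X * (1 - q) \<le> q\<^sup>2 / 4 * (1 - q)" using q by (intro mult_right_mono) auto
    also have "\<dots> \<le> q * ((1 - q) / 4)"
    proof -
      have "q * (q * (1 - q)) / 4 \<le> q * (1 - q) / 4"
        using q by (intro divide_right_mono mult_left_le_one_le) auto
      then show ?thesis by (simp add: power2_eq_square mult.assoc)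
    qed
    finally have "X * (1 - q) / q \<le> (1 - q) / 4"
      using q0 by (simp add: pos_divide_le_eq mult.commute)
    moreover have "(q\<^sup>2 + X) / q - q = X + X * (1 - q) / q"
      using q0 by (simp add: field_simps power2_eq_square)
    ultimately show ?thesis by simp
  qed
  finally show ?thesis by (simp add: X_def m_def s_def q_def)
qed

end

end

section \<open>Moments and constants\<close>

lemma (in prob_space) expectation_square_le:
  fixes X :: "'a \<Rightarrow> real"
  assumes "X \<in> borel_measurable M" "integrable M (\<lambda>\<omega>. (X \<omega>)\<^sup>2)"
  shows "(expectation X)\<^sup>2 \<le> expectation (\<lambda>\<omega>. (X \<omega>)\<^sup>2)"
  using variance_positive[of X] variance_eq[OF square_integrable_imp_integrable[OF assms] assms(2)] by simp

text \<open>The Cauchy--Schwarz inequality for \<open>X\<close> and the indicator of \<open>B\<close>.\<close>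

lemma (in prob_space) expectation_indicator_le:
  fixes X :: "'a \<Rightarrow> real"
  assumes X [measurable]: "X \<in> borel_measurable M" "integrable M (\<lambda>\<omega>. (X \<omega>)\<^sup>2)" "\<And>\<omega>. 0 \<le> X \<omega>"
    and B [measurable]: "B \<in> events"
  shows "expectation (\<lambda>\<omega>. X \<omega> * indicator B \<omega>) \<le> sqrt (prob B) * sqrt (expectation (\<lambda>\<omega>. (X \<omega>)\<^sup>2))"
proof -
  let ?e = "expectation (\<lambda>\<omega>. X \<omega> * indicator B \<omega>)"
  have int: "integrable M (\<lambda>\<omega>. X \<omega> * indicator B \<omega>)"
    using square_integrable_imp_integrable[OF X(1,2)] by (intro integrable_real_mult_indicator) auto
  have e0: "0 \<le> ?e" using X(3) by (intro Bochner_Integration.integral_nonneg) auto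
  have "ennreal (?e\<^sup>2) = (\<integral>\<^sup>+ \<omega>. ennreal (X \<omega>) * indicator B \<omega> \<partial>M)\<^sup>2"
  proof -
    have "ennreal ?e = (\<integral>\<^sup>+ \<omega>. ennreal (X \<omega> * indicator B \<omega>) \<partial>M)"
      using int X(3) by (intro nn_integral_eq_integral[symmetric]) auto
    also have "\<dots> = (\<integral>\<^sup>+ \<omega>. ennreal (X \<omega>) * indicator B \<omega> \<partial>M)"
      by (intro nn_integral_cong) (simp split: split_indicator)
    finally show ?thesis using e0 by (simp add: ennreal_power[symmetric])
  qed
  also have "\<dots> \<le> (\<integral>\<^sup>+ \<omega>. ennreal (X \<omega>) ^ 2 \<partial>M) * (\<integral>\<^sup>+ \<omega>. indicator B \<omega> ^ 2 \<partial>M)"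
    by (rule Cauchy_Schwarz_nn_integral) measurable
  also have "(\<integral>\<^sup>+ \<omega>. indicator B \<omega> ^ 2 \<partial>M) = (\<integral>\<^sup>+ \<omega>. indicator B \<omega> \<partial>M)"
    by (intro nn_integral_cong) (simp split: split_indicator)
  also have "\<dots> = ennreal (prob B)" by (simp add: emeasure_eq_measure)
  also have "(\<integral>\<^sup>+ \<omega>. ennreal (X \<omega>) ^ 2 \<partial>M) = ennreal (expectation (\<lambda>\<omega>. (X \<omega>)\<^sup>2))"
    using X by (subst nn_integral_eq_integral[symmetric]) (auto simp: ennreal_power)
  finally have "?e\<^sup>2 \<le> expectation (\<lambda>\<omega>. (X \<omega>)\<^sup>2) * prob B"
    by (simp add: ennreal_mult''[symmetric])
  then have "?e \<le> sqrt (expectation (\<lambda>\<omega>. (X \<omega>)\<^sup>2) * prob B)"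
    by (rule real_le_rsqrt)
  then show ?thesis by (simp add: real_sqrt_mult mult.commute)
qed

lemma S_const_ge: "12 \<le> S_const d" if "1 \<le> d"
proof -
  have "2449 / 1000 \<le> sqrt 6" "1414 / 1000 \<le> sqrt (2::real)"
    by (rule real_le_rsqrt, simp add: power2_eq_square)+
  moreover have "1 \<le> sqrt (real d)" using that by simp
  ultimately show ?thesis unfolding S_const_def by linarith
qed

lemma C1_const_ge: "(hs_norm (matrix_inv K))\<^sup>2 \<le> C1_const (K :: real ^ 'n ^ 'n)"
proof -
  have S: "12 \<le> S_const CARD('n)" by (rule S_const_ge) simp
  have "sqrt 2 \<le> sqrt (3 :: real)" by simp
  then have "1 \<le> sqrt 3 / sqrt (2 :: real)" by simp
  then have "1 * 12 \<le> sqrt 3 / sqrt 2 * S_const CARD('n)"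
    using S by (intro mult_mono) auto
  moreover have "sqrt 3 / (12 * sqrt 2) * S_const CARD('n) = sqrt 3 / sqrt 2 * S_const CARD('n) / 12" by simp
  ultimately have "1 \<le> sqrt 3 / (12 * sqrt 2) * S_const CARD('n)" by linarith
  then have "1 * (hs_norm (matrix_inv K))\<^sup>2 \<le> sqrt 3 / (12 * sqrt 2) * S_const CARD('n) * (hs_norm (matrix_inv K))\<^sup>2"
    by (intro mult_right_mono) auto
  then show ?thesis by (simp add: C1_const_def)
qed

text \<open>The four summands on the left are what the moment estimates consume. The first two occur verbatim
  in \<open>C2_const\<close>; its third summand dominates the next one, and its last summand the number \<open>6\<close>.\<close>

lemma C2_const_ge:
  fixes K :: "real ^ 'n ^ 'n"
  assumes K: "pos_def K"
  shows "1 / min_eigenvalue K ^ 4 *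
    (8 * hs_norm K * sqrt (\<integral>\<omega>. (hs_norm (matrix_inv (A \<omega>)))\<^sup>2 \<partial>M)
     + 8 * hs_norm (matrix_inv K) * sqrt (\<integral>\<omega>. (hs_norm (A \<omega>))\<^sup>2 \<partial>M)
     + 4 * (hs_norm (matrix_inv K))\<^sup>2 * (min_eigenvalue K)\<^sup>2 + 6) \<le> C2_const M A K"
proof -
  let ?d = "real CARD('n)"
  have S: "12 \<le> S_const CARD('n)" by (rule S_const_ge) simp
  have d1: "1 \<le> ?d" by simp
  have "1 / 2 \<le> sqrt 2 / sqrt (3 :: real)"
    by (subst real_sqrt_divide[symmetric], rule real_le_rsqrt) (simp add: power2_eq_square)
  then have "1 / 2 * 12 \<le> sqrt 2 / sqrt 3 * S_const CARD('n)"
    using S by (intro mult_mono) auto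
  then have "4 \<le> sqrt 2 / sqrt 3 * S_const CARD('n)" by simp
  then have t3: "4 * (hs_norm (matrix_inv K))\<^sup>2 * (min_eigenvalue K)\<^sup>2
      \<le> sqrt 2 / sqrt 3 * S_const CARD('n) * (hs_norm (matrix_inv K))\<^sup>2 * ((min_eigenvalue K)\<^sup>2 + 4 * (hs_norm K)\<^sup>2)"
    using S by (intro mult_mono mult_nonneg_nonneg) auto
  have M: "0 \<le> M_const K" by (simp add: M_const_def le_max_iff_disj)
  have t4: "0 \<le> sqrt 70 * ?d\<^sup>2 * (1 / 2 * M_const K + (sqrt 2 + 1) * ?d / 4)"
    using M by simp
  have c0: "6 \<le> c0_const"
  proof -
    have "1 \<le> sqrt (10 :: real)" "0 \<le> sqrt (3 :: real)" "0 \<le> sqrt (30 :: real)"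
      "0 \<le> sqrt (15 :: real)" "0 \<le> sqrt (5 :: real)" by simp_all
    then show ?thesis unfolding c0_const_def by linarith
  qed
  have "6 * 1 \<le> c0_const * ?d\<^sup>2"
    using c0 d1 by (intro mult_mono one_le_power) auto
  then show ?thesis
    unfolding C2_const_def using t3 t4 by (intro mult_left_mono) auto
qed

context gaussian_mixture
begin

text \<open>Moment estimates for the terms of \<open>relative_entropy_near_le\<close>. On the far event
  \<open>1 \<le> (2 |A - K| / \<lambda>)^j\<close> for every \<open>j\<close>. With \<open>j = 8\<close> this bounds the probability of the far event
  by the square of \<open>16 W / \<lambda>^4\<close>, and with \<open>j = 1\<close> it bounds the bias caused by truncating \<open>A - K\<close> by
  \<open>(2 / \<lambda>) E |A - K|^2\<close>, whose square is again of order \<open>W\<close>.\<close>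

theorem relative_entropy_moment_bound:
  fixes K :: "real ^ 'n ^ 'n"
  assumes K: "pos_def K" and int8: "integrable M (\<lambda>\<omega>. hs_norm (A \<omega>) ^ 8)"
    and int_inv: "integrable M (\<lambda>\<omega>. (hs_norm (matrix_inv (A \<omega>)))\<^sup>2)"
  shows "relative_entropy (density lborel (mixture_density M A (space M))) (gaussian_measure K)
    \<le> ereal (C1_const K * (hs_norm (expectation A - K))\<^sup>2
           + C2_const M A K * sqrt (expectation (\<lambda>\<omega>. hs_norm (A \<omega> - K) ^ 8)))"
proof -
  define lam where "lam = min_eigenvalue K"
  have lam: "0 < lam" using pos_def_min_eigenvalue(1)[OF K] by (simp add: lam_def)
  define Ki where "Ki = matrix_inv K"
  define Y where "Y \<omega> = norm (A \<omega> - K)" for \<omega>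
  have [measurable]: "Y \<in> borel_measurable M" unfolding Y_def by measurable
  have Y0: "0 \<le> Y \<omega>" for \<omega> by (simp add: Y_def)
  have pow_le: "t ^ j \<le> 1 + t ^ 8" if "0 \<le> t" "j \<le> 8" for t :: real and j
  proof (cases "t \<le> 1")
    case True
    then show ?thesis using that power_le_one[of t j] by (simp add: add_increasing2)
  next
    case False
    then have "t ^ j \<le> t ^ 8" using that by (intro power_increasing) auto
    then show ?thesis by simp
  qed
  have intA: "integrable M (\<lambda>\<omega>. norm (A \<omega>) ^ j)" if "j \<le> 8" for j
    by (rule Bochner_Integration.integrable_bound[where f = "\<lambda>\<omega>. 1 + norm (A \<omega>) ^ 8"])
      (use int8 pow_le that in auto)
  have Y8: "integrable M (\<lambda>\<omega>. Y \<omega> ^ 8)"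
  proof (rule Bochner_Integration.integrable_bound[where f = "\<lambda>\<omega>. 2 ^ 8 * (norm (A \<omega>) ^ 8 + norm K ^ 8)"])
    show "AE \<omega> in M. norm (Y \<omega> ^ 8) \<le> norm (2 ^ 8 * (norm (A \<omega>) ^ 8 + norm K ^ 8))"
    proof (rule AE_I2)
      fix \<omega>
      let ?m = "max (norm (A \<omega>)) (norm K)"
      have "Y \<omega> \<le> 2 * ?m"
        using norm_triangle_ineq4[of "A \<omega>" K] by (simp add: Y_def)
      then have "Y \<omega> ^ 8 \<le> (2 * ?m) ^ 8" using Y0 by (intro power_mono) auto
      also have "\<dots> \<le> 2 ^ 8 * (norm (A \<omega>) ^ 8 + norm K ^ 8)"
        unfolding power_mult_distrib by (intro mult_left_mono) (auto simp: max_def)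
      finally show "norm (Y \<omega> ^ 8) \<le> norm (2 ^ 8 * (norm (A \<omega>) ^ 8 + norm K ^ 8))"
        using Y0 by simp
    qed
  qed (use int8 in auto)
  have intY: "integrable M (\<lambda>\<omega>. Y \<omega> ^ j)" if "j \<le> 8" for j
    by (rule Bochner_Integration.integrable_bound[where f = "\<lambda>\<omega>. 1 + Y \<omega> ^ 8"])
      (use Y8 Y0 pow_le that in auto)
  define V where "V = expectation (\<lambda>\<omega>. (Y \<omega>)\<^sup>2)"
  define W where "W = sqrt (expectation (\<lambda>\<omega>. Y \<omega> ^ 8))"
  have V0: "0 \<le> V" unfolding V_def by (rule Bochner_Integration.integral_nonneg) simp
  have E8: "0 \<le> expectation (\<lambda>\<omega>. Y \<omega> ^ 8)" by (rule Bochner_Integration.integral_nonneg) simp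
  then have W0: "0 \<le> W" by (simp add: W_def)
  \<comment> \<open>Jensen's inequality for the square, twice.\<close>
  have VW: "V\<^sup>2 \<le> W"
  proof -
    have p: "((Y \<omega>)\<^sup>2)\<^sup>2 = Y \<omega> ^ 4" "(Y \<omega> ^ 4)\<^sup>2 = Y \<omega> ^ 8" for \<omega>
      by (simp_all add: power_mult[symmetric])
    have "V\<^sup>2 \<le> expectation (\<lambda>\<omega>. Y \<omega> ^ 4)"
      unfolding V_def using expectation_square_le[of "\<lambda>\<omega>. (Y \<omega>)\<^sup>2"] intY[of 4] by (simp add: p)
    also have "\<dots> \<le> W"
      unfolding W_def using expectation_square_le[of "\<lambda>\<omega>. Y \<omega> ^ 4"] intY[of 8]
      by (intro real_le_rsqrt) (simp add: p)
    finally show ?thesis .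
  qed
  define far where "far = space M - near K"
  have nearm [measurable]: "near K \<in> events" by (rule near_sets[OF K])
  then have [measurable]: "far \<in> events" by (simp add: far_def)
  have far: "lam / 2 < Y \<omega>" if "\<omega> \<in> far" for \<omega>
    using that by (auto simp: far_def near_def[OF K] lam_def Y_def)
  have far1: "indicator far \<omega> \<le> (2 / lam * Y \<omega>) ^ j" for j \<omega>
  proof (cases "\<omega> \<in> far")
    case True
    then have "1 \<le> 2 / lam * Y \<omega>" using far lam by (simp add: field_simps less_imp_le)
    then show ?thesis using True by (simp add: one_le_power)
  next
    case False
    then show ?thesis using Y0 lam by simp
  qed
  define p where "p = prob far"
  have p: "0 \<le> p" "p \<le> 1" "p = 1 - prob (near K)"
    by (simp_all add: p_def far_def prob_compl[OF nearm])
  have sqrt_p: "sqrt p \<le> 16 * W / lam ^ 4"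
  proof -
    have ind: "indicator far \<omega> \<le> (2 / lam) ^ 8 * Y \<omega> ^ 8" for \<omega>
      using far1[of \<omega> 8] by (simp only: power_mult_distrib)
    have "p = expectation (indicator far)" by (simp add: p_def)
    also have "\<dots> \<le> expectation (\<lambda>\<omega>. (2 / lam) ^ 8 * Y \<omega> ^ 8)"
      using Y8 by (intro integral_mono integrable_real_indicator ind) (auto simp: emeasure_eq_measure)
    also have "\<dots> = (16 / lam ^ 4)\<^sup>2 * expectation (\<lambda>\<omega>. Y \<omega> ^ 8)"
      by (simp add: power_divide power_mult[symmetric])
    finally have "sqrt p \<le> sqrt ((16 / lam ^ 4)\<^sup>2 * expectation (\<lambda>\<omega>. Y \<omega> ^ 8))" by (rule real_sqrt_le_mono)
    then show ?thesis using lam by (simp add: real_sqrt_mult W_def)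
  qed
  have p_le: "p \<le> 16 * W / lam ^ 4"
  proof -
    have "p \<le> sqrt p" using p by (simp add: real_le_rsqrt power2_eq_square mult_left_le)
    with sqrt_p show ?thesis by linarith
  qed
  define a where "a = sqrt (expectation (\<lambda>\<omega>. (norm (A \<omega>))\<^sup>2))"
  define ai where "ai = sqrt (expectation (\<lambda>\<omega>. (norm (matrix_inv (A \<omega>)))\<^sup>2))"
  define c where "c = (norm K * ai + norm Ki * a) / 2 * (16 * W / lam ^ 4)"
  have a0: "0 \<le> a" "0 \<le> ai" by (auto simp: a_def ai_def intro!: Bochner_Integration.integral_nonneg)
  have c0: "0 \<le> c" using a0 W0 lam by (simp add: c_def)
  have far_int: "(\<integral>\<^sup>+ \<omega>. ennreal ((trace (matrix_inv (A \<omega>) ** K) + trace (matrix_inv K ** A \<omega>)) / 2)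
        * indicator (space M - near K) \<omega> \<partial>M) \<le> ennreal c"
  proof -
    define Z where "Z \<omega> = (norm K * norm (matrix_inv (A \<omega>)) + norm Ki * norm (A \<omega>)) / 2" for \<omega>
    have iA: "integrable M (\<lambda>\<omega>. norm (A \<omega>) * indicator far \<omega>)"
      using intA[of 1] by (intro integrable_real_mult_indicator) auto
    have iI: "integrable M (\<lambda>\<omega>. norm (matrix_inv (A \<omega>)) * indicator far \<omega>)"
      using square_integrable_imp_integrable[OF _ int_inv] by (intro integrable_real_mult_indicator) auto
    have "(\<integral>\<^sup>+ \<omega>. ennreal ((trace (matrix_inv (A \<omega>) ** K) + trace (matrix_inv K ** A \<omega>)) / 2)
        * indicator (space M - near K) \<omega> \<partial>M) \<le> (\<integral>\<^sup>+ \<omega>. ennreal (Z \<omega> * indicator far \<omega>) \<partial>M)"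
    proof (intro nn_integral_mono)
      fix \<omega>
      have "trace (matrix_inv (A \<omega>) ** K) \<le> norm K * norm (matrix_inv (A \<omega>))"
        "trace (matrix_inv K ** A \<omega>) \<le> norm Ki * norm (A \<omega>)"
        using abs_trace_mult_le[of "matrix_inv (A \<omega>)" K] abs_trace_mult_le[of Ki "A \<omega>"]
        by (simp_all add: Ki_def mult.commute)
      then show "ennreal ((trace (matrix_inv (A \<omega>) ** K) + trace (matrix_inv K ** A \<omega>)) / 2)
        * indicator (space M - near K) \<omega> \<le> ennreal (Z \<omega> * indicator far \<omega>)"
        by (auto simp: Z_def far_def intro!: ennreal_leI split: split_indicator)
    qed
    also have "\<dots> = ennreal (expectation (\<lambda>\<omega>. norm K / 2 * (norm (matrix_inv (A \<omega>)) * indicator far \<omega>)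
        + norm Ki / 2 * (norm (A \<omega>) * indicator far \<omega>)))"
      using iA iI by (subst nn_integral_eq_integral[symmetric]) (auto intro!: nn_integral_cong simp: Z_def field_simps)
    also have "\<dots> \<le> ennreal c"
    proof (rule ennreal_leI)
      have "expectation (\<lambda>\<omega>. norm (matrix_inv (A \<omega>)) * indicator far \<omega>) \<le> sqrt p * ai"
        unfolding p_def ai_def using int_inv by (intro expectation_indicator_le) auto
      also have "\<dots> \<le> 16 * W / lam ^ 4 * ai" using sqrt_p a0 by (intro mult_right_mono)
      finally have 1: "norm K / 2 * expectation (\<lambda>\<omega>. norm (matrix_inv (A \<omega>)) * indicator far \<omega>)
          \<le> norm K / 2 * (16 * W / lam ^ 4 * ai)" by (intro mult_left_mono) auto
      have "expectation (\<lambda>\<omega>. norm (A \<omega>) * indicator far \<omega>) \<le> sqrt p * a"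
        unfolding p_def a_def using intA[of 2] by (intro expectation_indicator_le) auto
      also have "\<dots> \<le> 16 * W / lam ^ 4 * a" using sqrt_p a0 by (intro mult_right_mono)
      finally have 2: "norm Ki / 2 * expectation (\<lambda>\<omega>. norm (A \<omega>) * indicator far \<omega>)
          \<le> norm Ki / 2 * (16 * W / lam ^ 4 * a)" by (intro mult_left_mono) auto
      have "expectation (\<lambda>\<omega>. norm K / 2 * (norm (matrix_inv (A \<omega>)) * indicator far \<omega>)
          + norm Ki / 2 * (norm (A \<omega>) * indicator far \<omega>))
          = norm K / 2 * expectation (\<lambda>\<omega>. norm (matrix_inv (A \<omega>)) * indicator far \<omega>)
          + norm Ki / 2 * expectation (\<lambda>\<omega>. norm (A \<omega>) * indicator far \<omega>)"
        using iA iI by simp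
      also have "\<dots> \<le> norm K / 2 * (16 * W / lam ^ 4 * ai) + norm Ki / 2 * (16 * W / lam ^ 4 * a)"
        using 1 2 by linarith
      also have "\<dots> = c" by (simp add: c_def algebra_simps add_divide_distrib)
      finally show "expectation (\<lambda>\<omega>. norm K / 2 * (norm (matrix_inv (A \<omega>)) * indicator far \<omega>)
          + norm Ki / 2 * (norm (A \<omega>) * indicator far \<omega>)) \<le> c" .
    qed
    finally show ?thesis .
  qed
  define m where "m = expectation (near_dev K)"
  define s where "s = expectation (\<lambda>\<omega>. (norm (near_dev K \<omega>))\<^sup>2)"
  have s: "2 * s\<^sup>2 \<le> 2 * W / lam ^ 4"
  proof -
    have le: "norm (near_dev K \<omega>) \<le> Y \<omega> / lam" for \<omega>
      using hs_norm_mult_matrix_inv_le[OF K, of "A \<omega> - K"] Y0[of \<omega>] lam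
      by (auto simp: near_dev_def[OF K] rel_dev_def[OF K] Y_def lam_def split: split_indicator)
    have "(norm (near_dev K \<omega>))\<^sup>2 \<le> 1 / lam\<^sup>2 * (Y \<omega>)\<^sup>2" for \<omega>
      using power_mono[OF le norm_ge_zero, of \<omega> 2] by (simp add: power_divide)
    then have "s \<le> expectation (\<lambda>\<omega>. 1 / lam\<^sup>2 * (Y \<omega>)\<^sup>2)"
      unfolding s_def using integrable_near_dev(2)[OF K] intY[of 2] by (intro integral_mono) auto
    then have "s \<le> V / lam\<^sup>2" by (simp add: V_def)
    moreover have "0 \<le> s" unfolding s_def by (rule Bochner_Integration.integral_nonneg) simp
    ultimately have "s\<^sup>2 \<le> (V / lam\<^sup>2)\<^sup>2" by (intro power_mono)
    also have "\<dots> = V\<^sup>2 / lam ^ 4" by (simp add: power_divide power_mult[symmetric])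
    also have "\<dots> \<le> W / lam ^ 4" using VW lam by (intro divide_right_mono) auto
    finally show ?thesis by simp
  qed
  define e where "e = norm (expectation A - K)"
  have m: "(norm m)\<^sup>2 / 2 \<le> (norm Ki)\<^sup>2 * (e\<^sup>2 + 4 / lam\<^sup>2 * W)"
  proof -
    have intAm: "integrable M A"
      using intA[of 1] by (subst integrable_norm_iff[symmetric]) auto
    have intD: "integrable M (\<lambda>\<omega>. A \<omega> - K)" using intAm by simp
    have intf: "integrable M (\<lambda>\<omega>. indicator B \<omega> *\<^sub>R (A \<omega> - K))" if "B \<in> events" for B
      using that intD by (rule integrable_mult_indicator)
    have "m = expectation (\<lambda>\<omega>. (indicator (near K) \<omega> *\<^sub>R (A \<omega> - K)) ** Ki)"
      unfolding m_def near_dev_def[OF K, abs_def] rel_dev_def[OF K] Ki_def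
      by (intro Bochner_Integration.integral_cong refl)
        (simp add: linear_scale[OF bounded_linear.linear[OF bounded_linear_matrix_mult_left]])
    also have "\<dots> = expectation (\<lambda>\<omega>. indicator (near K) \<omega> *\<^sub>R (A \<omega> - K)) ** Ki"
      by (rule integral_bounded_linear[OF bounded_linear_matrix_mult_left intf[OF nearm]])
    finally have m_le: "norm m \<le> norm (expectation (\<lambda>\<omega>. indicator (near K) \<omega> *\<^sub>R (A \<omega> - K))) * norm Ki"
      using hs_norm_mult_le by metis
    have near_le: "norm (expectation (\<lambda>\<omega>. indicator (near K) \<omega> *\<^sub>R (A \<omega> - K))) \<le> e + 2 / lam * V"
    proof -
      have "expectation (\<lambda>\<omega>. indicator (near K) \<omega> *\<^sub>R (A \<omega> - K))
          = expectation (\<lambda>\<omega>. (A \<omega> - K) - indicator far \<omega> *\<^sub>R (A \<omega> - K))"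
        by (intro Bochner_Integration.integral_cong) (auto simp: far_def split: split_indicator)
      also have "\<dots> = (expectation A - K) - expectation (\<lambda>\<omega>. indicator far \<omega> *\<^sub>R (A \<omega> - K))"
        using intAm intf[of far] by (simp add: prob_space)
      finally have "norm (expectation (\<lambda>\<omega>. indicator (near K) \<omega> *\<^sub>R (A \<omega> - K)))
          \<le> e + norm (expectation (\<lambda>\<omega>. indicator far \<omega> *\<^sub>R (A \<omega> - K)))"
        unfolding e_def by (simp add: norm_triangle_ineq4)
      also have "norm (expectation (\<lambda>\<omega>. indicator far \<omega> *\<^sub>R (A \<omega> - K)))
          \<le> expectation (\<lambda>\<omega>. norm (indicator far \<omega> *\<^sub>R (A \<omega> - K)))"
        by (rule integral_norm_bound)
      also have "\<dots> \<le> expectation (\<lambda>\<omega>. 2 / lam * (Y \<omega>)\<^sup>2)"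
      proof (intro integral_mono)
        fix \<omega>
        have "indicator far \<omega> * Y \<omega> \<le> (2 / lam * Y \<omega>) ^ 1 * Y \<omega>"
          using far1[of \<omega> 1] Y0 by (intro mult_right_mono) auto
        then show "norm (indicator far \<omega> *\<^sub>R (A \<omega> - K)) \<le> 2 / lam * (Y \<omega>)\<^sup>2"
          by (simp add: Y_def power2_eq_square mult.assoc)
      qed (use integrable_norm[OF intf[of far]] intY[of 2] in auto)
      finally show ?thesis by (simp add: V_def)
    qed
    have "norm m \<le> (e + 2 / lam * V) * norm Ki"
      by (rule order_trans[OF m_le mult_right_mono[OF near_le norm_ge_zero]])
    then have "(norm m)\<^sup>2 \<le> ((e + 2 / lam * V) * norm Ki)\<^sup>2"
      by (intro power_mono) auto
    also have "\<dots> = (norm Ki)\<^sup>2 * (e + 2 / lam * V)\<^sup>2" by (simp only: power_mult_distrib mult.commute)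
    finally have sq: "(norm m)\<^sup>2 \<le> (norm Ki)\<^sup>2 * (e + 2 / lam * V)\<^sup>2" .
    have "(e + 2 / lam * V)\<^sup>2 \<le> 2 * (e\<^sup>2 + (2 / lam * V)\<^sup>2)"
    proof -
      have "(x + y)\<^sup>2 \<le> 2 * (x\<^sup>2 + y\<^sup>2)" for x y :: real
        using sum_squares_bound[of x y] by (simp add: power2_sum)
      then show ?thesis .
    qed
    also have "(2 / lam * V)\<^sup>2 = 4 / lam\<^sup>2 * V\<^sup>2" by (simp add: power_mult_distrib power_divide)
    also have "2 * (e\<^sup>2 + 4 / lam\<^sup>2 * V\<^sup>2) \<le> 2 * (e\<^sup>2 + 4 / lam\<^sup>2 * W)"
      using VW by (intro mult_left_mono add_left_mono) auto
    finally have "(e + 2 / lam * V)\<^sup>2 \<le> 2 * (e\<^sup>2 + 4 / lam\<^sup>2 * W)" .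
    then have "(norm Ki)\<^sup>2 * (e + 2 / lam * V)\<^sup>2 \<le> (norm Ki)\<^sup>2 * (2 * (e\<^sup>2 + 4 / lam\<^sup>2 * W))"
      by (intro mult_left_mono) auto
    with sq have "(norm m)\<^sup>2 \<le> (norm Ki)\<^sup>2 * (2 * (e\<^sup>2 + 4 / lam\<^sup>2 * W))" by (rule order_trans)
    then have "(norm m)\<^sup>2 / 2 \<le> (norm Ki)\<^sup>2 * (2 * (e\<^sup>2 + 4 / lam\<^sup>2 * W)) / 2" by (rule divide_right_mono) simp
    then show ?thesis by (simp only: mult.left_commute[of _ 2]) simp
  qed
  have "relative_entropy (density lborel (mixture_density M A (space M))) (gaussian_measure K)
      \<le> ereal ((norm m)\<^sup>2 / 2 + 2 * s\<^sup>2 + p / 4 + c)"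
    using relative_entropy_near_le[OF K c0 far_int] by (simp add: m_def s_def p(3))
  also have "(norm m)\<^sup>2 / 2 + 2 * s\<^sup>2 + p / 4 + c \<le> C1_const K * e\<^sup>2 + C2_const M A K * W"
  proof -
    have "(norm m)\<^sup>2 / 2 + 2 * s\<^sup>2 + p / 4 + c
        \<le> (norm Ki)\<^sup>2 * (e\<^sup>2 + 4 / lam\<^sup>2 * W) + 2 * W / lam ^ 4 + (16 * W / lam ^ 4) / 4 + c"
      by (intro add_mono m s divide_right_mono p_le order_refl) simp
    also have "\<dots> = (norm Ki)\<^sup>2 * e\<^sup>2 + 1 / lam ^ 4 *
        (8 * norm K * ai + 8 * norm Ki * a + 4 * (norm Ki)\<^sup>2 * lam\<^sup>2 + 6) * W"
      using lam by (simp add: c_def field_simps power2_eq_square power4_eq_xxxx)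
    also have "\<dots> \<le> C1_const K * e\<^sup>2 + C2_const M A K * W"
      using C1_const_ge[of K] C2_const_ge[OF K, where M = M and A = A] W0
      unfolding Ki_def lam_def a_def ai_def by (intro add_mono mult_right_mono) auto
    finally show ?thesis .
  qed
  finally show ?thesis by (simp add: e_def W_def Y_def)
qed

end

section \<open>The bound for conditionally Gaussian vectors\<close>

theorem theorem2:
  fixes M :: "'a measure" and \<F> :: "'a measure"
    and F G :: "'a \<Rightarrow> real ^ 'd"
    and A :: "'a \<Rightarrow> real ^ 'd ^ 'd" and K :: "real ^ 'd ^ 'd"
  assumes "prob_space M"
    and "psd_matrix K" and "invertible K"
    and "distributed M lborel G (\<lambda>x. ennreal (mv_normal_density 0 K x))"
    and "cond_gaussian M \<F> F A"
    and "integrable M (\<lambda>\<omega>. hs_norm (A \<omega>) ^ 8)"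
    and "measure M {\<omega> \<in> space M. det (A \<omega>) > 0} = 1"
    and "integrable M (\<lambda>\<omega>. (hs_norm (matrix_inv (A \<omega>)))\<^sup>2)"
  shows "relative_entropy (distr M borel F) (distr M borel G) \<le>
    ereal (C1_const K * (hs_norm ((\<integral>\<omega>. A \<omega> \<partial>M) - K))\<^sup>2
           + C2_const M A K * sqrt (\<integral>\<omega>. hs_norm (A \<omega> - K) ^ 8 \<partial>M))"
proof -
  interpret prob_space M by fact
  have K: "pos_def K"
    using assms(2,3) by (intro psd_det_nonzero_imp_pos_def) (simp_all add: invertible_det_nz)
  have cg: "subalgebra M \<F>" "integrable M F" "A \<in> borel_measurable \<F>" "AE \<omega> in M. psd_matrix (A \<omega>)"
    "\<And>y. AE \<omega> in M. complex_cond_exp M \<F> (\<lambda>\<omega>. exp (\<i> * complex_of_real (y \<bullet> F \<omega>))) \<omega> =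
                     complex_of_real (exp (- (y \<bullet> (A \<omega> *v y)) / 2))"
    using assms(5) unfolding cond_gaussian_def by auto
  interpret finite_measure_subalgebra M \<F>
    by standard (rule cg(1))
  have [measurable]: "A \<in> borel_measurable M" "F \<in> borel_measurable M"
    using measurable_from_subalg[OF cg(1,3)] cg(2) by auto
  have "AE \<omega> in M. pos_def (A \<omega>)"
    using cg(4) AE_prob_1[OF assms(7)] by eventually_elim (auto intro: psd_det_nonzero_imp_pos_def)
  then obtain N where N: "{\<omega> \<in> space M. \<not> pos_def (A \<omega>)} \<subseteq> N" "emeasure M N = 0" "N \<in> events"
    by (rule AE_E)
  \<comment> \<open>A version of the covariance that is positive definite everywhere.\<close>
  define A' where "A' \<omega> = (if \<omega> \<in> space M - N then A \<omega> else K)" for \<omega>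
  have "AE \<omega> in M. \<omega> \<notin> N"
    using N by (intro AE_not_in) (simp add: null_sets_def)
  then have eq: "AE \<omega> in M. A' \<omega> = A \<omega>"
    using AE_space by eventually_elim (simp add: A'_def)
  have [measurable]: "A' \<in> borel_measurable M"
    unfolding A'_def using N(3) by measurable
  interpret gaussian_mixture M A'
    by standard (use N(1) K in \<open>auto simp: A'_def\<close>)
  have cong: "(\<integral>\<omega>. h (A' \<omega>) \<partial>M) = (\<integral>\<omega>. h (A \<omega>) \<partial>M)" if "h \<in> borel_measurable borel"
    for h :: "real ^ 'd ^ 'd \<Rightarrow> 'z::{banach, second_countable_topology}"
    using that eq by (intro integral_cong_AE) (auto elim!: eventually_mono)
  have law: "distr M borel F = density lborel (mixture_density M A' (space M))"
  proof (rule distr_eq_mixture)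
    fix y
    let ?f = "\<lambda>\<omega>. iexp (y \<bullet> F \<omega>)"
    have int: "integrable M ?f" by (rule integrable_const_bound[of _ 1]) auto
    have "Re (CLINT \<omega>|M. ?f \<omega>) = (\<integral>\<omega>. real_cond_exp M \<F> (\<lambda>\<omega>. Re (?f \<omega>)) \<omega> \<partial>M)"
      using real_cond_exp_int(2)[OF integrable_Re[OF int]] integral_Re[OF int] by simp
    also have "\<dots> = (\<integral>\<omega>. exp (- (y \<bullet> (A' \<omega> *v y)) / 2) \<partial>M)"
      using cg(5)[of y] eq
      by (intro integral_cong_AE) (auto elim!: eventually_elim2 simp: complex_cond_exp_def complex_eq_iff)
    finally have re: "Re (CLINT \<omega>|M. ?f \<omega>) = (\<integral>\<omega>. exp (- (y \<bullet> (A' \<omega> *v y)) / 2) \<partial>M)" .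
    have "Im (CLINT \<omega>|M. ?f \<omega>) = (\<integral>\<omega>. real_cond_exp M \<F> (\<lambda>\<omega>. Im (?f \<omega>)) \<omega> \<partial>M)"
      using real_cond_exp_int(2)[OF integrable_Im[OF int]] integral_Im[OF int] by simp
    also have "\<dots> = (\<integral>\<omega>. 0 \<partial>M)"
      using cg(5)[of y]
      by (intro integral_cong_AE) (auto elim!: eventually_mono simp: complex_cond_exp_def complex_eq_iff)
    finally show "(CLINT \<omega>|M. ?f \<omega>) = (\<integral>\<omega>. complex_of_real (exp (- (y \<bullet> (A' \<omega> *v y)) / 2)) \<partial>M)"
      by (simp add: complex_eq_iff re)
  qed simp
  have G: "distr M borel G = gaussian_measure K"
    using assms(4) by (simp add: distributed_def gaussian_measure_def cong: distr_cong)
  have int: "integrable M (\<lambda>\<omega>. hs_norm (A' \<omega>) ^ 8)" "integrable M (\<lambda>\<omega>. (hs_norm (matrix_inv (A' \<omega>)))\<^sup>2)"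
    by (rule integrable_cong_AE_imp[OF assms(6)] integrable_cong_AE_imp[OF assms(8)];
        use eq in \<open>auto elim!: eventually_mono\<close>)+
  have C2: "C2_const M A' K = C2_const M A K"
    unfolding C2_const_def
    using cong[of "\<lambda>B. (hs_norm (matrix_inv B))\<^sup>2"] cong[of "\<lambda>B. (hs_norm B)\<^sup>2"] by simp
  have E: "expectation A' = expectation A"
    "expectation (\<lambda>\<omega>. hs_norm (A' \<omega> - K) ^ 8) = expectation (\<lambda>\<omega>. hs_norm (A \<omega> - K) ^ 8)"
    using cong[of "\<lambda>B. B"] cong[of "\<lambda>B. hs_norm (B - K) ^ 8"] by simp_all
  have "relative_entropy (distr M borel F) (distr M borel G)
      \<le> ereal (C1_const K * (hs_norm (expectation A' - K))\<^sup>2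
           + C2_const M A' K * sqrt (expectation (\<lambda>\<omega>. hs_norm (A' \<omega> - K) ^ 8)))"
    unfolding law G by (rule relative_entropy_moment_bound[OF K int])
  then show ?thesis
    by (simp only: C2 E)
qed

end
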